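(* Let $\beta>0$, $x\in(\lambda_t^-,\lambda^+)$, and let $n,m\to\infty$ with $\frac mn\to\frac1\beta$. For any $t<\bar\lambda-x$ and all sufficiently large $M$, $$\lim\frac1n\log\Pr\Big(\frac1n\sum_{i=1}^n(\lambda_i-x)Y_{M,i}\le t\,\Big|\,\boldsymbol\lambda\Big)=-\psi_{x,Y_M}^*(t)=-\sup_{\alpha<0}[\alpha t-\psi_{x,Y_M}(\alpha)]$$ almost surely in $\boldsymbol\lambda$. Similarly, for any $t>\bar\lambda-x$ and all sufficiently large $M$, $$\lim\frac1n\log\Pr\Big(\frac1n\sum_{i=1}^n(\lambda_i-x)Y_{M,i}\ge t\,\Big|\,\boldsymbol\lambda\Big)=-\psi_{x,Y_M}^*(t)=-\sup_{\alpha>0}[\alpha t-\psi_{x,Y_M}(\alpha)]$$ almost surely in $\boldsymbol\lambda$.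
   Context: $\mathbf H\in\mathbb C^{n\times m}$ has i.i.d. $\mathcal{CN}(0,1)$ entries and $\boldsymbol\lambda=(\lambda_1,\dots,\lambda_n)$ are the eigenvalues of $\frac1m\mathbf H\mathbf H^\dagger$. For $M>0$, $Y_M$ is the random variable with density $e^{-y}/(1-e^{-M})$ on $[0,M]$ (an Exp(1) variable conditioned to lie in $[0,M]$), and $Y_{M,1},\dots,Y_{M,n}$ are i.i.d. copies independent of $\mathbf H$. Let $\lambda^\pm=(1\pm\sqrt\beta)^2$, $\mu_\lambda$ the probability measure $d\mu_\lambda=\Big((1-\tfrac1\beta)^+\delta(\lambda)+\frac{\sqrt{(\lambda-\lambda^-)^+(\lambda^+-\lambda)^+}}{2\pi\beta\lambda}\Big)d\lambda$, $\lambda_t^-=0$ if $\beta\ge1$ and $=\lambda^-$ if $\beta<1$, $\bar\lambda=\int\lambda\,d\mu_\lambda$. Define $\psi_{x,Y_M}(\alpha)=\int\log\mathrm E_{Y_M}[e^{\alpha(\lambda-x)Y_M}]\,d\mu_\lambda$ and $\psi_{x,Y_M}^*(t)=\sup_{\alpha\in\mathbb R}[\alpha t-\psi_{x,Y_M}(\alpha)]$. *)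

theory Defs
  imports "HOL-Probability.Probability" "Jordan_Normal_Form.Schur_Decomposition"
    "Jordan_Normal_Form.Char_Poly"
begin

(* Marchenko--Pastur edges lambda^{+-} = (1 +- sqrt beta)^2 *)
definition mp_plus :: "real \<Rightarrow> real" where
  "mp_plus \<beta> = (1 + sqrt \<beta>)^2"
definition mp_minus :: "real \<Rightarrow> real" where
  "mp_minus \<beta> = (1 - sqrt \<beta>)^2"

definition mp_minus_t :: "real \<Rightarrow> real" where
  "mp_minus_t \<beta> = (if \<beta> \<ge> 1 then 0 else mp_minus \<beta>)"

definition mp_density :: "real \<Rightarrow> real \<Rightarrow> real" where
  "mp_density \<beta> l =
     sqrt (max 0 (l - mp_minus \<beta>) * max 0 (mp_plus \<beta> - l)) / (2 * pi * \<beta> * l)"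

(* integral of g against mu_lambda = (1-1/beta)^+ delta_0 + density part *)
definition mp_integral :: "real \<Rightarrow> (real \<Rightarrow> real) \<Rightarrow> real" where
  "mp_integral \<beta> g = max 0 (1 - 1 / \<beta>) * g 0 + (LINT l|lborel. mp_density \<beta> l * g l)"

definition mp_mean :: "real \<Rightarrow> real" where
  "mp_mean \<beta> = mp_integral \<beta> (\<lambda>l. l)"

(* law of Y_M: Exp(1) conditioned on [0,M] *)
definition Y_dist :: "real \<Rightarrow> real measure" where
  "Y_dist M = density lborel
     (\<lambda>y. ennreal (indicator {0..M} y * exp (- y) / (1 - exp (- M))))"

definition mgf_Y :: "real \<Rightarrow> real \<Rightarrow> real" where
  "mgf_Y M s = (\<integral>y. exp (s * y) \<partial>(Y_dist M))"

definition psi :: "real \<Rightarrow> real \<Rightarrow> real \<Rightarrow> real \<Rightarrow> real" where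
  "psi \<beta> x M \<alpha> = mp_integral \<beta> (\<lambda>l. ln (mgf_Y M (\<alpha> * (l - x))))"

definition psi_sup :: "real \<Rightarrow> real \<Rightarrow> real \<Rightarrow> real set \<Rightarrow> real \<Rightarrow> ereal" where
  "psi_sup \<beta> x M A t = (SUP \<alpha>\<in>A. ereal (\<alpha> * t - psi \<beta> x M \<alpha>))"

definition psi_star :: "real \<Rightarrow> real \<Rightarrow> real \<Rightarrow> real \<Rightarrow> ereal" where
  "psi_star \<beta> x M t = psi_sup \<beta> x M UNIV t"

(* eigenvalues (with multiplicity, sorted increasingly) of a matrix whose
   characteristic polynomial splits over the reals *)
definition real_eigvals :: "complex mat \<Rightarrow> real list" where
  "real_eigvals A = (SOME ls. sorted ls \<and> length ls = dim_row A \<and>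
      char_poly A = (\<Prod>l\<leftarrow>ls. [:- complex_of_real l, 1:]))"

definition sample_cov_eigvals :: "nat \<Rightarrow> nat \<Rightarrow> (nat \<Rightarrow> nat \<Rightarrow> complex) \<Rightarrow> real list" where
  "sample_cov_eigvals n m h =
     (let Hm = mat n m (\<lambda>(i, j). h i j)
      in real_eigvals (complex_of_real (1 / real m) \<cdot>\<^sub>m (Hm * mat_adjoint Hm)))"

(* Pr( (1/n) sum (lambda_i - x) Y_{M,i} <= t | lambda ), Y_{M,i} iid independent of lambda *)
definition cond_prob_le :: "real \<Rightarrow> real \<Rightarrow> real \<Rightarrow> real list \<Rightarrow> real" where
  "cond_prob_le M x t ls =
     measure (PiM {..<length ls} (\<lambda>_. Y_dist M))
       {y \<in> space (PiM {..<length ls} (\<lambda>_. Y_dist M)).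
          (1 / real (length ls)) * (\<Sum>i<length ls. (ls ! i - x) * y i) \<le> t}"

definition cond_prob_ge :: "real \<Rightarrow> real \<Rightarrow> real \<Rightarrow> real list \<Rightarrow> real" where
  "cond_prob_ge M x t ls =
     measure (PiM {..<length ls} (\<lambda>_. Y_dist M))
       {y \<in> space (PiM {..<length ls} (\<lambda>_. Y_dist M)).
          (1 / real (length ls)) * (\<Sum>i<length ls. (ls ! i - x) * y i) \<ge> t}"

(* Random matrices H_n (n x m_n), on a common probability space Omega, with
   i.i.d. CN(0,1) entries (density exp(-|z|^2)/pi on C). *)
definition gaussian_model :: "'w measure \<Rightarrow> (nat \<Rightarrow> nat) \<Rightarrow> (nat \<Rightarrow> 'w \<Rightarrow> nat \<Rightarrow> nat \<Rightarrow> complex) \<Rightarrow> bool" where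
  "gaussian_model \<Omega> m H \<longleftrightarrow> prob_space \<Omega> \<and>
     (\<forall>n. prob_space.indep_vars \<Omega> (\<lambda>_. borel) (\<lambda>(i, j) \<omega>. H n \<omega> i j) ({..<n} \<times> {..<m n}) \<and>
          (\<forall>i<n. \<forall>j<m n. distributed \<Omega> lborel (\<lambda>\<omega>. H n \<omega> i j)
              (\<lambda>z. ennreal (exp (- (cmod z * cmod z)) / pi))))"

end

theory Submission
  imports Defs "HOL-Probability.Hoeffding" "HOL-Real_Asymp.Real_Asymp"
begin

text \<open>
  The spectrum enters only through limits of empirical averages. Removing one column of \<open>H\<close> is a
  rank-one update of \<open>s + H H\<^sup>* / m\<close>, and the removed column is independent of the remaining
  resolvent, so the Gaussian quadratic form it enters concentrates, with exponentially small failure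
  probability, at a normalised trace. Pathwise this makes the Stieltjes transform \<open>g\<close> of the spectrum at
  \<open>- s\<close> an approximate solution of \<open>s g + g / (1 + \<beta> g) = 1\<close>, the equation of the Marchenko--Pastur
  law; the Borel--Cantelli lemma gives almost sure convergence for all rational \<open>s > 0\<close>. Together with
  convergence of the mean and Weierstrass approximation in the variable \<open>1 / (1 + \<lambda>)\<close>, this yields
  convergence of averages of continuous functions of linear growth, in particular of the conditional
  cumulant generating functions. The tail asymptotics then follow from the Chernoff bound and an
  exponential change of measure; for large \<open>M\<close> the level \<open>t\<close> lies strictly inside the range
  of \<open>\<psi>'\<close>, because \<open>\<mu>\<^sub>\<lambda>\<close> charges both sides of \<open>x\<close>.
\<close>

section \<open>Hermitian kernels and rank-one updates of resolvents\<close>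

text \<open>The averaged functions grow linearly in the eigenvalue, so weak convergence of the
  spectrum alone is too little. Large eigenvalues are controlled through the mean: its convergence
  to the mean of the limit law acts as uniform integrability. Truncation at \<open>M\<close> matters
  here: the generating function of an exponential variable is infinite from parameter 1 on, whereas
  that of \<open>Y_dist M\<close> is finite everywhere and has a Lipschitz logarithm. Working at
  \<open>- s\<close> keeps everything real: the resolvent is bounded by \<open>1 / s\<close>, and
  \<open>s g + g / (1 + \<beta> g)\<close> increases in \<open>g\<close> with slope at least
  \<open>s\<close>, so an approximate solution is close to the exact one. The almost sure event is a
  deterministic predicate on eigenvalue lists in which neither \<open>M\<close> nor \<open>t\<close>
  occurs; tails are then analysed for one fixed sequence of lists. The threshold on \<open>M\<close>
  depends only on \<beta>, \<open>x\<close>, \<open>t\<close>. It brings the mean of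
  \<open>Y_dist M\<close>, which tends to 1, so close to 1 that \<open>t\<close> lies on the proper
  side of the slope at 0, and it makes the Legendre objective negative at some point of the
  half-line, so that the supremum is attained before that point.\<close>

definition hvec :: "'i set \<Rightarrow> ('i \<Rightarrow> 'i \<Rightarrow> complex) \<Rightarrow> ('i \<Rightarrow> complex) \<Rightarrow> 'i \<Rightarrow> complex" where
  "hvec I K x i = (\<Sum>j\<in>I. K i j * x j)"

definition hprod :: "'i set \<Rightarrow> ('i \<Rightarrow> complex) \<Rightarrow> ('i \<Rightarrow> complex) \<Rightarrow> complex" where
  "hprod I x y = (\<Sum>i\<in>I. cnj (x i) * y i)"

text \<open>Index sets of any type keep these notions usable for rows, for the pairs that make up
  one column, and in inductions over finite sets. For a hermitian kernel the value under
  \<open>Re\<close> is already real, see \<open>hprod_hvec_real\<close>.\<close>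

definition hform :: "'i set \<Rightarrow> ('i \<Rightarrow> 'i \<Rightarrow> complex) \<Rightarrow> ('i \<Rightarrow> complex) \<Rightarrow> real" where
  "hform I K x = Re (hprod I x (hvec I K x))"

definition sqn :: "'i set \<Rightarrow> ('i \<Rightarrow> complex) \<Rightarrow> real" where
  "sqn I x = (\<Sum>i\<in>I. (cmod (x i))^2)"

definition herm :: "'i set \<Rightarrow> ('i \<Rightarrow> 'i \<Rightarrow> complex) \<Rightarrow> bool" where
  "herm I K \<longleftrightarrow> (\<forall>i\<in>I. \<forall>j\<in>I. K j i = cnj (K i j))"

definition htrace :: "'i set \<Rightarrow> ('i \<Rightarrow> 'i \<Rightarrow> complex) \<Rightarrow> real" where
  "htrace I K = (\<Sum>i\<in>I. Re (K i i))"

definition inv_on :: "'i set \<Rightarrow> ('i \<Rightarrow> 'i \<Rightarrow> complex) \<Rightarrow> ('i \<Rightarrow> 'i \<Rightarrow> complex) \<Rightarrow> bool" where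
  "inv_on I B G \<longleftrightarrow> (\<forall>i\<in>I. \<forall>k\<in>I. (\<Sum>l\<in>I. B i l * G l k) = (if i = k then 1 else 0)
      \<and> (\<Sum>l\<in>I. G i l * B l k) = (if i = k then 1 else 0))"

lemma hermD: "herm I K \<Longrightarrow> i \<in> I \<Longrightarrow> j \<in> I \<Longrightarrow> K j i = cnj (K i j)"
  unfolding herm_def by blast

lemma hprod_self: "hprod I x x = complex_of_real (sqn I x)"
  unfolding hprod_def sqn_def of_real_sum
  by (intro sum.cong refl) (simp add: mult.commute complex_norm_square del: of_real_power)

lemma sqn_nonneg [simp]: "0 \<le> sqn I x"
  by (auto simp: sqn_def intro!: sum_nonneg)

lemma hprod_cong: "(\<And>i. i \<in> I \<Longrightarrow> x i = x' i) \<Longrightarrow> (\<And>i. i \<in> I \<Longrightarrow> y i = y' i) \<Longrightarrow>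
    hprod I x y = hprod I x' y'"
  unfolding hprod_def by (intro sum.cong) auto

lemma cnj_hprod: "cnj (hprod I x y) = hprod I y x"
  unfolding hprod_def by (auto intro!: sum.cong simp: mult.commute)

lemma hprod_hvec_herm:
  assumes "herm I K"
  shows "hprod I x (hvec I K y) = hprod I (hvec I K x) y"
proof -
  have "hprod I x (hvec I K y) = (\<Sum>i\<in>I. \<Sum>j\<in>I. cnj (x i) * K i j * y j)"
    by (auto simp: hprod_def hvec_def sum_distrib_left mult.assoc)
  also have "\<dots> = (\<Sum>j\<in>I. \<Sum>i\<in>I. cnj (x i) * K i j * y j)" by (rule sum.swap)
  also have "\<dots> = hprod I (hvec I K x) y"
  proof -
    have "cnj (x i) * K i j * y j = cnj (K j i * x i) * y j" if "i \<in> I" "j \<in> I" for i j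
      using hermD[OF assms that] by simp
    then show ?thesis by (auto simp: hprod_def hvec_def sum_distrib_right intro!: sum.cong)
  qed
  finally show ?thesis .
qed

lemma hprod_hvec_real:
  assumes "herm I K"
  shows "hprod I x (hvec I K x) = complex_of_real (hform I K x)"
proof -
  have "cnj (hprod I x (hvec I K x)) = hprod I x (hvec I K x)"
    using hprod_hvec_herm[OF assms] cnj_hprod by metis
  then show ?thesis unfolding hform_def by (metis Reals_cnj_iff of_real_Re)
qed

lemma inv_on_hvec:
  assumes "finite I" "inv_on I B G" "i \<in> I"
  shows "hvec I B (hvec I G x) i = x i" "hvec I G (hvec I B x) i = x i"
proof -
  have *: "hvec I B (hvec I G x) i = (\<Sum>k\<in>I. (\<Sum>l\<in>I. B i l * G l k) * x k)" for B G
    unfolding hvec_def sum_distrib_left sum_distrib_right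
    by (subst sum.swap) (simp add: mult.assoc)
  have d: "(\<Sum>k\<in>I. (if i = k then 1 else 0) * x k) = x i"
    using assms by (simp add: if_distrib[of "\<lambda>c. c * _"] sum.delta cong: if_cong)
  show "hvec I B (hvec I G x) i = x i" "hvec I G (hvec I B x) i = x i"
    unfolding * using assms by (simp_all add: inv_on_def d)
qed

text \<open>Since \<open>B\<close> is hermitian, it sends the conjugated row \<open>k\<close> of
  \<open>G\<close> to the unit vector at \<open>k\<close>; applying \<open>G\<close> identifies that
  conjugated row with column \<open>k\<close> of \<open>G\<close>.\<close>

lemma inv_on_herm:
  assumes "finite I" "herm I B" "inv_on I B G"
  shows "herm I G"
  unfolding herm_def
proof (intro ballI)
  fix i k assume ik: "i \<in> I" "k \<in> I"
  define x where "x p = cnj (G k p)" for p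
  have Bx: "hvec I B x l = (if k = l then 1 else 0)" if "l \<in> I" for l
  proof -
    have "B l p * x p = cnj (G k p * B p l)" if "p \<in> I" for p
      using hermD[OF assms(2) that \<open>l \<in> I\<close>] by (simp add: x_def)
    then have "hvec I B x l = cnj (\<Sum>p\<in>I. G k p * B p l)"
      unfolding hvec_def cnj_sum by (intro sum.cong refl)
    also have "(\<Sum>p\<in>I. G k p * B p l) = (if k = l then 1 else 0)"
      using assms(3) that ik unfolding inv_on_def by blast
    finally show ?thesis by simp
  qed
  have "x i = hvec I G (hvec I B x) i" using inv_on_hvec(2)[OF assms(1,3) ik(1)] by simp
  also have "\<dots> = (\<Sum>l\<in>I. G i l * (if k = l then 1 else 0))"
    unfolding hvec_def[of I G] using Bx by simp
  also have "\<dots> = G i k" using assms(1) ik by (simp add: if_distrib[of "\<lambda>c. _ * c"] sum.delta cong: if_cong)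
  finally show "G k i = cnj (G i k)" by (metis x_def complex_cnj_cnj)
qed

text \<open>For \<open>w = G x\<close> the form of \<open>B\<close> at \<open>w\<close> equals the
  form of \<open>G\<close> at \<open>x\<close>, so positivity of \<open>B\<close> transfers to
  \<open>G\<close>. The upper bound comes from expanding the nonnegative squared norm of
  \<open>x - s w\<close>.\<close>

lemma resolvent_bounds:
  assumes I: "finite I" and B: "herm I B" and G: "inv_on I B G" and s: "s > 0"
    and pos: "\<And>x. s * sqn I x \<le> hform I B x"
  shows "s * sqn I (hvec I G x) \<le> hform I G x" "0 \<le> hform I G x" "hform I G x \<le> sqn I x / s"
proof -
  define w where "w = hvec I G x"
  have hG: "herm I G" by (rule inv_on_herm[OF I B G])
  have "hprod I w (hvec I B w) = hprod I w x"
    by (intro hprod_cong) (auto simp: w_def inv_on_hvec[OF I G])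
  moreover have wx2: "hprod I w x = complex_of_real (hform I G x)"
    unfolding w_def hprod_hvec_herm[OF hG, symmetric] by (rule hprod_hvec_real[OF hG])
  ultimately have wx: "hform I B w = hform I G x" "hprod I w x = complex_of_real (hform I G x)"
    unfolding hform_def[of I B] by simp_all
  show 1: "s * sqn I (hvec I G x) \<le> hform I G x" using pos[of w] wx by (simp add: w_def)
  have "0 \<le> s * sqn I w" using s by simp
  then show "0 \<le> hform I G x" using order_trans[OF _ 1[folded w_def]] by (simp add: w_def)
  have "0 \<le> sqn I (\<lambda>i. x i - of_real s * w i)" by simp
  also have "complex_of_real (sqn I (\<lambda>i. x i - of_real s * w i))
      = hprod I x x - s * hprod I x w - s * hprod I w x + s^2 * hprod I w w"
    unfolding hprod_self[symmetric]
    by (simp add: hprod_def algebra_simps sum.distrib sum_subtractf sum_distrib_left power2_eq_square)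
  then have "sqn I (\<lambda>i. x i - of_real s * w i) = Re (hprod I x x - s * hprod I x w - s * hprod I w x + s^2 * hprod I w w)"
    by (metis Re_complex_of_real)
  also have "\<dots> = sqn I x - 2 * s * hform I G x + s^2 * sqn I w"
    using wx(2) cnj_hprod[of I w x] by (simp add: hprod_self complex_eq_iff flip: of_real_power)
  also have "\<dots> \<le> sqn I x - 2 * s * hform I G x + s * hform I G x"
    using mult_left_mono[OF 1, of s] s by (simp add: w_def power2_eq_square mult.assoc)
  finally show "hform I G x \<le> sqn I x / s" using s by (simp add: field_simps)
qed

text \<open>Sherman--Morrison: with \<open>w = G v\<close> the updated kernel maps \<open>w\<close>
  to \<open>(1 + q) v\<close>, hence \<open>G' v = w / (1 + q)\<close>. The trace drops by
  \<open>|w|^2 / (1 + q)\<close>, and \<open>s |w|^2 \<le> q\<close> bounds this by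
  \<open>1 / s\<close>, whatever the dimension.\<close>

lemma leave_one_out:
  assumes I: "finite I" and B: "herm I B" and G: "inv_on I B G" and s: "s > 0"
    and pos: "\<And>x. s * sqn I x \<le> hform I B x"
    and G': "inv_on I B' G'"
    and B': "\<And>i k. i \<in> I \<Longrightarrow> k \<in> I \<Longrightarrow> B' i k = B i k + v i * cnj (v k)"
  defines "q \<equiv> hform I G v"
  shows "hform I G' v = q / (1 + q)" "0 \<le> htrace I G - htrace I G'" "htrace I G - htrace I G' \<le> 1 / s"
proof -
  have hG: "herm I G" by (rule inv_on_herm[OF I B G])
  have hB': "herm I B'"
    unfolding herm_def
  proof (intro ballI)
    fix i j assume ij: "i \<in> I" "j \<in> I"
    then have "B j i = cnj (B i j)" using B unfolding herm_def by blast
    then show "B' j i = cnj (B' i j)" using ij by (simp add: B')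
  qed
  have hG': "herm I G'" by (rule inv_on_herm[OF I hB' G'])
  define w where "w = hvec I G v"
  have q0: "q \<ge> 0" "s * sqn I w \<le> q"
    unfolding q_def w_def by (rule resolvent_bounds[OF I B G s pos])+
  have vw: "hprod I v w = complex_of_real q" unfolding w_def q_def by (rule hprod_hvec_real[OF hG])
  have B'v: "hvec I B' x i = hvec I B x i + v i * hprod I v x" if "i \<in> I" for x i
    using that by (simp add: hvec_def hprod_def B' algebra_simps sum.distrib sum_distrib_left)
  have B'w: "hvec I B' w i = (1 + q) * v i" if "i \<in> I" for i
    using that by (simp add: B'v vw) (simp add: w_def inv_on_hvec[OF I G] algebra_simps)
  have hv_cong: "hvec I K x i = hvec I K y i" if "\<And>j. j \<in> I \<Longrightarrow> x j = y j" for K x y i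
    using that by (simp add: hvec_def)
  have G'v: "hvec I G' v i = w i / (1 + q)" if "i \<in> I" for i
  proof -
    have "w i = hvec I G' (hvec I B' w) i" using that by (simp add: inv_on_hvec[OF I G'])
    also have "\<dots> = hvec I G' (\<lambda>i. (1+q) * v i) i" by (rule hv_cong) (rule B'w)
    also have "\<dots> = (1 + q) * hvec I G' v i" by (simp add: hvec_def sum_distrib_left mult_ac)
    finally have "w i = complex_of_real (1 + q) * hvec I G' v i" by simp
    moreover have "complex_of_real (1 + q) \<noteq> 0" using q0 unfolding of_real_eq_0_iff by linarith
    ultimately show ?thesis by simp
  qed
  have "hprod I v (hvec I G' v) = hprod I v (\<lambda>i. w i / (1 + q))"
    by (rule hprod_cong) (auto simp: G'v)
  also have "\<dots> = hprod I v w / (1 + q)" by (simp add: hprod_def sum_divide_distrib)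
  also have "\<dots> = complex_of_real (q / (1 + q))" by (simp add: vw)
  finally show "hform I G' v = q / (1 + q)" by (simp only: hform_def Re_complex_of_real)
  \<comment> \<open>Column \<open>i\<close> of \<open>G\<close> solves \<open>B x = e\<close>, hence
    \<open>B' x = e + v cnj (w i)\<close>; applying \<open>G'\<close> exhibits the correction of the
    diagonal entry.\<close>
  have diff: "G i i - G' i i = complex_of_real ((cmod (w i))^2 / (1 + q))" if i: "i \<in> I" for i
  proof -
    define x where "x k = G k i" for k
    define e where "e k = (if k = i then 1 else 0 :: complex)" for k
    have Bx: "hvec I B x k = e k" if "k \<in> I" for k
      using G that i by (simp add: inv_on_def hvec_def x_def e_def)
    have vx: "hprod I v x = cnj (w i)"
    proof -
      have "cnj (v k) * G k i = cnj (G i k * v k)" if "k \<in> I" for k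
      proof -
        have "G k i = cnj (G i k)" using hG i that unfolding herm_def by blast
        then show ?thesis by simp
      qed
      then show ?thesis unfolding hprod_def x_def w_def hvec_def cnj_sum
        by (intro sum.cong refl)
    qed
    have "x i = hvec I G' (hvec I B' x) i" using i by (simp add: inv_on_hvec[OF I G'])
    also have "\<dots> = hvec I G' (\<lambda>k. e k + v k * cnj (w i)) i"
      by (rule hv_cong) (simp add: B'v Bx vx)
    also have "\<dots> = hvec I G' e i + cnj (w i) * hvec I G' v i"
      by (simp add: hvec_def algebra_simps sum.distrib sum_distrib_left)
    also have "hvec I G' e i = G' i i"
      using I i by (simp add: hvec_def e_def if_distrib[of "\<lambda>c. G' i _ * c"] sum.delta cong: if_cong)
    finally have "G i i - G' i i = w i * cnj (w i) / (1 + complex_of_real q)"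
      unfolding x_def G'v[OF i] by simp
    also have "\<dots> = complex_of_real ((cmod (w i))^2 / (1 + q))"
      by (simp only: of_real_divide complex_norm_square of_real_add of_real_1)
    finally show ?thesis .
  qed
  have "htrace I G - htrace I G' = (\<Sum>i\<in>I. Re (G i i - G' i i))"
    by (simp add: htrace_def sum_subtractf)
  also have "\<dots> = sqn I w / (1 + q)"
    unfolding sqn_def sum_divide_distrib by (intro sum.cong refl, subst diff) auto
  finally have t: "htrace I G - htrace I G' = sqn I w / (1 + q)" .
  then show "0 \<le> htrace I G - htrace I G'" using q0 by simp
  have "sqn I w \<le> q / s" using q0 s by (simp add: field_simps)
  also have "\<dots> \<le> (1 + q) / s" using s by (simp add: field_simps)
  finally show "htrace I G - htrace I G' \<le> 1 / s" unfolding t using q0 s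
    by (simp add: field_simps)
qed

text \<open>The trace of \<open>B G\<close> counts the indices; expanding \<open>B\<close> into its
  scalar and rank-one parts turns the same trace into the right-hand side.\<close>

lemma sum_resolvent_forms:
  assumes I: "finite I" and G: "inv_on I B G"
    and B: "\<And>i k. i \<in> I \<Longrightarrow> k \<in> I \<Longrightarrow>
      B i k = (if i = k then complex_of_real s else 0) + (\<Sum>j\<in>J. v j i * cnj (v j k))"
  shows "real (card I) = s * htrace I G + (\<Sum>j\<in>J. hform I G (v j))"
proof -
  have "of_nat (card I) = (\<Sum>i\<in>I. \<Sum>k\<in>I. B i k * G k i)"
    using G by (simp add: inv_on_def)
  also have "\<dots> = (\<Sum>i\<in>I. \<Sum>k\<in>I. (if i = k then complex_of_real s * G k i else 0)
      + (\<Sum>j\<in>J. cnj (v j k) * (G k i * v j i)))"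
    by (intro sum.cong refl) (simp add: B algebra_simps sum_distrib_left)
  also have "\<dots> = (\<Sum>i\<in>I. complex_of_real s * G i i) + (\<Sum>i\<in>I. \<Sum>k\<in>I. \<Sum>j\<in>J. cnj (v j k) * (G k i * v j i))"
    using I by (simp add: sum.distrib sum.delta)
  also have "(\<Sum>i\<in>I. \<Sum>k\<in>I. \<Sum>j\<in>J. cnj (v j k) * (G k i * v j i))
    = (\<Sum>j\<in>J. \<Sum>i\<in>I. \<Sum>k\<in>I. cnj (v j k) * (G k i * v j i))"
    by (subst (2) sum.swap, subst sum.swap) (rule refl)
  also have "\<dots> = (\<Sum>j\<in>J. hprod I (v j) (hvec I G (v j)))"
  proof (intro sum.cong refl)
    fix j
    have "(\<Sum>i\<in>I. \<Sum>k\<in>I. cnj (v j k) * (G k i * v j i)) = (\<Sum>k\<in>I. \<Sum>i\<in>I. cnj (v j k) * (G k i * v j i))"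
      by (rule sum.swap)
    then show "(\<Sum>i\<in>I. \<Sum>k\<in>I. cnj (v j k) * (G k i * v j i)) = hprod I (v j) (hvec I G (v j))"
      by (simp add: hprod_def hvec_def sum_distrib_left)
  qed
  finally have "Re (of_nat (card I)) = Re ((\<Sum>i\<in>I. complex_of_real s * G i i)
      + (\<Sum>j\<in>J. hprod I (v j) (hvec I G (v j))))" by simp
  then show ?thesis by (simp add: hform_def htrace_def sum_distrib_left)
qed

section \<open>The complex Gaussian law\<close>

definition cgauss :: "complex measure" where
  "cgauss = density lborel (\<lambda>z. ennreal (exp (- (cmod z * cmod z)) / pi))"

lemma measurable_Complex_pair [measurable]:
  "(\<lambda>(a, b). Complex a b) \<in> borel_measurable (lborel \<Otimes>\<^sub>M lborel)"
  by (simp add: Complex_eq split_beta)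

text \<open>Lebesgue measure is determined by its values on boxes. Seen as a product measure, it
  lets the Gaussian integral factor into real and imaginary parts.\<close>

lemma lborel_complex_eq: "(lborel :: complex measure) = distr (lborel \<Otimes>\<^sub>M lborel) borel (\<lambda>(a, b). Complex a b)"
proof (rule lborel_eqI)
  fix l u :: complex
  assume le: "\<And>b. b \<in> Basis \<Longrightarrow> l \<bullet> b \<le> u \<bullet> b"
  have lu: "Re l \<le> Re u" "Im l \<le> Im u"
    using le[of 1] le[of \<i>] by (auto simp: Basis_complex_def inner_complex_def)
  have v: "(\<lambda>(a, b). Complex a b) -` box l u \<inter> space (lborel \<Otimes>\<^sub>M lborel)
      = box (Re l) (Re u) \<times> box (Im l) (Im u)"
    by (auto simp: box_def Basis_complex_def inner_complex_def space_pair_measure)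
  show "emeasure (distr (lborel \<Otimes>\<^sub>M lborel) borel (\<lambda>(a, b). Complex a b)) (box l u) =
      ennreal (\<Prod>b\<in>Basis. (u - l) \<bullet> b)"
    using lu by (subst emeasure_distr) (auto simp: v lborel.emeasure_pair_measure_Times
       Basis_complex_def inner_complex_def ennreal_mult)
qed simp

lemma nn_integral_gauss_real:
  fixes c d :: real assumes "c > 0"
  shows "(\<integral>\<^sup>+x. ennreal (exp (- c * x^2 - 2 * d * x)) \<partial>lborel) = ennreal (sqrt (pi / c) * exp (d^2 / c))"
proof -
  define \<sigma> where "\<sigma> = sqrt (1 / (2 * c))"
  have s2: "\<sigma>^2 = 1 / (2 * c)" and s0: "\<sigma> > 0" using assms by (auto simp: \<sigma>_def)
  have "exp (- c * x^2 - 2 * d * x) = (sqrt (pi / c) * exp (d^2 / c)) * normal_density (- d / c) \<sigma> x" for x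
  proof -
    have "normal_density (- d / c) \<sigma> x = 1 / sqrt (pi / c) * exp (- (c * (x + d / c)^2))"
      using assms by (simp add: normal_density_def s2 mult_ac)
    moreover have "c * (x + d / c)^2 = c * x^2 + 2 * d * x + d^2 / c"
      using assms by (simp add: power2_eq_square field_simps)
    then have "exp (- c * x^2 - 2 * d * x) = exp (d^2 / c) * exp (- (c * (x + d / c)^2))"
      by (simp flip: exp_add)
    ultimately show ?thesis using assms by simp
  qed
  then have "(\<integral>\<^sup>+x. ennreal (exp (- c * x^2 - 2 * d * x)) \<partial>lborel) =
     (\<integral>\<^sup>+x. ennreal (sqrt (pi / c) * exp (d^2 / c)) * ennreal (normal_density (- d / c) \<sigma> x) \<partial>lborel)"
    using assms by (simp add: ennreal_mult')
  also have "\<dots> = ennreal (sqrt (pi / c) * exp (d^2 / c)) * (\<integral>\<^sup>+x. ennreal (normal_density (- d / c) \<sigma> x) \<partial>lborel)"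
    by (rule nn_integral_cmult) simp
  also have "(\<integral>\<^sup>+x. ennreal (normal_density (- d / c) \<sigma> x) \<partial>lborel) = 1"
    using s0 by (subst nn_integral_eq_integral) (auto simp: integral_normal_density integrable_normal_density)
  finally show ?thesis by simp
qed

lemma cgauss_sets [simp, measurable_cong]: "sets cgauss = sets borel"
  by (simp add: cgauss_def)

lemma space_cgauss [simp]: "space cgauss = UNIV"
  by (simp add: cgauss_def)

text \<open>The linear term anticipates the coupling of one coordinate to the others in a quadratic
  form. Negative \<open>a\<close> above -1 serves the exponential moments of
  \<open>|z|^2\<close>.\<close>

lemma nn_integral_cgauss_exp:
  assumes a: "a > -1"
  shows "(\<integral>\<^sup>+z. ennreal (exp (- a * (cmod z)^2 - 2 * Re (cnj z * b))) \<partial>cgauss)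
    = ennreal (exp ((cmod b)^2 / (1 + a)) / (1 + a))"
proof -
  have c: "1 + a > 0" using a by simp
  have [measurable]: "(\<lambda>z. exp (- a * (cmod z)^2 - 2 * Re (cnj z * b))) \<in> borel_measurable borel"
    by (intro borel_measurable_continuous_onI continuous_intros)
  have [measurable]: "(\<lambda>z. exp (- (cmod z * cmod z)) / pi) \<in> borel_measurable (borel :: complex measure)"
    by (intro borel_measurable_continuous_onI continuous_intros) auto
  define F where "F d x = exp (- (1 + a) * x^2 - 2 * d * x)" for d x :: real
  have [measurable]: "F d \<in> borel_measurable borel" for d
    unfolding F_def by measurable
  have "(\<integral>\<^sup>+z. ennreal (exp (- a * (cmod z)^2 - 2 * Re (cnj z * b))) \<partial>cgauss)
    = (\<integral>\<^sup>+z. ennreal (exp (- (cmod z * cmod z)) / pi) * ennreal (exp (- a * (cmod z)^2 - 2 * Re (cnj z * b))) \<partial>lborel)"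
    unfolding cgauss_def by (subst nn_integral_density) auto
  also have "\<dots> = (\<integral>\<^sup>+z. ennreal (1 / pi) * ennreal (F (Re b) (Re z) * F (Im b) (Im z)) \<partial>(lborel :: complex measure))"
  proof (rule nn_integral_cong)
    fix z :: complex
    have "exp (- (cmod z * cmod z)) / pi * exp (- a * (cmod z)^2 - 2 * Re (cnj z * b)) =
      1 / pi * (F (Re b) (Re z) * F (Im b) (Im z))"
      by (simp add: F_def flip: exp_add) (simp add: cmod_power2 flip: power2_eq_square, simp add: algebra_simps)
    then show "ennreal (exp (- (cmod z * cmod z)) / pi) * ennreal (exp (- a * (cmod z)^2 - 2 * Re (cnj z * b))) =
       ennreal (1 / pi) * ennreal (F (Re b) (Re z) * F (Im b) (Im z))"
      by (simp add: F_def flip: ennreal_mult')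
  qed
  also have "\<dots> = ennreal (1 / pi) * (\<integral>\<^sup>+z. ennreal (F (Re b) (Re z) * F (Im b) (Im z)) \<partial>(lborel :: complex measure))"
    by (rule nn_integral_cmult) simp
  also have "(\<integral>\<^sup>+z. ennreal (F (Re b) (Re z) * F (Im b) (Im z)) \<partial>(lborel :: complex measure))
    = (\<integral>\<^sup>+z. ennreal (F (Re b) (fst z) * F (Im b) (snd z)) \<partial>(lborel \<Otimes>\<^sub>M lborel))"
    unfolding lborel_complex_eq
    by (subst nn_integral_distr) (auto simp: Complex_eq split_beta intro!: nn_integral_cong)
  also have "\<dots> = (\<integral>\<^sup>+x. \<integral>\<^sup>+y. ennreal (F (Re b) x) * ennreal (F (Im b) y) \<partial>lborel \<partial>lborel)"
    by (subst lborel.nn_integral_fst[symmetric]) (auto simp: F_def ennreal_mult')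
  also have "\<dots> = (\<integral>\<^sup>+x. ennreal (F (Re b) x) \<partial>lborel) * (\<integral>\<^sup>+x. ennreal (F (Im b) x) \<partial>lborel)"
    by (simp add: nn_integral_cmult nn_integral_multc)
  also have "\<dots> = ennreal (sqrt (pi / (1+a)) * exp ((Re b)^2 / (1+a))) * ennreal (sqrt (pi / (1+a)) * exp ((Im b)^2 / (1+a)))"
    unfolding F_def using nn_integral_gauss_real[OF c] by simp
  also have "ennreal (1 / pi) * \<dots> = ennreal (exp ((cmod b)^2 / (1 + a)) / (1 + a))"
  proof -
    have "exp ((Re b)^2 / (1+a)) * exp ((Im b)^2 / (1+a)) = exp ((cmod b)^2 / (1 + a))"
      by (simp add: cmod_power2 add_divide_distrib exp_add)
    moreover have "sqrt (pi / (1+a)) * sqrt (pi / (1+a)) = pi / (1 + a)" using c by simp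
    moreover have "1 / pi * (r * e * (r * f)) = 1 / pi * (r * r) * (e * f)" for r e f :: real
      by (simp add: mult_ac)
    ultimately have "1 / pi * (sqrt (pi / (1+a)) * exp ((Re b)^2 / (1+a)) * (sqrt (pi / (1+a)) * exp ((Im b)^2 / (1+a))))
       = 1 / pi * (pi / (1 + a)) * exp ((cmod b)^2 / (1 + a))"
      by (simp only:)
    also have "\<dots> = exp ((cmod b)^2 / (1 + a)) / (1 + a)" by simp
    finally show ?thesis using c by (simp flip: ennreal_mult')
  qed
  finally show ?thesis .
qed

lemma prob_space_cgauss: "prob_space cgauss"
proof
  show "emeasure cgauss (space cgauss) = 1"
    using nn_integral_cgauss_exp[of 0 0] by simp
qed

section \<open>Concentration of Gaussian quadratic forms\<close>

text \<open>Row and column \<open>k\<close> are conjugate, so the two cross terms add up to twice a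
  real part: the shape of exponent treated in \<open>nn_integral_cgauss_exp\<close>.\<close>

lemma hform_insert:
  assumes k: "k \<notin> I" "finite I" and A: "herm (insert k I) A"
  shows "hform (insert k I) A (h(k := z)) =
     hform I A h + Re (A k k) * (cmod z)^2 + 2 * Re (cnj z * (\<Sum>i\<in>I. A k i * h i))"
proof -
  have kk: "Im (A k k) = 0" using hermD[OF A, of k k] by (simp add: complex_eq_iff)
  have ne: "i \<in> I \<Longrightarrow> i \<noteq> k" for i using k by auto
  define b where "b = (\<Sum>i\<in>I. A k i * h i)"
  have c: "A i k = cnj (A k i)" if "i \<in> I" for i using hermD[OF A, of k i] that by simp
  have v1: "hvec (insert k I) A (h(k := z)) k = A k k * z + b"
    using k ne by (simp add: hvec_def b_def)
  have v2: "hvec (insert k I) A (h(k := z)) i = A i k * z + hvec I A h i" for i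
  proof -
    have "(\<Sum>j\<in>I. A i j * (h(k := z)) j) = (\<Sum>j\<in>I. A i j * h j)"
      using ne by (intro sum.cong) auto
    then show ?thesis using k by (simp add: hvec_def)
  qed
  have "hprod (insert k I) (h(k := z)) (hvec (insert k I) A (h(k := z)))
      = cnj z * (A k k * z + b) + (\<Sum>i\<in>I. cnj (h i) * (A i k * z + hvec I A h i))"
  proof -
    have "(\<Sum>i\<in>I. cnj ((h(k := z)) i) * hvec (insert k I) A (h(k := z)) i)
       = (\<Sum>i\<in>I. cnj (h i) * (A i k * z + hvec I A h i))"
      using ne by (intro sum.cong) (auto simp: v2)
    then show ?thesis using k by (simp add: hprod_def v1)
  qed
  also have "(\<Sum>i\<in>I. cnj (h i) * (A i k * z + hvec I A h i)) = cnj b * z + hprod I h (hvec I A h)"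
    by (simp add: b_def hprod_def algebra_simps sum.distrib sum_distrib_left c)
  finally have e: "hprod (insert k I) (h(k := z)) (hvec (insert k I) A (h(k := z)))
     = cnj z * (A k k * z + b) + (cnj b * z + hprod I h (hvec I A h))" .
  show ?thesis unfolding hform_def b_def[symmetric] e
    by (simp add: kk cmod_power2) (simp add: power2_eq_square algebra_simps)
qed

lemma hform_measurable [measurable]:
  assumes "finite I" "I \<subseteq> J"
  shows "hform I A \<in> borel_measurable (PiM J (\<lambda>_. cgauss))"
proof -
  have [measurable]: "(\<lambda>x. x i) \<in> borel_measurable (PiM J (\<lambda>_. cgauss))" if "i \<in> I" for i
    using measurable_component_singleton[of i J "\<lambda>_. cgauss"] that assms
      measurable_cong_sets[OF refl cgauss_sets] by blast
  have [measurable]: "(\<lambda>x. cnj (x i)) \<in> borel_measurable (PiM J (\<lambda>_. cgauss))" if "i \<in> I" for i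
    using that by (intro borel_measurable_continuous_on[where f = cnj] continuous_intros) measurable
  show ?thesis
    unfolding hform_def[abs_def] hprod_def hvec_def
    by (intro borel_measurable_Re[THEN measurable_compose[rotated]] borel_measurable_sum borel_measurable_times) measurable
qed

text \<open>The remainder is quadratic in \<open>u\<close>, so the loss per coordinate in the
  Laplace transform is of order \<theta>^2 and a small \<theta> beats it by a linear gain.\<close>

lemma inverse_le_exp:
  fixes u :: real assumes "u \<ge> 0"
  shows "1 / (1 + u) \<le> exp (- u + u^2)"
proof -
  have "exp (u - u^2) \<le> 1 + u"
  proof (cases "u \<le> 1")
    case True
    then have "u - u^2 \<le> ln (1 + u)" using ln_one_plus_pos_lower_bound assms by blast
    then have "exp (u - u^2) \<le> exp (ln (1 + u))" by simp
    also have "\<dots> = 1 + u" using assms by simp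
    finally show ?thesis .
  next
    case False
    then have "u - u^2 \<le> 0" by (simp add: power2_eq_square)
    then have "exp (u - u^2) \<le> 1" by simp
    then show ?thesis using assms by linarith
  qed
  moreover have "exp (- u + u^2) = 1 / exp (u - u^2)" by (simp add: exp_diff exp_add exp_minus field_simps)
  ultimately show ?thesis using assms by (simp add: frac_le)
qed

text \<open>Integrating out one coordinate turns \<open>A\<close> into a Schur-type complement \<open>A'\<close> with
  \<open>0 \<le> A' \<le> A\<close> on the remaining coordinates, so the bounds survive the induction.\<close>

lemma nn_integral_exp_hform_le:
  assumes "finite I" "herm I A" "\<And>x. 0 \<le> hform I A x" "\<And>x. hform I A x \<le> C * sqn I x"
    and C: "C > 0" and th: "\<theta> \<ge> 0"
  shows "(\<integral>\<^sup>+h. ennreal (exp (- \<theta> * hform I A h)) \<partial>PiM I (\<lambda>_. cgauss))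
    \<le> ennreal (exp (- \<theta> * htrace I A + 2 * \<theta>^2 * C^2 * real (card I)))"
  using assms(1-4)
proof (induction I arbitrary: A rule: finite_induct)
  case empty
  show ?case by (simp add: hform_def hprod_def htrace_def PiM_empty)
next
  case (insert k I)
  interpret prob_space cgauss by (rule prob_space_cgauss)
  interpret product_sigma_finite "\<lambda>_::'a. cgauss" by standard
  have k: "k \<notin> I" "finite I" and hA: "herm (insert k I) A" by fact+
  note ins = hform_insert[OF k hA]
  have sq_ins: "sqn (insert k I) (h(k := z)) = sqn I h + (cmod z)^2" for h z
  proof -
    have "(\<Sum>i\<in>I. (cmod ((h(k := z)) i))^2) = (\<Sum>i\<in>I. (cmod (h i))^2)"
      using k by (intro sum.cong) auto
    then show ?thesis using k by (simp add: sqn_def)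
  qed
  define a where "a = Re (A k k)"
  define b where "b h = (\<Sum>i\<in>I. A k i * h i)" for h
  \<comment> \<open>Completing the square in coordinate \<open>k\<close> leaves the factor
    \<open>exp (\<theta> * t * |b h|^2)\<close>; this dictates the weight of the rank-one correction
    in \<open>A'\<close>.\<close>
  define t where "t = \<theta> / (1 + \<theta> * a)"
  define R where "R = (\<Sum>i\<in>I. (cmod (A k i))^2)"
  have pos: "0 \<le> hform I A h + a * (cmod z)^2 + 2 * Re (cnj z * b h)" for h z
    using insert.prems(2)[of "h(k := z)"] unfolding ins a_def b_def .
  have le: "hform I A h + a * (cmod z)^2 + 2 * Re (cnj z * b h) \<le> C * (sqn I h + (cmod z)^2)" for h z
    using insert.prems(3)[of "h(k := z)"] unfolding ins a_def b_def sq_ins .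
  have leC: "hform I A h \<le> C * sqn I h" for h using le[of h 0] by simp
  have a0: "a \<ge> 0" using pos[of "\<lambda>_. 0" 1] by (simp add: b_def hform_def hprod_def)
  have aC: "a \<le> C" using le[of "\<lambda>_. 0" 1] by (simp add: b_def hform_def hprod_def sqn_def)
  have R0: "R \<ge> 0" unfolding R_def by (intro sum_nonneg) auto
  \<comment> \<open>The test vector is the conjugated row \<open>k\<close> with entry
    \<open>- R / C\<close> at \<open>k\<close>. The bounds 0 and \<open>C\<close> on the form then
    leave \<open>0 \<le> R (C - R / C)\<close>.\<close>
  have RC: "R \<le> C^2"
  proof -
    define x where "x i = cnj (A k i)" for i
    have bx: "b x = complex_of_real R"
      unfolding b_def x_def R_def of_real_sum by (intro sum.cong refl) (simp add: complex_norm_square del: of_real_power)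
    have sx: "sqn I x = R" by (simp add: sqn_def x_def R_def)
    have "0 \<le> hform I A x + a * (R / C)^2 - 2 * (R / C) * R"
      using pos[of x "- complex_of_real (R / C)"] R0 C by (simp add: bx norm_divide power_divide)
    also have "\<dots> \<le> C * R + C * (R / C)^2 - 2 * (R / C) * R"
      using leC[of x] mult_right_mono[OF aC, of "(R/C)^2"] by (simp add: sx)
    also have "\<dots> = R * (C - R / C)" using C by (simp add: power2_eq_square field_simps)
    finally have "0 \<le> R * (C - R / C)" .
    then show ?thesis using C R0
      by (cases "R = 0") (auto simp: zero_le_mult_iff field_simps power2_eq_square)
  qed
  have d0: "1 + \<theta> * a > 0" using th a0 by (simp add: add_pos_nonneg)
  have t0: "t \<ge> 0" "t \<le> \<theta>" "a * t \<le> 1"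
    using d0 th a0 by (auto simp: t_def field_simps mult_left_mono)
  define A' where "A' i j = A i j - of_real t * (cnj (A k i) * A k j)" for i j
  have hA': "herm I A'"
    unfolding herm_def A'_def
  proof (intro ballI)
    fix i j assume "i \<in> I" "j \<in> I"
    then have "A j i = cnj (A i j)" using hermD[OF hA, of i j] by simp
    then show "A j i - of_real t * (cnj (A k j) * A k i) = cnj (A i j - of_real t * (cnj (A k i) * A k j))"
      by simp
  qed
  have fA': "hform I A' h = hform I A h - t * (cmod (b h))^2" for h
  proof -
    have v: "hvec I A' h i = hvec I A h i - of_real t * (cnj (A k i) * b h)" for i
      by (simp add: hvec_def A'_def b_def algebra_simps sum_subtractf sum_distrib_left)
    have "hprod I h (hvec I A' h) = hprod I h (hvec I A h) - of_real t * (cnj (b h) * b h)"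
      unfolding hprod_def v by (simp add: b_def algebra_simps sum_subtractf sum_distrib_left sum_distrib_right)
    then show ?thesis unfolding hform_def
      by (simp add: cmod_power2) (simp add: power2_eq_square algebra_simps)
  qed
  \<comment> \<open>The full form at \<open>z = - t b\<close> equals the form of \<open>A'\<close>
    less \<open>(1 - a t) t |b|^2\<close>, and \<open>a t \<le> 1\<close>.\<close>
  have pA': "0 \<le> hform I A' h" for h
  proof -
    have "0 \<le> hform I A h + a * (t * cmod (b h))^2 - 2 * t * (cmod (b h))^2"
      using pos[of h "- of_real t * b h"] t0
      by (simp add: norm_mult cmod_power2 power_mult_distrib) (simp add: power2_eq_square algebra_simps)
    also have "\<dots> = hform I A h - t * (cmod (b h))^2 - (1 - a * t) * (t * (cmod (b h))^2)"
      by (simp add: power2_eq_square algebra_simps)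
    also have "\<dots> \<le> hform I A h - t * (cmod (b h))^2" using t0 by simp
    finally show ?thesis by (simp add: fA')
  qed
  have lA': "hform I A' h \<le> C * sqn I h" for h
  proof -
    have "0 \<le> t * (cmod (b h))^2" using t0 by simp
    then show ?thesis using leC[of h] unfolding fA' by linarith
  qed
  have tr': "htrace I A' = htrace I A - t * R"
    by (simp add: htrace_def A'_def R_def sum_subtractf sum_distrib_left cmod_power2)
       (simp add: power2_eq_square distrib_left sum.distrib sum_distrib_left)
  have tr: "htrace (insert k I) A = a + htrace I A" using k by (simp add: htrace_def a_def)
  have inner: "(\<integral>\<^sup>+z. ennreal (exp (- \<theta> * hform (insert k I) A (h(k := z)))) \<partial>cgauss)
      = ennreal (1 / (1 + \<theta> * a)) * ennreal (exp (- \<theta> * hform I A' h))" for h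
  proof -
    have "(\<integral>\<^sup>+z. ennreal (exp (- \<theta> * hform (insert k I) A (h(k := z)))) \<partial>cgauss)
      = (\<integral>\<^sup>+z. ennreal (exp (- \<theta> * hform I A h)) *
          ennreal (exp (- (\<theta> * a) * (cmod z)^2 - 2 * Re (cnj z * (of_real \<theta> * b h)))) \<partial>cgauss)"
      by (intro nn_integral_cong) (simp add: ins a_def b_def algebra_simps flip: ennreal_mult' exp_add)
    also have "\<dots> = ennreal (exp (- \<theta> * hform I A h)) *
        (\<integral>\<^sup>+z. ennreal (exp (- (\<theta> * a) * (cmod z)^2 - 2 * Re (cnj z * (of_real \<theta> * b h)))) \<partial>cgauss)"
      by (intro nn_integral_cmult)
        (simp add: measurable_cong_sets[OF cgauss_sets refl] borel_measurable_continuous_onI continuous_intros)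
    also have "\<dots> = ennreal (exp (- \<theta> * hform I A h)) *
        ennreal (exp ((cmod (of_real \<theta> * b h))^2 / (1 + \<theta> * a)) / (1 + \<theta> * a))"
      using d0 by (subst nn_integral_cgauss_exp) auto
    also have "\<dots> = ennreal (1 / (1 + \<theta> * a)) * ennreal (exp (- \<theta> * hform I A' h))"
      using d0 by (simp add: fA' norm_mult t_def power_mult_distrib algebra_simps power2_eq_square flip: ennreal_mult' exp_add)
    finally show ?thesis .
  qed
  have "(\<integral>\<^sup>+h. ennreal (exp (- \<theta> * hform (insert k I) A h)) \<partial>PiM (insert k I) (\<lambda>_. cgauss))
    = (\<integral>\<^sup>+h. \<integral>\<^sup>+z. ennreal (exp (- \<theta> * hform (insert k I) A (h(k := z)))) \<partial>cgauss \<partial>PiM I (\<lambda>_. cgauss))"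
    using k by (subst product_nn_integral_insert) auto
  also have "\<dots> = ennreal (1 / (1 + \<theta> * a)) * (\<integral>\<^sup>+h. ennreal (exp (- \<theta> * hform I A' h)) \<partial>PiM I (\<lambda>_. cgauss))"
    unfolding inner using k by (intro nn_integral_cmult) auto
  also have "\<dots> \<le> ennreal (1 / (1 + \<theta> * a)) * ennreal (exp (- \<theta> * htrace I A' + 2 * \<theta>^2 * C^2 * real (card I)))"
    by (intro mult_left_mono insert.IH hA' pA' lA') simp
  also have "\<dots> = ennreal (1 / (1 + \<theta> * a) * exp (- \<theta> * htrace I A' + 2 * \<theta>^2 * C^2 * real (card I)))"
    using d0 by (simp flip: ennreal_mult')
  also have "\<dots> \<le> ennreal (exp (- \<theta> * htrace (insert k I) A + 2 * \<theta>^2 * C^2 * real (card (insert k I))))"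
  proof (rule ennreal_leI)
    have "1 / (1 + \<theta> * a) * exp (- \<theta> * htrace I A' + 2 * \<theta>^2 * C^2 * real (card I))
      \<le> exp (- (\<theta> * a) + (\<theta> * a)^2) * exp (- \<theta> * htrace I A' + 2 * \<theta>^2 * C^2 * real (card I))"
      using th a0 by (intro mult_right_mono inverse_le_exp) auto
    also have "\<dots> = exp (- (\<theta> * a) + (\<theta> * a)^2 - \<theta> * htrace I A' + 2 * \<theta>^2 * C^2 * real (card I))"
      by (simp flip: exp_add)
    also have "\<dots> \<le> exp (- \<theta> * htrace (insert k I) A + 2 * \<theta>^2 * C^2 * real (card (insert k I)))"
    proof -
      \<comment> \<open>Each integrated coordinate costs two errors of size at most
        \<open>\<theta>^2 C^2\<close>: the quadratic remainder in \<open>\<theta> a\<close>, and the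
        trace \<open>t R\<close> lost in passing to \<open>A'\<close>. This is the factor 2 in the
        bound.\<close>
      have 1: "(\<theta> * a)^2 \<le> \<theta>^2 * C^2"
        using a0 aC by (simp add: power_mult_distrib mult_left_mono power_mono)
      have "\<theta> * (t * R) \<le> \<theta> * (\<theta> * C^2)"
        using th t0 RC R0 by (intro mult_left_mono mult_mono) auto
      then show ?thesis using 1 k by (simp add: tr tr' algebra_simps power2_eq_square)
    qed
    finally show "1 / (1 + \<theta> * a) * exp (- \<theta> * htrace I A' + 2 * \<theta>^2 * C^2 * real (card I))
      \<le> exp (- \<theta> * htrace (insert k I) A + 2 * \<theta>^2 * C^2 * real (card (insert k I)))" .
  qed
  finally show ?case .
qed


lemma finite_product_cgauss: "finite I \<Longrightarrow> prob_space (PiM I (\<lambda>_. cgauss))"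
  by (intro prob_space_PiM prob_space_cgauss)

lemma emeasure_le_exp_bound:
  assumes [measurable]: "X \<in> borel_measurable M"
    and le: "(\<integral>\<^sup>+h. ennreal (exp (X h)) \<partial>M) \<le> ennreal (exp u)"
  shows "emeasure M {h\<in>space M. X h \<ge> v} \<le> ennreal (exp (u - v))"
proof -
  have "emeasure M {h\<in>space M. X h \<ge> v} = (\<integral>\<^sup>+h. indicator {h\<in>space M. X h \<ge> v} h \<partial>M)" by simp
  also have "\<dots> \<le> (\<integral>\<^sup>+h. ennreal (exp (- v)) * ennreal (exp (X h)) \<partial>M)"
    by (intro nn_integral_mono) (auto simp: indicator_def simp flip: ennreal_mult' exp_add)
  also have "\<dots> = ennreal (exp (- v)) * (\<integral>\<^sup>+h. ennreal (exp (X h)) \<partial>M)"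
    by (rule nn_integral_cmult) simp
  also have "\<dots> \<le> ennreal (exp (- v)) * ennreal (exp u)" by (intro mult_left_mono le) simp
  finally show ?thesis by (simp add: exp_diff exp_minus field_simps flip: ennreal_mult')
qed

lemma hform_lower_tail:
  fixes C \<epsilon> :: real
  assumes "finite I" "herm I A" "\<And>x. 0 \<le> hform I A x" "\<And>x. hform I A x \<le> C * sqn I x"
    and C: "C > 0" and e: "\<epsilon> > 0"
  shows "emeasure (PiM I (\<lambda>_. cgauss)) {h\<in>space (PiM I (\<lambda>_. cgauss)). hform I A h \<le> htrace I A - \<epsilon> * card I}
    \<le> ennreal (exp (- (\<epsilon>^2 / (8 * C^2)) * card I))"
proof -
  \<comment> \<open>Minimiser of the exponent \<open>2 \<theta>^2 C^2 - \<theta> \<epsilon>\<close>;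
    the value there is \<open>- \<epsilon>^2 / (8 C^2)\<close>.\<close>
  define \<theta> where "\<theta> = \<epsilon> / (4 * C^2)"
  have th: "\<theta> > 0" using C e by (simp add: \<theta>_def)
  have "emeasure (PiM I (\<lambda>_. cgauss)) {h\<in>space (PiM I (\<lambda>_. cgauss)). - \<theta> * hform I A h \<ge> - \<theta> * (htrace I A - \<epsilon> * card I)}
    \<le> ennreal (exp ((- \<theta> * htrace I A + 2 * \<theta>^2 * C^2 * real (card I)) - (- \<theta> * (htrace I A - \<epsilon> * card I))))"
    using assms th by (intro emeasure_le_exp_bound nn_integral_exp_hform_le) auto
  also have "(- \<theta> * htrace I A + 2 * \<theta>^2 * C^2 * real (card I)) - (- \<theta> * (htrace I A - \<epsilon> * card I))
     = (2 * \<theta>^2 * C^2 - \<theta> * \<epsilon>) * card I" by (simp add: algebra_simps)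
  also have "2 * \<theta>^2 * C^2 - \<theta> * \<epsilon> = - (\<epsilon>^2 / (8 * C^2))"
    using C by (simp add: \<theta>_def power2_eq_square field_simps)
  also have "{h\<in>space (PiM I (\<lambda>_. cgauss)). - \<theta> * hform I A h \<ge> - \<theta> * (htrace I A - \<epsilon> * card I)}
     = {h\<in>space (PiM I (\<lambda>_. cgauss)). hform I A h \<le> htrace I A - \<epsilon> * card I}"
    using th by simp
  finally show ?thesis .
qed

lemma sqn_measurable [measurable]:
  assumes "finite I"
  shows "sqn I \<in> borel_measurable (PiM I (\<lambda>_. cgauss))"
proof -
  have [measurable]: "(\<lambda>x. x i) \<in> borel_measurable (PiM I (\<lambda>_. cgauss))" if "i \<in> I" for i
    using measurable_component_singleton[of i I "\<lambda>_. cgauss"] that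
      measurable_cong_sets[OF refl cgauss_sets] by blast
  show ?thesis unfolding sqn_def[abs_def] by measurable
qed

text \<open>Here the Laplace transform is explicit, \<open>1 / (1 - \<theta>)\<close> per
  coordinate. The cap on \<epsilon> keeps \<theta> in the range where
  \<open>ln (1 - \<theta>)\<close> admits its quadratic lower bound.\<close>

lemma sqn_upper_tail:
  fixes \<epsilon> :: real
  assumes I: "finite I" and e: "\<epsilon> > 0" "\<epsilon> \<le> 1"
  shows "emeasure (PiM I (\<lambda>_. cgauss)) {h\<in>space (PiM I (\<lambda>_. cgauss)). sqn I h \<ge> (1 + \<epsilon>) * card I}
    \<le> ennreal (exp (- (\<epsilon>^2 / 8) * card I))"
proof -
  interpret prob_space cgauss by (rule prob_space_cgauss)
  interpret product_sigma_finite "\<lambda>_::'a. cgauss" by standard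
  define \<theta> where "\<theta> = \<epsilon> / 4"
  have th: "\<theta> > 0" "\<theta> \<le> 1/2" using e by (auto simp: \<theta>_def)
  have one: "(\<integral>\<^sup>+z. ennreal (exp (\<theta> * (cmod z)^2)) \<partial>cgauss) = ennreal (1 / (1 - \<theta>))"
    using nn_integral_cgauss_exp[of "- \<theta>" 0] th by simp
  have [measurable]: "(\<lambda>z. ennreal (exp (\<theta> * (cmod z)^2))) \<in> borel_measurable cgauss"
    by (simp add: measurable_cong_sets[OF cgauss_sets refl])
  have "(\<integral>\<^sup>+h. ennreal (exp (\<theta> * sqn I h)) \<partial>PiM I (\<lambda>_. cgauss))
    = (\<integral>\<^sup>+h. (\<Prod>i\<in>I. ennreal (exp (\<theta> * (cmod (h i))^2))) \<partial>PiM I (\<lambda>_. cgauss))"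
    using I by (intro nn_integral_cong) (simp add: sqn_def sum_distrib_left exp_sum prod_ennreal)
  also have "\<dots> = (\<Prod>i\<in>I. (\<integral>\<^sup>+z. ennreal (exp (\<theta> * (cmod z)^2)) \<partial>cgauss))"
    using I by (intro product_nn_integral_prod) auto
  also have "\<dots> = ennreal ((1 / (1 - \<theta>)) ^ card I)"
    using th by (simp add: one ennreal_power)
  also have "\<dots> \<le> ennreal (exp ((\<theta> + 2 * \<theta>^2) * card I))"
  proof (rule ennreal_leI)
    have "exp (- \<theta> - 2 * \<theta>^2) \<le> exp (ln (1 - \<theta>))"
      unfolding exp_le_cancel_iff by (rule ln_one_minus_pos_lower_bound) (use th in auto)
    also have "\<dots> = 1 - \<theta>" using th by simp
    finally have "1 \<le> (1 - \<theta>) * exp (\<theta> + 2 * \<theta>^2)"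
      using th by (simp add: exp_diff exp_minus exp_add field_simps)
    then have "(1 / (1 - \<theta>)) \<le> exp (\<theta> + 2 * \<theta>^2)"
      using th by (simp add: field_simps)
    then have "(1 / (1 - \<theta>)) ^ card I \<le> exp (\<theta> + 2 * \<theta>^2) ^ card I"
      using th by (intro power_mono) auto
    then show "(1 / (1 - \<theta>)) ^ card I \<le> exp ((\<theta> + 2 * \<theta>^2) * card I)"
      by (simp add: exp_of_nat_mult[symmetric] mult.commute)
  qed
  finally have "emeasure (PiM I (\<lambda>_. cgauss)) {h\<in>space (PiM I (\<lambda>_. cgauss)). \<theta> * sqn I h \<ge> \<theta> * ((1 + \<epsilon>) * card I)}
    \<le> ennreal (exp ((\<theta> + 2 * \<theta>^2) * card I - \<theta> * ((1 + \<epsilon>) * card I)))"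
    using I by (intro emeasure_le_exp_bound) auto
  also have "(\<theta> + 2 * \<theta>^2) * card I - \<theta> * ((1 + \<epsilon>) * card I) = - (\<epsilon>^2 / 8) * card I"
    by (simp add: \<theta>_def power2_eq_square field_simps)
  also have "{h\<in>space (PiM I (\<lambda>_. cgauss)). \<theta> * sqn I h \<ge> \<theta> * ((1 + \<epsilon>) * card I)}
     = {h\<in>space (PiM I (\<lambda>_. cgauss)). sqn I h \<ge> (1 + \<epsilon>) * card I}"
    using th by simp
  finally show ?thesis .
qed

text \<open>The upper tail of \<open>A\<close> is obtained from the lower tail of \<open>C - A\<close>.\<close>

lemma hform_concentration:
  fixes C \<epsilon> :: real
  assumes I: "finite I" and A: "herm I A" "\<And>x. 0 \<le> hform I A x" "\<And>x. hform I A x \<le> C * sqn I x"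
    and C: "C > 0" and e: "\<epsilon> > 0" "\<epsilon> \<le> 2 * C"
  shows "emeasure (PiM I (\<lambda>_. cgauss)) {h\<in>space (PiM I (\<lambda>_. cgauss)). \<bar>hform I A h - htrace I A\<bar> \<ge> \<epsilon> * card I}
    \<le> ennreal (3 * exp (- (\<epsilon>^2 / (32 * C^2)) * card I))"
proof -
  let ?P = "PiM I (\<lambda>_. cgauss)"
  note [measurable] = hform_measurable[OF I order_refl] sqn_measurable[OF I]
  define A' where "A' i j = (if i = j then complex_of_real C else 0) - A i j" for i j
  have v: "hvec I A' x i = of_real C * x i - hvec I A x i" if "i \<in> I" for x i
    using that I by (simp add: hvec_def A'_def left_diff_distrib sum_subtractf if_distrib[of "\<lambda>c. c * _"] sum.delta cong: if_cong)
  have f: "hform I A' x = C * sqn I x - hform I A x" for x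
  proof -
    have "hprod I x (hvec I A' x) = of_real C * hprod I x x - hprod I x (hvec I A x)"
      by (simp add: hprod_def v algebra_simps sum_subtractf sum_distrib_left)
    then show ?thesis by (simp add: hform_def hprod_self)
  qed
  have tr: "htrace I A' = C * card I - htrace I A"
    by (simp add: htrace_def A'_def sum_subtractf)
  have h': "herm I A'" unfolding herm_def
  proof (intro ballI)
    fix i j assume "i \<in> I" "j \<in> I"
    from hermD[OF A(1) this] show "A' j i = cnj (A' i j)" by (simp add: A'_def)
  qed
  \<comment> \<open>An upward deviation of \<open>A\<close> by \<epsilon> per index forces a deficit
    of \<open>C - A\<close> or an excess of \<open>C |h|^2\<close> of at least half that
    size.\<close>
  define S1 where "S1 = {h\<in>space ?P. hform I A h \<le> htrace I A - \<epsilon> * card I}"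
  define S2 where "S2 = {h\<in>space ?P. hform I A' h \<le> htrace I A' - (\<epsilon> / 2) * card I}"
  define S3 where "S3 = {h\<in>space ?P. sqn I h \<ge> (1 + \<epsilon> / (2 * C)) * card I}"
  have [measurable]: "S1 \<in> sets ?P" "S2 \<in> sets ?P" "S3 \<in> sets ?P"
    unfolding S1_def S2_def S3_def f by measurable
  have sub: "{h\<in>space ?P. \<bar>hform I A h - htrace I A\<bar> \<ge> \<epsilon> * card I} \<subseteq> S1 \<union> (S2 \<union> S3)"
  proof
    fix h assume h: "h \<in> {h\<in>space ?P. \<bar>hform I A h - htrace I A\<bar> \<ge> \<epsilon> * card I}"
    show "h \<in> S1 \<union> (S2 \<union> S3)"
    proof (rule ccontr)
      assume "h \<notin> S1 \<union> (S2 \<union> S3)"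
      then have 1: "hform I A h > htrace I A - \<epsilon> * card I"
        and 2: "C * sqn I h - hform I A h > C * card I - htrace I A - (\<epsilon> / 2) * card I"
        and 3: "sqn I h < (1 + \<epsilon> / (2 * C)) * card I"
        using h by (auto simp: S1_def S2_def S3_def f tr)
      have "C * sqn I h < C * ((1 + \<epsilon> / (2 * C)) * card I)" using 3 C by simp
      also have "\<dots> = C * card I + \<epsilon> / 2 * card I" using C by (simp add: field_simps)
      finally show False using 1 2 h by (auto simp: abs_real_def split: if_splits)
    qed
  qed
  \<comment> \<open>The halved deviations determine the exponent: \<open>S2\<close> and
    \<open>S3\<close> both come with \<open>\<epsilon>^2 / (32 C^2)\<close>, while \<open>S1\<close>
    has a better one.\<close>
  have b: "exp (- c * card I) \<le> exp (- (\<epsilon>^2 / (32 * C^2)) * card I)" if "c \<ge> \<epsilon>^2 / (32 * C^2)" for c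
    using mult_right_mono[OF that, of "real (card I)"] by simp
  have "emeasure ?P {h\<in>space ?P. \<bar>hform I A h - htrace I A\<bar> \<ge> \<epsilon> * card I} \<le> emeasure ?P (S1 \<union> (S2 \<union> S3))"
    using sub by (rule emeasure_mono) measurable
  also have "\<dots> \<le> emeasure ?P S1 + (emeasure ?P S2 + emeasure ?P S3)"
    by (intro order_trans[OF emeasure_subadditive] add_left_mono emeasure_subadditive) auto
  also have "\<dots> \<le> ennreal (exp (- (\<epsilon>^2 / (32 * C^2)) * card I)) + (ennreal (exp (- (\<epsilon>^2 / (32 * C^2)) * card I)) + ennreal (exp (- (\<epsilon>^2 / (32 * C^2)) * card I)))"
  proof (intro add_mono)
    show "emeasure ?P S1 \<le> ennreal (exp (- (\<epsilon>^2 / (32 * C^2)) * card I))"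
      unfolding S1_def
      by (rule order_trans[OF hform_lower_tail[OF I A C e(1)] ennreal_leI[OF b]])
        (use C in \<open>simp add: field_simps\<close>)
    have "0 \<le> hform I A' x" "hform I A' x \<le> C * sqn I x" for x
      using A(2,3)[of x] by (auto simp: f)
    from hform_lower_tail[OF I h' this C, of "\<epsilon> / 2"]
    show "emeasure ?P S2 \<le> ennreal (exp (- (\<epsilon>^2 / (32 * C^2)) * card I))"
      using e by (simp add: S2_def power_divide)
    have "\<epsilon> / (2 * C) > 0" "\<epsilon> / (2 * C) \<le> 1" using e C by auto
    from sqn_upper_tail[OF I this]
    show "emeasure ?P S3 \<le> ennreal (exp (- (\<epsilon>^2 / (32 * C^2)) * card I))"
      unfolding S3_def
      by (rule order_trans[OF _ ennreal_leI[OF b]])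
        (use C in \<open>simp add: field_simps\<close>)
  qed
  also have "\<dots> = ennreal (3 * exp (- (\<epsilon>^2 / (32 * C^2)) * card I))"
    by (simp flip: ennreal_plus)
  finally show ?thesis .
qed

section \<open>Resolvents of sample covariance matrices\<close>

lemma borel_measurable_cnj:
  "f \<in> borel_measurable M \<Longrightarrow> (\<lambda>x. cnj (f x)) \<in> borel_measurable M"
  by (rule measurable_compose[OF _ borel_measurable_continuous_onI]) (auto intro: continuous_intros)

definition scol :: "nat \<Rightarrow> (nat \<times> nat \<Rightarrow> complex) \<Rightarrow> nat \<Rightarrow> nat \<Rightarrow> complex" where
  "scol m h j i = h (i, j) / complex_of_real (sqrt (real m))"

text \<open>The shifted sample covariance built from the columns in \<open>J\<close> only. Deleting
  a column means shrinking \<open>J\<close>; \<open>s = 0\<close> with all columns gives the matrix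
  of the theorem.\<close>

definition cov_kernel :: "nat \<Rightarrow> real \<Rightarrow> nat set \<Rightarrow> (nat \<times> nat \<Rightarrow> complex) \<Rightarrow> nat \<Rightarrow> nat \<Rightarrow> complex" where
  "cov_kernel m s J h i k =
     (if i = k then complex_of_real s else 0) + (\<Sum>j\<in>J. scol m h j i * cnj (scol m h j k))"

text \<open>Cramer's rule makes the measurability of the inverse in the matrix entries immediate.\<close>

definition resolv :: "nat \<Rightarrow> nat \<Rightarrow> real \<Rightarrow> nat set \<Rightarrow> (nat \<times> nat \<Rightarrow> complex) \<Rightarrow> nat \<Rightarrow> nat \<Rightarrow> complex" where
  "resolv n m s J h i k =
     (let B = mat n n (\<lambda>(i, k). cov_kernel m s J h i k) in adj_mat B $$ (i, k) / det B)"

lemma herm_cov_kernel: "herm I (cov_kernel m s J h)"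
  unfolding herm_def
proof (intro ballI)
  fix i j
  show "cov_kernel m s J h j i = cnj (cov_kernel m s J h i j)"
    by (simp add: cov_kernel_def mult.commute)
qed

lemma hform_cov_kernel:
  assumes "finite I"
  shows "hform I (cov_kernel m s J h) x = s * sqn I x + (\<Sum>j\<in>J. (cmod (hprod I (scol m h j) x))^2)"
proof -
  have v: "hvec I (cov_kernel m s J h) x i = of_real s * x i + (\<Sum>j\<in>J. scol m h j i * hprod I (scol m h j) x)"
    if "i \<in> I" for i
  proof -
    have "hvec I (cov_kernel m s J h) x i =
      (\<Sum>k\<in>I. (if i = k then of_real s * x k else 0)) + (\<Sum>k\<in>I. \<Sum>j\<in>J. scol m h j i * (cnj (scol m h j k) * x k))"
      unfolding hvec_def sum.distrib[symmetric] cov_kernel_def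
      by (intro sum.cong refl) (simp add: algebra_simps sum_distrib_left)
    also have "(\<Sum>k\<in>I. \<Sum>j\<in>J. scol m h j i * (cnj (scol m h j k) * x k))
       = (\<Sum>j\<in>J. \<Sum>k\<in>I. scol m h j i * (cnj (scol m h j k) * x k))" by (rule sum.swap)
    finally show ?thesis using assms that by (simp add: hprod_def sum_distrib_left)
  qed
  have "hprod I x (hvec I (cov_kernel m s J h) x)
    = (\<Sum>i\<in>I. of_real s * (cnj (x i) * x i)) + (\<Sum>i\<in>I. \<Sum>j\<in>J. (cnj (x i) * scol m h j i) * hprod I (scol m h j) x)"
    unfolding hprod_def[of I x] sum.distrib[symmetric]
    by (intro sum.cong refl) (simp add: v algebra_simps sum_distrib_left)
  also have "(\<Sum>i\<in>I. \<Sum>j\<in>J. (cnj (x i) * scol m h j i) * hprod I (scol m h j) x)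
    = (\<Sum>j\<in>J. \<Sum>i\<in>I. (cnj (x i) * scol m h j i) * hprod I (scol m h j) x)" by (rule sum.swap)
  also have "\<dots> = (\<Sum>j\<in>J. hprod I x (scol m h j) * hprod I (scol m h j) x)"
    by (simp add: hprod_def[of I x] sum_distrib_right)
  also have "\<dots> = (\<Sum>j\<in>J. complex_of_real ((cmod (hprod I (scol m h j) x))^2))"
    by (intro sum.cong refl, subst complex_norm_square) (simp add: cnj_hprod)
  also have "(\<Sum>i\<in>I. of_real s * (cnj (x i) * x i)) = complex_of_real (s * sqn I x)"
    using hprod_self[of I x] by (simp add: hprod_def flip: sum_distrib_left)
  finally have "hprod I x (hvec I (cov_kernel m s J h) x) = complex_of_real (s * sqn I x + (\<Sum>j\<in>J. (cmod (hprod I (scol m h j) x))^2))"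
    by simp
  then show ?thesis by (simp only: hform_def Re_complex_of_real)
qed

lemma cov_kernel_pos:
  "finite I \<Longrightarrow> s * sqn I x \<le> hform I (cov_kernel m s J h) x"
  by (simp add: hform_cov_kernel sum_nonneg)

lemma det_nonzero_of_pos:
  assumes s: "s > 0" and pos: "\<And>x. s * sqn {..<n} x \<le> hform {..<n} K x"
  shows "det (mat n n (\<lambda>(i, k). K i k)) \<noteq> 0"
proof
  assume "det (mat n n (\<lambda>(i, k). K i k)) = 0"
  then obtain v where v: "v \<in> carrier_vec n" "v \<noteq> 0\<^sub>v n" "mat n n (\<lambda>(i, k). K i k) *\<^sub>v v = 0\<^sub>v n"
    using det_0_iff_vec_prod_zero[of "mat n n (\<lambda>(i, k). K i k)" n] by auto
  define x where "x i = vec_index v i" for i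
  have "hvec {..<n} K x i = 0" if "i < n" for i
  proof -
    have "vec_index (mat n n (\<lambda>(i, k). K i k) *\<^sub>v v) i = (\<Sum>k\<in>{0..<n}. K i k * vec_index v k)"
      using that v(1) by (simp add: scalar_prod_def)
    then show ?thesis using v(3) that by (simp add: hvec_def x_def atLeast0LessThan)
  qed
  then have "hform {..<n} K x = 0" by (simp add: hform_def hprod_def)
  with pos[of x] s have "sqn {..<n} x = 0"
    using sqn_nonneg[of "{..<n}" x] by (simp add: mult_le_0_iff)
  then have "x i = 0" if "i < n" for i using that by (simp add: sqn_def sum_nonneg_eq_0_iff)
  then have "v = 0\<^sub>v n" using v(1) by (auto simp: x_def)
  then show False using v by simp
qed

lemma inv_on_adj_mat:
  assumes "det (mat n n (\<lambda>(i, k). K i k)) \<noteq> 0"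
  shows "inv_on {..<n} K (\<lambda>i k. adj_mat (mat n n (\<lambda>(i, k). K i k)) $$ (i, k) / det (mat n n (\<lambda>(i, k). K i k)))"
  unfolding inv_on_def
proof (intro ballI conjI)
  define B where "B = mat n n (\<lambda>(i, k). K i k)"
  have B: "B \<in> carrier_mat n n" by (simp add: B_def)
  note a = adj_mat[OF B]
  have d: "det B \<noteq> 0" using assms by (simp add: B_def)
  have Bi: "B $$ (i, k) = K i k" if "i < n" "k < n" for i k using that by (simp add: B_def)
  fix i k assume "i \<in> {..<n}" "k \<in> {..<n}"
  then have ik: "i < n" "k < n" by auto
  have "(\<Sum>l<n. K i l * (adj_mat B $$ (l, k))) = (B * adj_mat B) $$ (i, k)"
    using ik B a(1) by (simp add: scalar_prod_def atLeast0LessThan Bi)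
  also have "\<dots> = (if i = k then det B else 0)" using ik by (simp add: a(2))
  finally show "(\<Sum>l<n. K i l * (adj_mat (mat n n (\<lambda>(i, k). K i k)) $$ (l, k) / det (mat n n (\<lambda>(i, k). K i k))))
      = (if i = k then 1 else 0)"
    using d unfolding B_def[symmetric] by (simp flip: sum_divide_distrib)
  have "(\<Sum>l<n. adj_mat B $$ (i, l) * K l k) = (adj_mat B * B) $$ (i, k)"
    using ik B a(1) by (simp add: scalar_prod_def atLeast0LessThan Bi)
  also have "\<dots> = (if i = k then det B else 0)" using ik by (simp add: a(3))
  finally show "(\<Sum>l<n. adj_mat (mat n n (\<lambda>(i, k). K i k)) $$ (i, l) / det (mat n n (\<lambda>(i, k). K i k)) * K l k)
      = (if i = k then 1 else 0)"
    using d unfolding B_def[symmetric] by (simp flip: sum_divide_distrib)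
qed

lemma inv_on_resolv:
  assumes "s > 0"
  shows "inv_on {..<n} (cov_kernel m s J h) (resolv n m s J h)"
proof -
  have "det (mat n n (\<lambda>(i, k). cov_kernel m s J h i k)) \<noteq> 0"
    using assms by (rule det_nonzero_of_pos) (rule cov_kernel_pos, simp)
  from inv_on_adj_mat[OF this] show ?thesis
    by (simp add: resolv_def[abs_def] Let_def)
qed

lemma resolv_bounds:
  fixes n m s J h defines "G \<equiv> resolv n m s J h"
  assumes s: "s > 0"
  shows "s * sqn {..<n} (hvec {..<n} G x) \<le> hform {..<n} G x" "0 \<le> hform {..<n} G x"
    "hform {..<n} G x \<le> sqn {..<n} x / s"
  unfolding G_def
  by (rule resolvent_bounds[OF finite_lessThan herm_cov_kernel inv_on_resolv[OF s] s cov_kernel_pos[OF finite_lessThan]])+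

lemmas herm_resolv = inv_on_herm[OF finite_lessThan herm_cov_kernel inv_on_resolv]

text \<open>This carries the independence: with column \<open>j\<close> outside \<open>J\<close>,
  the resolvent stays constant while column \<open>j\<close> is integrated out.\<close>

lemma resolv_cong:
  assumes "\<And>i j. i < n \<Longrightarrow> j \<in> J \<Longrightarrow> h (i, j) = h' (i, j)"
  shows "resolv n m s J h = resolv n m s J h'"
proof -
  have "mat n n (\<lambda>(i, k). cov_kernel m s J h i k) = mat n n (\<lambda>(i, k). cov_kernel m s J h' i k)"
    by (intro cong_mat refl) (auto simp: cov_kernel_def scol_def assms intro!: sum.cong)
  then show ?thesis by (simp add: resolv_def[abs_def])
qed

lemma det_measurable:
  assumes "\<And>h. A h \<in> carrier_mat n n"
    and [measurable]: "\<And>i k. i < n \<Longrightarrow> k < n \<Longrightarrow> (\<lambda>h. A h $$ (i, k)) \<in> borel_measurable M"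
  shows "(\<lambda>h. det (A h) :: complex) \<in> borel_measurable M"
  unfolding det_def'[OF assms(1)]
proof (intro borel_measurable_sum borel_measurable_times borel_measurable_prod borel_measurable_const)
  fix p i assume "p \<in> {p. p permutes {0..<n}}" "i \<in> {0..<n}"
  then have "i < n" "p i < n" using permutes_in_image[of p "{0..<n}" i] by auto
  then show "(\<lambda>h. A h $$ (i, p i)) \<in> borel_measurable M" by measurable
qed

lemma resolv_measurable:
  assumes m: "\<And>i j. i < n \<Longrightarrow> j \<in> J \<Longrightarrow> (\<lambda>h. h (i, j)) \<in> borel_measurable M"
    and ik: "i < n" "k < n"
  shows "(\<lambda>h. resolv n m s J h i k) \<in> borel_measurable M"
proof -
  define B where "B h = mat n n (\<lambda>(i, k). cov_kernel m s J h i k)" for h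
  have B: "B h \<in> carrier_mat n n" for h by (simp add: B_def)
  have mB: "(\<lambda>h. B h $$ (i, k)) \<in> borel_measurable M" if "i < n" "k < n" for i k
  proof -
    have c1: "(\<lambda>h. cnj (h (k, j) / complex_of_real (sqrt (real m)))) \<in> borel_measurable M" if "j \<in> J" for j
      using m[OF \<open>k < n\<close> that] by (intro borel_measurable_cnj borel_measurable_divide borel_measurable_const)
    have eq: "(\<lambda>h. B h $$ (i, k)) = (\<lambda>h. (if i = k then complex_of_real s else 0) +
        (\<Sum>j\<in>J. h (i, j) / complex_of_real (sqrt (real m)) * cnj (h (k, j) / complex_of_real (sqrt (real m)))))"
      using that by (simp only: B_def cov_kernel_def scol_def) simp
    have c2: "(\<lambda>h. h (i, j) / complex_of_real (sqrt (real m))) \<in> borel_measurable M" if "j \<in> J" for j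
      using m[OF \<open>i < n\<close> that] by (intro borel_measurable_divide borel_measurable_const)
    show ?thesis unfolding eq
      by (intro borel_measurable_add borel_measurable_const borel_measurable_sum borel_measurable_times c1 c2)
  qed
  have md: "(\<lambda>h. mat_delete (B h) k i $$ (a, b)) \<in> borel_measurable M" if "a < n - 1" "b < n - 1" for a b
    using that by (auto simp: mat_delete_def B intro!: mB simp: carrier_matD[OF B])
  have "(\<lambda>h. det (mat_delete (B h) k i)) \<in> borel_measurable M"
    by (rule det_measurable[OF mat_delete_carrier[OF B] md])
  moreover have "(\<lambda>h. det (B h)) \<in> borel_measurable M"
    by (rule det_measurable[OF B mB])
  ultimately show ?thesis
    using ik unfolding resolv_def Let_def B_def[symmetric]
    by (simp add: adj_mat_def cofactor_def carrier_matD[OF B])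
qed

section \<open>Gaussian columns and their exceptional events\<close>

lemma column_reindex:
  "sum f ({..<n} \<times> {j}) = (\<Sum>i<n. f (i, j))"
proof -
  have "{..<n} \<times> {j} = (\<lambda>i. (i, j)) ` {..<n}" by auto
  then show ?thesis by (simp add: sum.reindex inj_on_def)
qed

text \<open>A column sits in the product space as the pairs with fixed second index. A kernel that
  ignores this index carries the concentration bound over to forms on rows.\<close>

lemma column_forms:
  fixes G :: "nat \<Rightarrow> nat \<Rightarrow> complex"
  defines "G' \<equiv> (\<lambda>p q :: nat \<times> nat. G (fst p) (fst q))"
  shows "hform ({..<n} \<times> {j}) G' h = hform {..<n} G (\<lambda>i. h (i, j))"
    "htrace ({..<n} \<times> {j}) G' = htrace {..<n} G"
    "sqn ({..<n} \<times> {j}) h = sqn {..<n} (\<lambda>i. h (i, j))"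
    "herm {..<n} G \<Longrightarrow> herm ({..<n} \<times> {j}) G'"
proof -
  show "herm ({..<n} \<times> {j}) G'" if "herm {..<n} G"
    unfolding herm_def G'_def
  proof (intro ballI)
    fix p q assume "p \<in> {..<n} \<times> {j}" "q \<in> {..<n} \<times> {j}"
    then show "G (fst q) (fst p) = cnj (G (fst p) (fst q))"
      by (intro hermD[OF that]) auto
  qed
qed (simp_all add: hform_def hprod_def hvec_def htrace_def sqn_def column_reindex G'_def)

text \<open>\<open>J\<close> is general for two uses: all columns but \<open>j\<close> for the
  self-consistent equation, and no column with \<open>s = 1\<close>, where the resolvent is the
  identity and the event concerns the norm of column \<open>j\<close>.\<close>

definition bad_column :: "nat \<Rightarrow> nat \<Rightarrow> real \<Rightarrow> real \<Rightarrow> nat set \<Rightarrow> nat \<Rightarrow> (nat \<times> nat \<Rightarrow> complex) set" where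
  "bad_column n m s \<epsilon> J j = {h \<in> space (PiM ({..<n} \<times> {..<m}) (\<lambda>_. cgauss)).
     \<epsilon> * n \<le> \<bar>hform {..<n} (resolv n m s J h) (\<lambda>i. h (i, j))
        - htrace {..<n} (resolv n m s J h)\<bar>}"

lemma component_measurable_cgauss:
  "p \<in> I \<Longrightarrow> (\<lambda>x. x p) \<in> borel_measurable (PiM I (\<lambda>_. cgauss))"
  using measurable_component_singleton[of p I "\<lambda>_. cgauss"]
    measurable_cong_sets[OF refl cgauss_sets] by blast

lemma bad_column_measurable:
  assumes j: "j < m" and J: "J \<subseteq> {..<m}"
  shows "bad_column n m s \<epsilon> J j \<in> sets (PiM ({..<n} \<times> {..<m}) (\<lambda>_. cgauss))"
proof -
  let ?P = "PiM ({..<n} \<times> {..<m}) (\<lambda>_. cgauss)"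
  have c: "(\<lambda>x. x (i, j)) \<in> borel_measurable ?P" if "i < n" "j < m" for i j
    using that by (intro component_measurable_cgauss) auto
  have cc: "(\<lambda>x. cnj (x (i, j))) \<in> borel_measurable ?P" if "i < n" "j < m" for i j
    using c[OF that] by (rule borel_measurable_cnj)
  have r: "(\<lambda>h. resolv n m s J h i k) \<in> borel_measurable ?P" if "i < n" "k < n" for i k
    using that J by (intro resolv_measurable c) auto
  have "(\<lambda>h. hprod {..<n} (\<lambda>i. h (i, j)) (hvec {..<n} (resolv n m s J h) (\<lambda>i. h (i, j)))) \<in> borel_measurable ?P"
    unfolding hprod_def hvec_def
    by (intro borel_measurable_sum borel_measurable_times cc c r j) auto
  then have [measurable]: "(\<lambda>h. hform {..<n} (resolv n m s J h) (\<lambda>i. h (i, j))) \<in> borel_measurable ?P"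
    unfolding hform_def by measurable
  have [measurable]: "(\<lambda>h. htrace {..<n} (resolv n m s J h)) \<in> borel_measurable ?P"
    unfolding htrace_def by (intro borel_measurable_sum borel_measurable_Re[THEN measurable_compose[rotated]] r) auto
  show ?thesis unfolding bad_column_def by measurable
qed

text \<open>Fubini with column \<open>j\<close> innermost: the other columns are frozen, and the
  resolvent is a fixed kernel between 0 and \<open>1 / s\<close>. The exponent is that of
  \<open>hform_concentration\<close> for \<open>C = 1 / s\<close>.\<close>

lemma bad_column_bound:
  assumes j: "j < m" and J: "J \<subseteq> {..<m}" "j \<notin> J" and s: "s > 0" and e: "\<epsilon> > 0" "\<epsilon> \<le> 2 / s"
  shows "emeasure (PiM ({..<n} \<times> {..<m}) (\<lambda>_. cgauss)) (bad_column n m s \<epsilon> J j)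
    \<le> ennreal (3 * exp (- (\<epsilon>^2 * s^2 / 32) * n))"
proof -
  interpret prob_space cgauss by (rule prob_space_cgauss)
  interpret product_sigma_finite "\<lambda>_::nat \<times> nat. cgauss" by standard
  let ?R = "{..<n} \<times> ({..<m} - {j})" and ?C = "{..<n} \<times> {j}" and ?I = "{..<n} \<times> {..<m}"
  let ?b = "ennreal (3 * exp (- (\<epsilon>^2 * s^2 / 32) * n))"
  have I: "?I = ?R \<union> ?C" "?R \<inter> ?C = {}" using j by auto
  note [measurable] = bad_column_measurable[OF j J(1), of n s \<epsilon>]
  have "emeasure (PiM ?I (\<lambda>_. cgauss)) (bad_column n m s \<epsilon> J j)
     = (\<integral>\<^sup>+h. indicator (bad_column n m s \<epsilon> J j) h \<partial>PiM ?I (\<lambda>_. cgauss))" by simp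
  also have "\<dots> = (\<integral>\<^sup>+x. \<integral>\<^sup>+y. indicator (bad_column n m s \<epsilon> J j) (merge ?R ?C (x, y)) \<partial>PiM ?C (\<lambda>_. cgauss) \<partial>PiM ?R (\<lambda>_. cgauss))"
    unfolding I(1) by (rule product_nn_integral_fold) (use I bad_column_measurable[OF j J(1), of n s \<epsilon>] in \<open>auto simp flip: I(1)\<close>)
  also have "\<dots> \<le> (\<integral>\<^sup>+x. ?b \<partial>PiM ?R (\<lambda>_. cgauss))"
  proof (rule nn_integral_mono)
    fix x assume x: "x \<in> space (PiM ?R (\<lambda>_. cgauss))"
    define G where "G = resolv n m s J x"
    have G: "resolv n m s J (merge ?R ?C (x, y)) = G" for y
      unfolding G_def by (rule resolv_cong) (use J in \<open>auto simp: merge_def\<close>)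
    have y: "(\<lambda>i. merge ?R ?C (x, y) (i, j)) i = y (i, j)" if "i < n" for y i
      using that by (simp add: merge_def)
    have hf: "hform {..<n} G (\<lambda>i. merge ?R ?C (x, y) (i, j)) = hform {..<n} G (\<lambda>i. y (i, j))" for y
      unfolding hform_def hprod_def hvec_def by (simp add: merge_def)
    let ?G' = "\<lambda>p q :: nat \<times> nat. G (fst p) (fst q)"
    let ?S = "{y \<in> space (PiM ?C (\<lambda>_. cgauss)). \<bar>hform ?C ?G' y - htrace ?C ?G'\<bar> \<ge> \<epsilon> * card ?C}"
    have hG: "herm {..<n} G" unfolding G_def using s by (rule herm_resolv)
    have "(\<integral>\<^sup>+y. indicator (bad_column n m s \<epsilon> J j) (merge ?R ?C (x, y)) \<partial>PiM ?C (\<lambda>_. cgauss))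
       \<le> (\<integral>\<^sup>+y. indicator ?S y \<partial>PiM ?C (\<lambda>_. cgauss))"
      by (intro nn_integral_mono) (auto simp: bad_column_def indicator_def G hf column_forms)
    also have "\<dots> = emeasure (PiM ?C (\<lambda>_. cgauss)) ?S"
      using hform_measurable[of ?C ?C ?G'] by (intro nn_integral_indicator) measurable
    also have "\<dots> \<le> ennreal (3 * exp (- (\<epsilon>^2 / (32 * (1 / s)^2)) * card ?C))"
      using s e hG resolv_bounds[OF s, where n=n and m=m and J=J and h=x]
      by (intro hform_concentration column_forms) (auto simp: column_forms G_def)
    finally show "(\<integral>\<^sup>+y. indicator (bad_column n m s \<epsilon> J j) (merge ?R ?C (x, y)) \<partial>PiM ?C (\<lambda>_. cgauss)) \<le> ?b"
      using s by (simp add: power_divide card_cartesian_product)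
  qed
  also have "\<dots> = ?b"
    using prob_space.emeasure_space_1[OF finite_product_cgauss[of ?R]] by simp
  finally show ?thesis .
qed


section \<open>Deterministic consequences on good events\<close>

lemma resolv_empty:
  assumes "i < n" "k < n"
  shows "resolv n m 1 {} h i k = (if i = k then 1 else 0)"
proof -
  have "(\<Sum>l<n. resolv n m 1 {} h i l * cov_kernel m 1 {} h l k) = (if i = k then 1 else 0)"
    using inv_on_resolv[of 1 n m "{}" h] assms unfolding inv_on_def by simp
  then show ?thesis using assms
    by (simp add: cov_kernel_def if_distrib[of "\<lambda>c. _ * c"] sum.delta cong: if_cong)
qed

text \<open>Reuses the concentration event for the column norms, on which the mean of the spectrum
  depends.\<close>

lemma good_column_norm:
  assumes h: "h \<in> space (PiM ({..<n} \<times> {..<m}) (\<lambda>_. cgauss))" "h \<notin> bad_column n m 1 \<epsilon> {} j"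
  shows "\<bar>(\<Sum>i<n. (cmod (h (i, j)))^2) - n\<bar> < \<epsilon> * n"
proof -
  let ?G = "resolv n m 1 {} h"
  have "hvec {..<n} ?G x i = x i" if "i < n" for x i
    using that by (simp add: hvec_def resolv_empty if_distrib[of "\<lambda>c. c * _"] sum.delta cong: if_cong)
  then have "hprod {..<n} x (hvec {..<n} ?G x) = hprod {..<n} x x" for x
    by (intro hprod_cong) auto
  then have "hform {..<n} ?G x = sqn {..<n} x" for x
    by (simp add: hform_def hprod_self)
  moreover have "htrace {..<n} ?G = n" by (simp add: htrace_def resolv_empty)
  ultimately show ?thesis using h by (simp add: bad_column_def sqn_def)
qed

text \<open>The trace identity and Sherman--Morrison give
  \<open>n = s tr + (\<Sum>j. q j / (1 + q j))\<close>. On the good event every \<open>q j\<close>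
  is close to \<open>T = tr / m\<close>, and \<open>q / (1 + q)\<close> does not enlarge distances
  on the nonnegative axis. Division by \<open>n\<close> yields the approximate equation.\<close>

lemma resolv_self_consistent:
  assumes s: "s > 0" and n: "n > 0" and m: "m > 0"
    and h: "h \<in> space (PiM ({..<n} \<times> {..<m}) (\<lambda>_. cgauss))"
    and good: "\<And>j. j < m \<Longrightarrow> h \<notin> bad_column n m s \<epsilon> ({..<m} - {j}) j"
  defines "g \<equiv> htrace {..<n} (resolv n m s {..<m} h) / n"
  shows "0 \<le> g" "g \<le> 1 / s"
    "\<bar>1 - s * g - g / (1 + real n / real m * g)\<bar> \<le> \<epsilon> + 1 / (s * n)"
proof -
  let ?I = "{..<n}"
  let ?tr = "\<lambda>J. htrace ?I (resolv n m s J h)"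
  let ?v = "scol m h"
  define q where "q j = hform ?I (resolv n m s ({..<m} - {j}) h) (?v j)" for j
  define T where "T = ?tr {..<m} / m"
  have fin: "finite ?I" by simp
  have diag: "0 \<le> Re (resolv n m s J h i i) \<and> Re (resolv n m s J h i i) \<le> 1 / s" if i: "i < n" for i J
  proof -
    define e where "e k = (if k = i then 1 else 0 :: complex)" for k
    have "hvec ?I (resolv n m s J h) e k = resolv n m s J h k i" for k
      using i by (simp add: hvec_def e_def if_distrib[of "\<lambda>c. _ * c"] sum.delta cong: if_cong)
    then have "hform ?I (resolv n m s J h) e = Re (resolv n m s J h i i)"
      using i by (simp add: hform_def hprod_def e_def if_distrib[of cnj] if_distrib[of "\<lambda>c. c * _"] sum.delta cong: if_cong)
    moreover have "sqn ?I e = 1"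
      using i by (simp add: sqn_def e_def if_distrib[of cmod] if_distrib[of "\<lambda>c. c^2"] sum.delta cong: if_cong)
    ultimately show ?thesis using resolv_bounds(2,3)[OF s, where n=n and m=m and J=J and h=h and x=e] s by simp
  qed
  have tr: "0 \<le> ?tr {..<m}" "?tr {..<m} \<le> n * (1 / s)"
    unfolding htrace_def using diag sum_bounded_above[of ?I "\<lambda>i. Re (resolv n m s {..<m} h i i)" "1 / s"]
    by (auto intro!: sum_nonneg)
  show "0 \<le> g" using tr by (simp add: g_def)
  show "g \<le> 1 / s" using tr n by (simp add: g_def field_simps)
  have T0: "T \<ge> 0" using tr by (simp add: T_def)
  have q0: "q j \<ge> 0" for j unfolding q_def by (rule resolv_bounds(2)[OF s])
  have upd: "cov_kernel m s {..<m} h i k = cov_kernel m s ({..<m} - {j}) h i k + ?v j i * cnj (?v j k)"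
    if "j < m" for i j k
    unfolding cov_kernel_def using that by (simp add: sum.remove[of "{..<m}" j])
  have loo: "hform ?I (resolv n m s {..<m} h) (?v j) = q j / (1 + q j)"
      "0 \<le> ?tr ({..<m} - {j}) - ?tr {..<m}" "?tr ({..<m} - {j}) - ?tr {..<m} \<le> 1 / s" if "j < m" for j
    unfolding q_def
    by (rule leave_one_out[OF fin herm_cov_kernel inv_on_resolv[OF s] s cov_kernel_pos[OF fin]
          inv_on_resolv[OF s] upd[OF that]]; assumption?)+
  have "real n = s * ?tr {..<m} + (\<Sum>j<m. hform ?I (resolv n m s {..<m} h) (?v j))"
    using sum_resolvent_forms[OF fin inv_on_resolv[OF s, where n=n and m=m and J="{..<m}" and h=h], where s=s and J="{..<m}" and v="?v"]
    by (simp add: cov_kernel_def)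
  then have main: "real n = s * ?tr {..<m} + (\<Sum>j<m. q j / (1 + q j))" using loo(1) by simp
  have scale: "q j = hform ?I (resolv n m s ({..<m} - {j}) h) (\<lambda>i. h (i, j)) / m" for j
  proof -
    let ?r = "complex_of_real (sqrt m)"
    have r2: "cnj ?r * ?r = of_nat m" by (simp flip: of_real_mult)
    have "hprod ?I (?v j) (hvec ?I (resolv n m s ({..<m} - {j}) h) (?v j))
      = hprod ?I (\<lambda>i. h (i, j)) (hvec ?I (resolv n m s ({..<m} - {j}) h) (\<lambda>i. h (i, j))) / (cnj ?r * ?r)"
      by (simp add: hprod_def hvec_def scol_def sum_divide_distrib[symmetric] sum_distrib_left mult_ac)
    then show ?thesis unfolding r2 by (simp only: q_def hform_def Re_divide_of_nat)
  qed
  \<comment> \<open>\<open>\<epsilon> n\<close> comes from concentration, \<open>1 / s\<close> from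
    the change of the trace when column \<open>j\<close> is restored, and the division by
    \<open>m\<close> from the scaling of the columns.\<close>
  define \<delta> where "\<delta> = (\<epsilon> * n + 1 / s) / m"
  have qT: "\<bar>q j - T\<bar> \<le> \<delta>" if j: "j < m" for j
  proof -
    have "\<bar>hform ?I (resolv n m s ({..<m} - {j}) h) (\<lambda>i. h (i, j)) - ?tr ({..<m} - {j})\<bar> < \<epsilon> * n"
      using good[OF j] h by (simp add: bad_column_def)
    with loo(2,3)[OF j] have "\<bar>hform ?I (resolv n m s ({..<m} - {j}) h) (\<lambda>i. h (i, j)) - ?tr {..<m}\<bar> \<le> \<epsilon> * n + 1 / s"
      by linarith
    then have "\<bar>hform ?I (resolv n m s ({..<m} - {j}) h) (\<lambda>i. h (i, j)) - ?tr {..<m}\<bar> / m \<le> \<delta>"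
      unfolding \<delta>_def by (rule divide_right_mono) simp
    then show ?thesis unfolding scale T_def by (simp flip: diff_divide_distrib add: abs_divide)
  qed
  have lip: "\<bar>q j / (1 + q j) - T / (1 + T)\<bar> \<le> \<delta>" if j: "j < m" for j
  proof -
    have "q j / (1 + q j) - T / (1 + T) = (q j - T) / ((1 + q j) * (1 + T))"
      using q0[of j] T0 by (simp add: field_simps)
    also have "\<bar>\<dots>\<bar> = \<bar>q j - T\<bar> / ((1 + q j) * (1 + T))"
      using q0[of j] T0 by (simp add: abs_mult)
    also have "\<dots> \<le> \<bar>q j - T\<bar> / 1"
    proof (rule divide_left_mono)
      have "1 * 1 \<le> (1 + q j) * (1 + T)" using q0[of j] T0 by (intro mult_mono) auto
      then show "1 \<le> (1 + q j) * (1 + T)" by simp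
      then show "0 < (1 + q j) * (1 + T) * 1" by simp
    qed simp
    finally show ?thesis using qT[OF j] by simp
  qed
  have "\<bar>(\<Sum>j<m. q j / (1 + q j)) - m * (T / (1 + T))\<bar> = \<bar>\<Sum>j<m. q j / (1 + q j) - T / (1 + T)\<bar>"
    by (simp add: sum_subtractf)
  also have "\<dots> \<le> (\<Sum>j<m. \<delta>)" by (rule order_trans[OF sum_abs sum_mono]) (use lip in auto)
  also have "\<dots> = \<epsilon> * n + 1 / s" using m by (simp add: \<delta>_def)
  finally have "\<bar>real n - s * ?tr {..<m} - m * (T / (1 + T))\<bar> \<le> \<epsilon> * n + 1 / s" using main by simp
  then have "\<bar>real n - s * ?tr {..<m} - m * (T / (1 + T))\<bar> / n \<le> (\<epsilon> * n + 1 / s) / n"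
    by (rule divide_right_mono) simp
  also have "\<bar>real n - s * ?tr {..<m} - m * (T / (1 + T))\<bar> / n
      = \<bar>(real n - s * ?tr {..<m} - m * (T / (1 + T))) / n\<bar>" by simp
  also have "(real n - s * ?tr {..<m} - m * (T / (1 + T))) / n = 1 - s * g - g / (1 + real n / real m * g)"
  proof -
    \<comment> \<open>\<open>T\<close> equals \<open>n / m * g\<close>, which is how the aspect
      ratio enters the equation.\<close>
    have "m * (T / (1 + T)) / n = g / (1 + real n / real m * g)"
      using n m by (simp add: T_def g_def)
    then show ?thesis using n by (simp add: g_def diff_divide_distrib)
  qed
  also have "(\<epsilon> * n + 1 / s) / n = \<epsilon> + 1 / (s * n)" using n by (simp add: field_simps)
  finally show "\<bar>1 - s * g - g / (1 + real n / real m * g)\<bar> \<le> \<epsilon> + 1 / (s * n)" .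
qed

section \<open>Eigenvalues and the trace of the resolvent\<close>

lemma poly_pderiv_linear_factors:
  fixes z :: "'a :: field"
  assumes "\<And>a. a \<in> set as \<Longrightarrow> z \<noteq> a"
  shows "poly (pderiv (\<Prod>a\<leftarrow>as. [:- a, 1:])) z = poly (\<Prod>a\<leftarrow>as. [:- a, 1:]) z * (\<Sum>a\<leftarrow>as. 1 / (z - a))"
  using assms
proof (induction as)
  case (Cons a as)
  let ?p = "\<Prod>a\<leftarrow>as. [:- a, 1:]"
  have za: "z - a \<noteq> 0" using Cons.prems[of a] by simp
  have IH: "poly (pderiv ?p) z = poly ?p z * (\<Sum>a\<leftarrow>as. 1 / (z - a))" using Cons by simp
  have "poly (pderiv ([:- a, 1:] * ?p)) z = (z - a) * poly (pderiv ?p) z + poly ?p z"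
    by (subst pderiv_mult) (simp add: pderiv_pCons algebra_simps)
  also have "\<dots> = (z - a) * poly ?p z * (1 / (z - a) + (\<Sum>a\<leftarrow>as. 1 / (z - a)))"
    using za unfolding IH by (simp add: distrib_left)
  also have "(z - a) * poly ?p z = poly ([:- a, 1:] * ?p) z"
    by (simp only: poly_mult) simp
  finally show ?case by (simp only: list.map prod_list.Cons sum_list.Cons)
qed simp

lemma det_uminus:
  fixes B :: "'a :: comm_ring_1 mat"
  assumes "B \<in> carrier_mat n n"
  shows "det (- B) = (- 1) ^ n * det B"
proof -
  have "- B = (- 1) \<cdot>\<^sub>m B" using assms by (intro eq_matI) auto
  then show ?thesis using assms by simp
qed

lemma mat_adjoint_index:
  assumes "i < dim_col A" "j < dim_row A"
  shows "mat_adjoint A $$ (i, j) = conjugate (A $$ (j, i))"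
  using assms by (simp add: mat_adjoint_def mat_of_rows_index)

lemma sample_cov_mat:
  fixes h :: "nat \<Rightarrow> nat \<Rightarrow> complex"
  shows "complex_of_real (1 / real m) \<cdot>\<^sub>m (mat n m (\<lambda>(i, j). h i j) * mat_adjoint (mat n m (\<lambda>(i, j). h i j)))
    = mat n n (\<lambda>(i, k). cov_kernel m 0 {..<m} (\<lambda>(i, j). h i j) i k)" (is "?L = ?R")
proof (rule eq_matI)
  let ?H = "mat n m (\<lambda>(i, j). h i j)"
  have ad: "mat_adjoint ?H \<in> carrier_mat m n" by (simp add: mat_adjoint_def carrier_matI)
  fix i k assume "i < dim_row ?R" "k < dim_col ?R"
  then have ik: "i < n" "k < n" by auto
  have "(?H * mat_adjoint ?H) $$ (i, k) = (\<Sum>j<m. h i j * cnj (h k j))"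
    using ik ad by (simp add: scalar_prod_def atLeast0LessThan mat_adjoint_index)
  moreover have "dim_col (mat_adjoint ?H) = n" "dim_row (?H * mat_adjoint ?H) = n" using ad by auto
  ultimately show "?L $$ (i, k) = ?R $$ (i, k)"
    using ik by (simp add: cov_kernel_def scol_def sum_divide_distrib flip: of_real_mult)
qed (auto simp: mat_adjoint_def)

lemma cov_kernel_shift:
  "cov_kernel m s J h i k = cov_kernel m 0 J h i k + (if i = k then complex_of_real s else 0)"
  by (simp add: cov_kernel_def)

context
  fixes n m :: nat and h :: "nat \<times> nat \<Rightarrow> complex" and A :: "complex mat"
  assumes A_def: "A = mat n n (\<lambda>(i, k). cov_kernel m 0 {..<m} h i k)"
begin

lemma cov_carrier: "A \<in> carrier_mat n n"
  by (simp add: A_def)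

text \<open>A root is the Rayleigh quotient of an eigenvector, and the form is a sum of squares, so
  reality and sign come together.\<close>

lemma cov_root:
  assumes "poly (char_poly A) a = 0"
  shows "\<exists>r\<ge>0. a = complex_of_real r"
proof -
  from assms obtain v where v: "v \<in> carrier_vec n" "v \<noteq> 0\<^sub>v n" "A *\<^sub>v v = a \<cdot>\<^sub>v v"
    using eigenvalue_root_char_poly[OF cov_carrier, of a] cov_carrier
    by (auto simp: eigenvalue_def eigenvector_def)
  define x where "x i = vec_index v i" for i
  let ?K = "cov_kernel m 0 {..<m} h"
  have Kx: "hvec {..<n} ?K x i = a * x i" if "i < n" for i
  proof -
    have "vec_index (A *\<^sub>v v) i = (\<Sum>k\<in>{0..<n}. ?K i k * vec_index v k)"
      using that v(1) by (simp add: scalar_prod_def A_def)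
    then show ?thesis using v that by (simp add: hvec_def x_def atLeast0LessThan)
  qed
  have "hprod {..<n} x (hvec {..<n} ?K x) = hprod {..<n} x (\<lambda>i. a * x i)"
    by (rule hprod_cong) (auto simp: Kx)
  also have "\<dots> = a * sqn {..<n} x"
    unfolding hprod_self[symmetric] by (simp add: hprod_def sum_distrib_left mult_ac)
  finally have e: "a * sqn {..<n} x = complex_of_real (hform {..<n} ?K x)"
    by (simp add: hprod_hvec_real[OF herm_cov_kernel])
  have "sqn {..<n} x \<noteq> 0"
  proof
    assume "sqn {..<n} x = 0"
    then have "x i = 0" if "i < n" for i using that by (simp add: sqn_def sum_nonneg_eq_0_iff)
    then have "v = 0\<^sub>v n" using v(1) by (auto simp: x_def)
    then show False using v by simp
  qed
  then have "a = complex_of_real (hform {..<n} ?K x / sqn {..<n} x)"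
    using e by (simp add: field_simps)
  moreover have "hform {..<n} ?K x / sqn {..<n} x \<ge> 0"
    by (simp add: hform_cov_kernel sum_nonneg)
  ultimately show ?thesis by blast
qed

text \<open>The choice in \<open>real_eigvals\<close> says something only if a witness exists. The
  complex roots provide one: they are real by \<open>cov_root\<close>, so their sorted real parts
  factor the characteristic polynomial.\<close>

lemma real_eigvals_cov:
  defines "ls \<equiv> real_eigvals A"
  shows "length ls = n" "char_poly A = (\<Prod>l\<leftarrow>ls. [:- complex_of_real l, 1:])"
    "\<And>l. l \<in> set ls \<Longrightarrow> l \<ge> 0"
proof -
  obtain as where as: "char_poly A = (\<Prod>a\<leftarrow>as. [:- a, 1:])" "length as = n"
    using char_poly_factorized[OF cov_carrier] by auto
  have re: "complex_of_real (Re a) = a" if "a \<in> set as" for a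
  proof -
    have "poly (char_poly A) a = 0" unfolding as poly_prod_list using that by (auto simp: prod_list_zero_iff)
    from cov_root[OF this] show ?thesis by auto
  qed
  let ?P = "\<lambda>ls. sorted ls \<and> length ls = dim_row A \<and> char_poly A = (\<Prod>l\<leftarrow>ls. [:- complex_of_real l, 1:])"
  have "char_poly A = (\<Prod>l\<leftarrow>map Re as. [:- complex_of_real l, 1:])"
    unfolding as(1) map_map by (intro arg_cong[where f = prod_list] map_cong refl) (simp add: re)
  also have "\<dots> = (\<Prod>l\<leftarrow>sort (map Re as). [:- complex_of_real l, 1:])"
    unfolding prod_mset_prod_list[symmetric] mset_map by simp
  finally have "?P (sort (map Re as))" using as cov_carrier by simp
  then have P: "?P ls" unfolding ls_def real_eigvals_def by (rule someI)
  then show "length ls = n" and cp: "char_poly A = (\<Prod>l\<leftarrow>ls. [:- complex_of_real l, 1:])"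
    using cov_carrier by auto
  show "l \<ge> 0" if "l \<in> set ls" for l
  proof -
    have "poly (char_poly A) (complex_of_real l) = 0"
      unfolding cp poly_prod_list using that by (auto simp: prod_list_zero_iff)
    from cov_root[OF this] show ?thesis by auto
  qed
qed

text \<open>Up to sign, the trace is the logarithmic derivative of the characteristic polynomial at \<open>- s\<close>; its
  derivative is the sum of the characteristic polynomials of the principal minors.\<close>

lemma sum_inverse_real_eigvals:
  assumes s: "s > 0"
  shows "(\<Sum>l\<leftarrow>real_eigvals A. 1 / (l + s)) = htrace {..<n} (resolv n m s {..<m} h)"
proof -
  define ls where "ls = real_eigvals A"
  note ls = real_eigvals_cov[folded ls_def]
  define B where "B = mat n n (\<lambda>(i, k). cov_kernel m s {..<m} h i k)"
  have B: "B \<in> carrier_mat n n" by (simp add: B_def)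
  let ?z = "- complex_of_real s"
  have cm: "char_matrix A ?z = B"
    by (rule eq_matI) (auto simp: char_matrix_def A_def B_def cov_kernel_shift[of m s])
  have cmd: "char_matrix (mat_delete A i i) ?z = mat_delete B i i" if "i < n" for i
    by (rule eq_matI) (use that in \<open>auto simp: char_matrix_def A_def B_def mat_delete_def cov_kernel_shift[of m s]\<close>)
  have d: "det B \<noteq> 0"
    unfolding B_def using s by (rule det_nonzero_of_pos) (rule cov_kernel_pos, simp)
  have cp: "poly (char_poly A) ?z = (- 1) ^ n * det B"
    unfolding char_poly_matrix[OF cov_carrier] cm by (rule det_uminus[OF B])
  have "poly (pderiv (char_poly A)) ?z = (\<Sum>i<n. poly (char_poly (mat_delete A i i)) ?z)"
    by (simp add: pderiv_char_poly[OF cov_carrier] poly_sum)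
  also have "\<dots> = (\<Sum>i<n. (- 1) ^ (n - 1) * det (mat_delete B i i))"
  proof (intro sum.cong refl)
    fix i assume "i \<in> {..<n}"
    then have i: "i < n" by simp
    have c: "mat_delete B i i \<in> carrier_mat (n - 1) (n - 1)" by (rule mat_delete_carrier[OF B])
    show "poly (char_poly (mat_delete A i i)) ?z = (- 1) ^ (n - 1) * det (mat_delete B i i)"
      unfolding char_poly_matrix[OF mat_delete_carrier[OF cov_carrier]] cmd[OF i]
      by (rule det_uminus[OF c])
  qed
  \<comment> \<open>Diagonal cofactors carry the sign +1, so principal minors divided by
    \<open>det B\<close> are the diagonal entries of the resolvent.\<close>
  also have "\<dots> = (- 1) ^ (n - 1) * det B * (\<Sum>i<n. resolv n m s {..<m} h i i)"
    using d B unfolding resolv_def Let_def B_def[symmetric]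
    by (simp add: adj_mat_def cofactor_def sum_distrib_left flip: power_add mult_2)
  finally have pd: "poly (pderiv (char_poly A)) ?z = (- 1) ^ (n - 1) * det B * (\<Sum>i<n. resolv n m s {..<m} h i i)" .
  have "poly (pderiv (char_poly A)) ?z = poly (char_poly A) ?z * (\<Sum>a\<leftarrow>map complex_of_real ls. 1 / (?z - a))"
  proof -
    have "?z \<noteq> a" if "a \<in> set (map complex_of_real ls)" for a
      using that s by (auto simp: complex_eq_iff dest!: ls(3))
    from poly_pderiv_linear_factors[of "map complex_of_real ls", OF this] show ?thesis
      unfolding ls(2) by (simp add: comp_def)
  qed
  also have "(\<Sum>a\<leftarrow>map complex_of_real ls. 1 / (?z - a)) = - complex_of_real (\<Sum>l\<leftarrow>ls. 1 / (l + s))"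
  proof -
    have "1 / (?z - complex_of_real l) = - complex_of_real (1 / (l + s))" for l
    proof -
      have "?z - complex_of_real l = - complex_of_real (l + s)" by simp
      then show ?thesis by (simp only: minus_divide_right[symmetric] of_real_divide of_real_1)
    qed
    then show ?thesis by (induction ls) auto
  qed
  finally have "(- 1) ^ (n - 1) * det B * (\<Sum>i<n. resolv n m s {..<m} h i i) = (- 1) ^ n * det B * - complex_of_real (\<Sum>l\<leftarrow>ls. 1 / (l + s))"
    unfolding pd cp .
  \<comment> \<open>For \<open>n = 0\<close> the truncated \<open>n - 1\<close> is again 0 and the
    signs do not cancel as usual; both sums are empty there.\<close>
  then have "(\<Sum>i<n. resolv n m s {..<m} h i i) = complex_of_real (\<Sum>l\<leftarrow>ls. 1 / (l + s))"
  proof (cases n)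
    case 0
    then have "ls = []" using ls by simp
    then show ?thesis using 0 by simp
  next
    case (Suc k)
    then show "(- 1) ^ (n - 1) * det B * (\<Sum>i<n. resolv n m s {..<m} h i i) = (- 1) ^ n * det B * - complex_of_real (\<Sum>l\<leftarrow>ls. 1 / (l + s)) \<Longrightarrow> ?thesis" using d by simp
  qed
  then have "Re (\<Sum>i<n. resolv n m s {..<m} h i i) = Re (complex_of_real (\<Sum>l\<leftarrow>ls. 1 / (l + s)))" by simp
  then show ?thesis by (simp add: htrace_def ls_def)
qed

text \<open>The trace is invariant under similarity, and Schur triangularisation puts the prescribed
  list of eigenvalues on the diagonal.\<close>

lemma sum_real_eigvals:
  "(\<Sum>l\<leftarrow>real_eigvals A. l) = (\<Sum>i<n. \<Sum>j<m. (cmod (h (i, j)))^2) / m"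
proof -
  define ls where "ls = real_eigvals A"
  note ls = real_eigvals_cov[folded ls_def]
  obtain T P Q where S: "schur_decomposition A (map complex_of_real ls) = (T, P, Q)"
    by (cases "schur_decomposition A (map complex_of_real ls)") auto
  have "similar_mat_wit A T P Q \<and> upper_triangular T \<and> diag_mat T = map complex_of_real ls"
    by (rule schur_decomposition[OF cov_carrier _ S]) (simp add: ls(2) comp_def)
  then have sim: "similar_mat_wit A T P Q" and dg: "diag_mat T = map complex_of_real ls" by auto
  from similar_mat_witD2[OF cov_carrier sim]
  have PQ: "Q * P = 1\<^sub>m n" "A = P * T * Q" and c: "T \<in> carrier_mat n n" "P \<in> carrier_mat n n" "Q \<in> carrier_mat n n"
    by auto
  have comm: "(\<Sum>i<n. (X * Y) $$ (i, i)) = (\<Sum>i<n. (Y * X) $$ (i, i))"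
    if "X \<in> carrier_mat n n" "Y \<in> carrier_mat n n" for X Y :: "complex mat"
  proof -
    have "(\<Sum>i<n. (X * Y) $$ (i, i)) = (\<Sum>i<n. \<Sum>k<n. X $$ (i, k) * Y $$ (k, i))"
      using that by (intro sum.cong refl) (simp add: scalar_prod_def atLeast0LessThan)
    also have "\<dots> = (\<Sum>k<n. \<Sum>i<n. X $$ (i, k) * Y $$ (k, i))" by (rule sum.swap)
    also have "\<dots> = (\<Sum>i<n. (Y * X) $$ (i, i))"
      using that by (intro sum.cong refl) (simp add: scalar_prod_def atLeast0LessThan mult.commute)
    finally show ?thesis .
  qed
  have "(\<Sum>i<n. A $$ (i, i)) = (\<Sum>i<n. (Q * (P * T)) $$ (i, i))"
    unfolding PQ(2) using c by (intro comm) auto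
  also have "Q * (P * T) = T" using c by (simp add: PQ(1) flip: assoc_mult_mat[of Q n n P n T n])
  also have "(\<Sum>i<n. T $$ (i, i)) = sum_list (diag_mat T)"
    using c by (simp add: diag_mat_def interv_sum_list_conv_sum_set_nat atLeast0LessThan)
  also have "\<dots> = complex_of_real (sum_list ls)" unfolding dg by (induction ls) auto
  finally have "complex_of_real (sum_list ls) = (\<Sum>i<n. \<Sum>j<m. scol m h j i * cnj (scol m h j i))"
    by (simp add: A_def cov_kernel_def)
  also have "\<dots> = complex_of_real ((\<Sum>i<n. \<Sum>j<m. (cmod (h (i, j)))^2) / m)"
  proof -
    have "scol m h j i * cnj (scol m h j i) = complex_of_real ((cmod (h (i, j)))^2 / m)" for i j
      unfolding complex_norm_square[symmetric] scol_def by (simp add: norm_divide power_divide)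
    then show ?thesis by (simp add: sum_divide_distrib)
  qed
  finally show ?thesis unfolding of_real_eq_iff by (simp add: ls_def)
qed

end

section \<open>Almost sure convergence of the empirical Stieltjes transform\<close>

text \<open>Restriction to the rectangle yields a point of the product space; the model says nothing
  about entries outside it.\<close>

definition entries :: "nat \<Rightarrow> nat \<Rightarrow> (nat \<Rightarrow> nat \<Rightarrow> complex) \<Rightarrow> nat \<times> nat \<Rightarrow> complex" where
  "entries n m h = (\<lambda>p\<in>{..<n} \<times> {..<m}. h (fst p) (snd p))"

text \<open>Independence and the marginal densities identify the joint law as a product, so bounds
  for products of \<open>cgauss\<close> become bounds on \<Omega>.\<close>

lemma gaussian_model_entries:
  assumes G: "gaussian_model \<Omega> m H" and n: "n > 0" "m n > 0"
  shows "(\<lambda>\<omega>. entries n (m n) (H n \<omega>)) \<in> measurable \<Omega> (PiM ({..<n} \<times> {..<m n}) (\<lambda>_. cgauss))"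
    "distr \<Omega> (PiM ({..<n} \<times> {..<m n}) (\<lambda>_. cgauss)) (\<lambda>\<omega>. entries n (m n) (H n \<omega>))
      = PiM ({..<n} \<times> {..<m n}) (\<lambda>_. cgauss)"
proof -
  let ?I = "{..<n} \<times> {..<m n}"
  let ?X = "\<lambda>p \<omega>. H n \<omega> (fst p) (snd p)"
  interpret prob_space \<Omega> using G by (simp add: gaussian_model_def)
  have d: "distributed \<Omega> lborel (?X p) (\<lambda>z. ennreal (exp (- (cmod z * cmod z)) / pi))" if "p \<in> ?I" for p
    using G that unfolding gaussian_model_def by auto
  have rv: "random_variable borel (?X p)" if "p \<in> ?I" for p
    using distributed_measurable[OF d[OF that]] by simp
  have law: "distr \<Omega> borel (?X p) = cgauss" if "p \<in> ?I" for p
  proof -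
    have "distr \<Omega> borel (?X p) = distr \<Omega> lborel (?X p)" by (intro distr_cong) auto
    then show ?thesis using distributed_distr_eq_density[OF d[OF that]] by (simp add: cgauss_def)
  qed
  have iv: "indep_vars (\<lambda>_. borel) ?X ?I"
    using G unfolding gaussian_model_def by (simp add: split_beta')
  have sets_eq: "sets (PiM ?I (\<lambda>_. borel)) = sets (PiM ?I (\<lambda>_. cgauss))"
    by (intro sets_PiM_cong) auto
  have ne: "?I \<noteq> {}" using n by auto
  have ent: "entries n (m n) (H n \<omega>) = (\<lambda>p\<in>?I. ?X p \<omega>)" for \<omega>
    by (simp add: entries_def)
  have "(\<lambda>\<omega>. \<lambda>p\<in>?I. ?X p \<omega>) \<in> measurable \<Omega> (PiM ?I (\<lambda>_. borel))"
    by (rule measurable_restrict) (rule rv)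
  then show "(\<lambda>\<omega>. entries n (m n) (H n \<omega>)) \<in> measurable \<Omega> (PiM ?I (\<lambda>_. cgauss))"
    unfolding ent using measurable_cong_sets[OF refl sets_eq] by blast
  have "distr \<Omega> (PiM ?I (\<lambda>_. cgauss)) (\<lambda>\<omega>. \<lambda>p\<in>?I. ?X p \<omega>) = distr \<Omega> (PiM ?I (\<lambda>_. borel)) (\<lambda>\<omega>. \<lambda>p\<in>?I. ?X p \<omega>)"
    by (intro distr_cong) (simp_all add: sets_eq)
  also have "\<dots> = PiM ?I (\<lambda>p. distr \<Omega> borel (?X p))"
    using indep_vars_iff_distr_eq_PiM'[OF ne rv] iv by simp
  also have "\<dots> = PiM ?I (\<lambda>_. cgauss)" by (intro PiM_cong refl law)
  finally show "distr \<Omega> (PiM ?I (\<lambda>_. cgauss)) (\<lambda>\<omega>. entries n (m n) (H n \<omega>)) = PiM ?I (\<lambda>_. cgauss)"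
    unfolding ent .
qed

section \<open>Borel--Cantelli for the good events\<close>

lemma summable_nat_exp:
  fixes c :: real assumes "c > 0"
  shows "summable (\<lambda>n. real n * exp (- c * n))"
proof -
  have "summable (\<lambda>n. of_nat (Suc n) * exp (- c) ^ n)"
    using geometric_deriv_sums[of "exp (- c)"] assms by (auto simp: summable_def)
  then show ?thesis
    by (rule summable_comparison_test'[of _ 0]) (simp add: exp_of_nat_mult[symmetric] mult.commute mult_right_mono)
qed

lemma ratio_eventually:
  assumes lim: "(\<lambda>n. real (m n) / real n) \<longlonglongrightarrow> 1 / \<beta>" and b: "\<beta> > 0"
  shows "eventually (\<lambda>n. n > 0 \<and> m n > 0 \<and> real (m n) \<le> (1 / \<beta> + 1) * n) sequentially"
proof -
  have "eventually (\<lambda>n. real (m n) / real n > 0) sequentially"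
    using order_tendstoD(1)[OF lim, of 0] b by simp
  moreover have "eventually (\<lambda>n. real (m n) / real n < 1 / \<beta> + 1) sequentially"
    using lim by (rule order_tendstoD(2)) simp
  ultimately show ?thesis
  proof eventually_elim
    case (elim n)
    then have "n > 0" "m n > 0" by (auto simp: zero_less_divide_iff)
    then show ?case using elim by (simp add: field_simps)
  qed
qed

text \<open>The union bound over columns costs the factor \<open>m n\<close>, eventually at most
  linear in \<open>n\<close>, which exponentially small terms absorb.\<close>

lemma AE_good_columns:
  assumes G: "gaussian_model \<Omega> m H" and lim: "(\<lambda>n. real (m n) / real n) \<longlonglongrightarrow> 1 / \<beta>" and b: "\<beta> > 0"
    and s: "s > 0" and e: "\<epsilon> > 0" "\<epsilon> \<le> 2 / s"
    and J: "\<And>n j. j < m n \<Longrightarrow> J n j \<subseteq> {..<m n} \<and> j \<notin> J n j"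
  shows "AE \<omega> in \<Omega>. eventually (\<lambda>n. \<forall>j<m n. entries n (m n) (H n \<omega>) \<notin> bad_column n (m n) s \<epsilon> (J n j) j) sequentially"
proof -
  interpret prob_space \<Omega> using G by (simp add: gaussian_model_def)
  define c where "c = \<epsilon>^2 * s^2 / 32"
  have c: "c > 0" using e s by (simp add: c_def)
  define S where "S n = (\<Union>j<m n. bad_column n (m n) s \<epsilon> (J n j) j)" for n
  let ?P = "\<lambda>n. PiM ({..<n} \<times> {..<m n}) (\<lambda>_. cgauss)"
  have S_sets: "S n \<in> sets (?P n)" for n
    unfolding S_def using J by (intro sets.finite_UN bad_column_measurable) auto
  have S_le: "emeasure (?P n) (S n) \<le> ennreal (m n * (3 * exp (- c * n)))" for n
  proof -
    have "emeasure (?P n) (S n) \<le> (\<Sum>j<m n. emeasure (?P n) (bad_column n (m n) s \<epsilon> (J n j) j))"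
      unfolding S_def using J by (intro emeasure_subadditive_finite) (auto intro!: bad_column_measurable)
    also have "\<dots> \<le> (\<Sum>j<m n. ennreal (3 * exp (- c * n)))"
      unfolding c_def using J s e by (intro sum_mono bad_column_bound) auto
    also have "\<dots> = ennreal (m n * (3 * exp (- c * n)))"
      by (simp add: ennreal_mult ennreal_of_nat_eq_real_of_nat)
    finally show ?thesis .
  qed
  \<comment> \<open>Sizes without entries get the empty event, since the joint law is available only
    for a nonempty index set.\<close>
  define A where "A n = (if n > 0 \<and> m n > 0 then (\<lambda>\<omega>. entries n (m n) (H n \<omega>)) -` S n \<inter> space \<Omega> else {})" for n
  have A_sets: "A n \<in> sets \<Omega>" for n
    unfolding A_def using measurable_sets[OF gaussian_model_entries(1)[OF G] S_sets] by auto
  have A_le: "measure \<Omega> (A n) \<le> m n * (3 * exp (- c * n))" for n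
  proof (cases "n > 0 \<and> m n > 0")
    case True
    have "emeasure \<Omega> (A n) = emeasure (distr \<Omega> (?P n) (\<lambda>\<omega>. entries n (m n) (H n \<omega>))) (S n)"
      using True gaussian_model_entries(1)[OF G, of n] S_sets[of n]
      by (simp add: A_def emeasure_distr)
    also have "\<dots> = emeasure (?P n) (S n)" using True by (simp add: gaussian_model_entries(2)[OF G])
    also note S_le[of n]
    finally show ?thesis by (simp add: emeasure_eq_measure)
  qed (auto simp: A_def)
  have "summable (\<lambda>n. measure \<Omega> (A n))"
  proof (rule summable_comparison_test_ev)
    show "summable (\<lambda>n. ((1 / \<beta> + 1) * 3) * (real n * exp (- c * n)))"
      by (intro summable_mult summable_nat_exp c)
    show "\<forall>\<^sub>F n in sequentially. norm (measure \<Omega> (A n)) \<le> ((1 / \<beta> + 1) * 3) * (real n * exp (- c * n))"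
      using ratio_eventually[OF lim b]
    proof eventually_elim
      case (elim n)
      then have "real (m n) * (3 * exp (- c * n)) \<le> ((1 / \<beta> + 1) * n) * (3 * exp (- c * n))"
        by (intro mult_right_mono) auto
      then have "measure \<Omega> (A n) \<le> ((1 / \<beta> + 1) * n) * (3 * exp (- c * n))"
        using A_le[of n] by linarith
      then show ?case by (simp only: real_norm_def abs_of_nonneg[OF measure_nonneg] mult_ac)
    qed
  qed
  then have "AE \<omega> in \<Omega>. eventually (\<lambda>n. \<omega> \<in> space \<Omega> - A n) sequentially"
    by (intro borel_cantelli_AE1 A_sets) (simp_all add: emeasure_eq_measure)
  then show ?thesis
  proof eventually_elim
    case (elim \<omega>)
    then show ?case using ratio_eventually[OF lim b]
      by eventually_elim (auto simp: A_def S_def)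
  qed
qed

section \<open>Spectral averages in terms of the entries\<close>

lemma entries_in_space:
  "entries n m h \<in> space (PiM ({..<n} \<times> {..<m}) (\<lambda>_. cgauss))"
  by (simp add: space_PiM entries_def)

lemma sample_cov_eigvals_eq:
  "sample_cov_eigvals n m h = real_eigvals (mat n n (\<lambda>(i, k). cov_kernel m 0 {..<m} (entries n m h) i k))"
proof -
  have "mat n n (\<lambda>(i, k). cov_kernel m 0 {..<m} (\<lambda>(i, j). h i j) i k)
      = mat n n (\<lambda>(i, k). cov_kernel m 0 {..<m} (entries n m h) i k)"
    by (intro cong_mat refl) (auto simp: cov_kernel_def scol_def entries_def intro!: sum.cong)
  then show ?thesis unfolding sample_cov_eigvals_def Let_def sample_cov_mat by simp
qed

lemma sample_cov_eigvals_basic: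
  "length (sample_cov_eigvals n m h) = n" "l \<in> set (sample_cov_eigvals n m h) \<Longrightarrow> l \<ge> 0"
  unfolding sample_cov_eigvals_eq by (rule real_eigvals_cov[OF refl], assumption?)+

lemma sample_cov_eigvals_stieltjes:
  "s > 0 \<Longrightarrow> (\<Sum>l\<leftarrow>sample_cov_eigvals n m h. 1 / (l + s)) = htrace {..<n} (resolv n m s {..<m} (entries n m h))"
  unfolding sample_cov_eigvals_eq by (rule sum_inverse_real_eigvals[OF refl])

lemma sample_cov_eigvals_sum:
  "(\<Sum>l\<leftarrow>sample_cov_eigvals n m h. l) = (\<Sum>i<n. \<Sum>j<m. (cmod (entries n m h (i, j)))^2) / m"
  unfolding sample_cov_eigvals_eq by (rule sum_real_eigvals[OF refl])

text \<open>On the nonnegative axis \<open>s g + g / (1 + \<beta> g)\<close> has slope at least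
  \<open>s\<close>, so the distance to the root is at most the defect divided by \<open>s\<close>.
  Replacing the ratio \<open>c n\<close> by \<beta> adds at most \<open>|c n - \<beta>| g^2\<close>,
  where \<open>g \<le> 1 / s\<close>.\<close>

lemma self_consistent_limit:
  fixes g c :: "nat \<Rightarrow> real"
  assumes s: "s > 0" and b: "\<beta> > 0" and g: "eventually (\<lambda>n. 0 \<le> g n \<and> g n \<le> 1 / s) sequentially"
    and c: "c \<longlonglongrightarrow> \<beta>"
    and err: "(\<lambda>n. 1 - s * g n - g n / (1 + c n * g n)) \<longlonglongrightarrow> 0"
    and g0: "g0 \<ge> 0" "s * g0 + g0 / (1 + \<beta> * g0) = 1"
  shows "g \<longlonglongrightarrow> g0"
proof -
  define D where "D n = \<bar>1 - s * g n - g n / (1 + c n * g n)\<bar> + \<bar>c n - \<beta>\<bar> * (1 / s)^2" for n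
  have D: "(\<lambda>n. D n / s) \<longlonglongrightarrow> 0"
  proof -
    have "(\<lambda>n. (\<bar>1 - s * g n - g n / (1 + c n * g n)\<bar> + \<bar>c n - \<beta>\<bar> * (1 / s)^2) / s) \<longlonglongrightarrow> (\<bar>0\<bar> + \<bar>\<beta> - \<beta>\<bar> * (1 / s)^2) / s"
      using s by (intro tendsto_intros err c) auto
    then show ?thesis by (simp add: D_def)
  qed
  have cpos: "eventually (\<lambda>n. c n > 0) sequentially" using order_tendstoD(1)[OF c b] .
  have "eventually (\<lambda>n. norm (g n - g0) \<le> D n / s) sequentially"
    using g cpos
  proof eventually_elim
    case (elim n)
    define x where "x = g n"
    have x: "x \<ge> 0" "x \<le> 1 / s" using elim by (auto simp: x_def)
    have p: "1 + c n * x > 0" "1 + \<beta> * x > 0" "1 + \<beta> * g0 > 0"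
      using elim x b g0 by (auto intro!: add_pos_nonneg)
    have "x / (1 + c n * x) - x / (1 + \<beta> * x) = (\<beta> - c n) * x^2 / ((1 + c n * x) * (1 + \<beta> * x))"
      using p by (simp add: field_simps power2_eq_square)
    also have "\<bar>\<dots>\<bar> = \<bar>c n - \<beta>\<bar> * x^2 / ((1 + c n * x) * (1 + \<beta> * x))"
      using p by (simp add: abs_mult abs_minus_commute)
    also have "\<dots> \<le> \<bar>c n - \<beta>\<bar> * x^2 / 1"
    proof (rule divide_left_mono)
      have "1 * 1 \<le> (1 + c n * x) * (1 + \<beta> * x)" using elim x b by (intro mult_mono) auto
      then show "1 \<le> (1 + c n * x) * (1 + \<beta> * x)" by simp
      then show "0 < (1 + c n * x) * (1 + \<beta> * x) * 1" by simp
    qed simp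
    also have "\<dots> \<le> \<bar>c n - \<beta>\<bar> * (1 / s)^2" using x by (simp add: mult_left_mono power_mono del: power_divide power_one_over)
    finally have 1: "\<bar>x / (1 + c n * x) - x / (1 + \<beta> * x)\<bar> \<le> \<bar>c n - \<beta>\<bar> * (1 / s)^2" .
    have "(s * x + x / (1 + \<beta> * x)) - (s * g0 + g0 / (1 + \<beta> * g0)) = (x - g0) * (s + 1 / ((1 + \<beta> * x) * (1 + \<beta> * g0)))"
    proof -
      have "x / (1 + \<beta> * x) - g0 / (1 + \<beta> * g0) = (x - g0) / ((1 + \<beta> * x) * (1 + \<beta> * g0))"
        using p by (simp add: field_simps)
      then show ?thesis by (simp add: algebra_simps)
    qed
    then have "\<bar>(s * x + x / (1 + \<beta> * x)) - 1\<bar> = \<bar>x - g0\<bar> * (s + 1 / ((1 + \<beta> * x) * (1 + \<beta> * g0)))"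
      using p s g0(2) by (simp add: abs_mult abs_of_pos add_pos_pos)
    also have "\<dots> \<ge> \<bar>x - g0\<bar> * s" using p by (intro mult_left_mono) auto
    finally have "\<bar>x - g0\<bar> * s \<le> \<bar>(s * x + x / (1 + \<beta> * x)) - 1\<bar>" .
    also have "\<dots> \<le> D n" using 1 unfolding D_def x_def[symmetric] by linarith
    finally show ?case using s by (simp add: field_simps x_def)
  qed
  then have "(\<lambda>n. g n - g0) \<longlonglongrightarrow> 0" using D by (rule Lim_null_comparison)
  then show ?thesis by (simp add: LIM_zero_iff)
qed

text \<open>Null sets can be discarded only countably often, so the tolerance runs through the
  values \<open>1 / (k + 1)\<close>.\<close>

lemma tendsto_zero_if_bounds:
  fixes u :: "nat \<Rightarrow> real"
  assumes "\<And>k::nat. eventually (\<lambda>n. \<bar>u n\<bar> \<le> 1 / (real k + 1) + v n) sequentially" and v: "v \<longlonglongrightarrow> 0"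
  shows "u \<longlonglongrightarrow> 0"
proof (rule tendstoI)
  fix e :: real assume e: "e > 0"
  obtain k :: nat where "1 / (real k + 1) < e / 2"
    using reals_Archimedean[of "e/2"] e by (auto simp: inverse_eq_divide add.commute)
  have "eventually (\<lambda>n. v n < e / 2) sequentially" using e by (intro order_tendstoD(2)[OF v]) simp
  with assms(1)[of k] show "eventually (\<lambda>n. dist (u n) 0 < e) sequentially"
    by eventually_elim (use \<open>1 / (real k + 1) < e / 2\<close> in auto)
qed

text \<open>\<open>g\<close> enters through its equation and its sign; that the Marchenko--Pastur
  transform has these two properties is the separate computation
  \<open>mp_stieltjes\<close>.\<close>

proposition AE_empirical_stieltjes:
  assumes G: "gaussian_model \<Omega> m H" and lim: "(\<lambda>n. real (m n) / real n) \<longlonglongrightarrow> 1 / \<beta>" and b: "\<beta> > 0"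
    and g: "\<And>s. s > 0 \<Longrightarrow> g s \<ge> 0 \<and> s * g s + g s / (1 + \<beta> * g s) = (1::real)"
  shows "AE \<omega> in \<Omega>.
     (\<forall>s\<in>{0<..} \<inter> \<rat>. (\<lambda>n. (\<Sum>l\<leftarrow>sample_cov_eigvals n (m n) (H n \<omega>). 1 / (l + s)) / n) \<longlonglongrightarrow> g s) \<and>
     (\<lambda>n. (\<Sum>l\<leftarrow>sample_cov_eigvals n (m n) (H n \<omega>). l) / n) \<longlonglongrightarrow> 1"
proof -
  \<comment> \<open>The cap \<open>2 / s\<close> is the range of deviations covered by the
    concentration bound.\<close>
  define \<epsilon> where "\<epsilon> s k = min (2 / s) (1 / (real k + 1))" for s :: real and k :: nat
  have \<epsilon>: "\<epsilon> s k > 0" "\<epsilon> s k \<le> 2 / s" "\<epsilon> s k \<le> 1 / (real k + 1)" if "s > 0" for s k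
    using that by (auto simp: \<epsilon>_def)
  have 1: "AE \<omega> in \<Omega>. \<forall>s\<in>{0<..} \<inter> \<rat>. \<forall>k. eventually (\<lambda>n. \<forall>j<m n. entries n (m n) (H n \<omega>) \<notin> bad_column n (m n) s (\<epsilon> s k) ({..<m n} - {j}) j) sequentially"
    using countable_rat
    by (intro AE_ball_countable' countable_Int2 iffD2[OF AE_all_countable] allI AE_good_columns[OF G lim b] \<epsilon>) auto
  have 2: "AE \<omega> in \<Omega>. \<forall>k. eventually (\<lambda>n. \<forall>j<m n. entries n (m n) (H n \<omega>) \<notin> bad_column n (m n) 1 (\<epsilon> 1 k) {} j) sequentially"
    by (intro iffD2[OF AE_all_countable] allI AE_good_columns[OF G lim b] \<epsilon>) auto
  show ?thesis using 1 2
  proof eventually_elim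
    case (elim \<omega>)
    note ev = ratio_eventually[OF lim b]
    have n0: "(\<lambda>n. 1 / real n) \<longlonglongrightarrow> 0" by (rule lim_1_over_n)
    have c: "(\<lambda>n. real n / real (m n)) \<longlonglongrightarrow> \<beta>"
      using tendsto_inverse[OF lim] b by (simp add: inverse_eq_divide)
    show ?case
    proof (intro conjI ballI)
      fix s assume "s \<in> {0<..} \<inter> (\<rat> :: real set)"
      then have s: "s > 0" and sr: "s \<in> {0<..} \<inter> \<rat>" by auto
      define gn where "gn n = (\<Sum>l\<leftarrow>sample_cov_eigvals n (m n) (H n \<omega>). 1 / (l + s)) / n" for n
      have gn: "gn n = htrace {..<n} (resolv n (m n) s {..<m n} (entries n (m n) (H n \<omega>))) / n" for n
        unfolding gn_def using s by (simp add: sample_cov_eigvals_stieltjes)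
      have *: "eventually (\<lambda>n. 0 \<le> gn n \<and> gn n \<le> 1 / s \<and>
          \<bar>1 - s * gn n - gn n / (1 + real n / real (m n) * gn n)\<bar> \<le> 1 / (real k + 1) + 1 / (s * n)) sequentially" for k :: nat
        using ev elim(1)[rule_format, OF sr, of k]
      proof eventually_elim
        case (elim n)
        have n: "n > 0" "m n > 0" using elim by auto
        note r = resolv_self_consistent[OF s n entries_in_space, of "H n \<omega>" "\<epsilon> s k", folded gn]
        have "0 \<le> gn n" "gn n \<le> 1 / s"
          "\<bar>1 - s * gn n - gn n / (1 + real n / real (m n) * gn n)\<bar> \<le> \<epsilon> s k + 1 / (s * n)"
          using r elim(2) by blast+
        then show ?case using \<epsilon>(3)[OF s, of k] by (auto simp: add.commute)
      qed
      have "gn \<longlonglongrightarrow> g s"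
      proof (rule self_consistent_limit[OF s b _ c])
        show "eventually (\<lambda>n. 0 \<le> gn n \<and> gn n \<le> 1 / s) sequentially"
          using *[of 0] by eventually_elim auto
        show "(\<lambda>n. 1 - s * gn n - gn n / (1 + real n / real (m n) * gn n)) \<longlonglongrightarrow> 0"
        proof (rule tendsto_zero_if_bounds)
          show "\<forall>\<^sub>F n in sequentially. \<bar>1 - s * gn n - gn n / (1 + real n / real (m n) * gn n)\<bar> \<le> 1 / (real k + 1) + 1 / (s * n)" for k
            using *[of k] by eventually_elim auto
          show "(\<lambda>n. 1 / (s * real n)) \<longlonglongrightarrow> 0"
            using tendsto_mult_right_zero[OF n0, of "1 / s"] by simp
        qed
      qed (use g[OF s] in auto)
      then show "(\<lambda>n. (\<Sum>l\<leftarrow>sample_cov_eigvals n (m n) (H n \<omega>). 1 / (l + s)) / n) \<longlonglongrightarrow> g s"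
        unfolding gn_def .
    next
      have "(\<lambda>n. (\<Sum>l\<leftarrow>sample_cov_eigvals n (m n) (H n \<omega>). l) / n - 1) \<longlonglongrightarrow> 0"
      proof (rule tendsto_zero_if_bounds[where v = "\<lambda>_. 0"])
        fix k :: nat
        show "\<forall>\<^sub>F n in sequentially. \<bar>(\<Sum>l\<leftarrow>sample_cov_eigvals n (m n) (H n \<omega>). l) / n - 1\<bar> \<le> 1 / (real k + 1) + 0"
          using ev elim(2)[rule_format, of k]
        proof eventually_elim
          case (elim n)
          then have n: "n > 0" "m n > 0" by auto
          let ?h = "entries n (m n) (H n \<omega>)"
          have col: "\<bar>(\<Sum>i<n. (cmod (?h (i, j)))^2) - n\<bar> \<le> 1 / (real k + 1) * n" if "j < m n" for j
          proof -
            have "\<epsilon> 1 k * n \<le> 1 / (real k + 1) * n" using \<epsilon>(3)[of 1 k] by (intro mult_right_mono) auto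
            then show ?thesis
              using good_column_norm[OF entries_in_space elim(2)[rule_format, OF that]] by linarith
          qed
          \<comment> \<open>The eigenvalue sum is the total squared norm of the entries over
            \<open>m n\<close>, and each of the \<open>m n\<close> columns contributes
            \<open>n\<close> up to the tolerance.\<close>
          have "(\<Sum>l\<leftarrow>sample_cov_eigvals n (m n) (H n \<omega>). l) * m n = (\<Sum>i<n. \<Sum>j<m n. (cmod (?h (i, j)))^2)"
            by (subst sample_cov_eigvals_sum) (use n in simp)
          also have "\<dots> = (\<Sum>j<m n. \<Sum>i<n. (cmod (?h (i, j)))^2)" by (rule sum.swap)
          finally have e: "(\<Sum>l\<leftarrow>sample_cov_eigvals n (m n) (H n \<omega>). l) * m n - real n * m n
            = (\<Sum>j<m n. (\<Sum>i<n. (cmod (?h (i, j)))^2) - n)"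
            by (simp add: sum_subtractf)
          have "\<bar>(\<Sum>l\<leftarrow>sample_cov_eigvals n (m n) (H n \<omega>). l) * m n - real n * m n\<bar> \<le> (\<Sum>j<m n. 1 / (real k + 1) * n)"
            unfolding e by (rule order_trans[OF sum_abs sum_mono]) (use col in auto)
          also have "\<dots> = 1 / (real k + 1) * (real n * m n)" by simp
          finally have "\<bar>(\<Sum>l\<leftarrow>sample_cov_eigvals n (m n) (H n \<omega>). l) * m n - real n * m n\<bar> / (real n * m n)
             \<le> 1 / (real k + 1)"
            using n by (simp add: field_simps)
          also have "\<bar>(\<Sum>l\<leftarrow>sample_cov_eigvals n (m n) (H n \<omega>). l) * m n - real n * m n\<bar> / (real n * m n)
            = \<bar>((\<Sum>l\<leftarrow>sample_cov_eigvals n (m n) (H n \<omega>). l) * m n - real n * m n) / (real n * m n)\<bar>" by simp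
          also have "((\<Sum>l\<leftarrow>sample_cov_eigvals n (m n) (H n \<omega>). l) * m n - real n * m n) / (real n * m n)
            = (\<Sum>l\<leftarrow>sample_cov_eigvals n (m n) (H n \<omega>). l) / n - 1"
            using n by (simp add: field_simps)
          finally show ?case by simp
        qed
      qed simp
      then show "(\<lambda>n. (\<Sum>l\<leftarrow>sample_cov_eigvals n (m n) (H n \<omega>). l) / n) \<longlonglongrightarrow> 1"
        by (simp only: LIM_zero_iff)
    qed
  qed
qed

section \<open>Integrals of square roots of quadratics\<close>

context
  fixes a b :: real
  assumes ab: "a < b"
begin

lemma quadratic_pos: "a < l \<Longrightarrow> l < b \<Longrightarrow> 0 < (l - a) * (b - l)"
  by simp

lemma arcsin_affine_deriv:
  assumes l: "a < l" "l < b"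
  shows "((\<lambda>l. arcsin ((l - (a + b) / 2) / ((b - a) / 2))) has_real_derivative 1 / sqrt ((l - a) * (b - l))) (at l)"
proof -
  define r where "r = (b - a) / 2"
  define t where "t = (l - (a + b) / 2) / r"
  have r: "r > 0" using ab by (simp add: r_def)
  have t: "-1 < t" "t < 1" using l r by (auto simp: t_def r_def field_simps)
  have "1 - t^2 = (r^2 - (l - (a + b) / 2)^2) / r^2"
    unfolding t_def power_divide diff_divide_distrib[of "r^2"] using r by simp
  also have "r^2 - (l - (a + b) / 2)^2 = (l - a) * (b - l)"
    by (simp add: r_def power2_eq_square field_simps)
  finally have "1 - t^2 = (l - a) * (b - l) / r^2" .
  then have "sqrt (1 - t^2) = sqrt ((l - a) * (b - l)) / r" using r by (simp add: real_sqrt_divide)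
  moreover have "((\<lambda>l. arcsin ((l - (a + b) / 2) / r)) has_real_derivative inverse (sqrt (1 - ((l - (a + b) / 2) / r)^2)) * (1 / r)) (at l)"
  proof (rule DERIV_chain2[OF DERIV_arcsin])
    show "((\<lambda>l. (l - (a + b) / 2) / r) has_real_derivative 1 / r) (at l)"
      by (intro DERIV_cdivide) (auto intro!: derivative_eq_intros)
  qed (use t in \<open>simp_all add: t_def\<close>)
  ultimately show ?thesis using r unfolding t_def[symmetric] by (simp add: r_def[symmetric])
qed

lemma sqrt_quadratic_deriv:
  assumes l: "a < l" "l < b"
  shows "((\<lambda>l. sqrt ((l - a) * (b - l))) has_real_derivative ((a + b) / 2 - l) / sqrt ((l - a) * (b - l))) (at l)"
proof -
  have "((\<lambda>l. (l - a) * (b - l)) has_real_derivative (a + b) - 2 * l) (at l)"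
    by (auto intro!: derivative_eq_intros)
  from DERIV_chain2[OF DERIV_real_sqrt[OF quadratic_pos[OF l]] this]
  have "((\<lambda>l. sqrt ((l - a) * (b - l))) has_real_derivative
     inverse (sqrt ((l - a) * (b - l))) / 2 * ((a + b) - 2 * l)) (at l)" .
  moreover have "inverse S / 2 * ((a + b) - 2 * l) = ((a + b) / 2 - l) / S" for S :: real
    by (cases "S = 0") (simp_all add: field_simps)
  ultimately show ?thesis by (simp only:)
qed

lemma arcsin_affine_cont: "continuous_on {a..b} (\<lambda>l. arcsin ((l - (a + b) / 2) / ((b - a) / 2)))"
  using ab by (intro continuous_intros) (auto simp: field_simps)

text \<open>The area of a half disc of radius \<open>(b - a) / 2\<close>. The interior form of the
  fundamental theorem is used because the arcsine has no finite derivative at the ends.\<close>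

lemma has_integral_sqrt_quadratic:
  "((\<lambda>l. sqrt ((l - a) * (b - l))) has_integral pi * (b - a)^2 / 8) {a..b}"
proof -
  define r where "r = (b - a) / 2"
  let ?F = "\<lambda>l. ((l - (a + b) / 2) * sqrt ((l - a) * (b - l)) + ((b - a) / 2)^2 * arcsin ((l - (a + b) / 2) / ((b - a) / 2))) / 2"
  have "((\<lambda>l. sqrt ((l - a) * (b - l))) has_integral (?F b - ?F a)) {a..b}"
  proof (rule fundamental_theorem_of_calculus_interior)
    show "a \<le> b" using ab by simp
    show "continuous_on {a..b} ?F" by (intro continuous_intros arcsin_affine_cont) simp
    fix l assume "l \<in> {a<..<b}"
    then have l: "a < l" "l < b" by auto
    note R = quadratic_pos[OF l]
    define S where "S = sqrt ((l - a) * (b - l))"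
    have S: "S > 0" "S^2 = (l - a) * (b - l)" using R by (auto simp: S_def simp del: mult_pos_pos)
    have lin: "((\<lambda>l. l - (a + b) / 2) has_real_derivative 1) (at l)"
      by (auto intro!: derivative_eq_intros)
    have "(?F has_real_derivative ((1 * S + ((a + b) / 2 - l) / S * (l - (a + b) / 2)) + ((b - a) / 2)^2 * (1 / S)) / 2) (at l)"
      unfolding S_def
      by (intro DERIV_cdivide DERIV_add DERIV_cmult arcsin_affine_deriv[OF l]
          DERIV_mult[OF lin sqrt_quadratic_deriv[OF l]])
    also have "((1 * S + ((a + b) / 2 - l) / S * (l - (a + b) / 2)) + ((b - a) / 2)^2 * (1 / S)) / 2 = S"
    proof -
      have "(l - (a + b) / 2) * ((a + b) / 2 - l) + ((b - a) / 2)^2 = S^2"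
        unfolding S(2) by (simp add: power2_eq_square field_simps)
      moreover have "(1 * S + y / S * x + k * (1 / S)) / 2 = (S^2 + (x * y + k)) / S / 2" for x y k
        using S(1) by (simp add: field_simps power2_eq_square)
      ultimately show ?thesis using S(1) by (simp only:) (simp add: power2_eq_square)
    qed
    finally show "(?F has_vector_derivative sqrt ((l - a) * (b - l))) (at l)"
      by (simp add: has_real_derivative_iff_has_vector_derivative S_def)
  qed
  moreover have e: "(b - (a + b) / 2) / ((b - a) / 2) = 1" "(a - (a + b) / 2) / ((b - a) / 2) = -1"
    using ab by (simp_all add: divide_eq_eq) (simp_all add: field_simps)
  have "?F b - ?F a = pi * (b - a)^2 / 8"
    unfolding e by (simp add: power2_eq_square)
  ultimately show ?thesis by (simp only:)
qed

text \<open>With \<open>R = (l - a) (b - l)\<close>, the integrand \<open>R / ((l + c) sqrt R)\<close> is the difference of the two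
  integrands below; their antiderivatives stay continuous at the endpoints, also when \<open>a + c = 0\<close>.\<close>

lemma has_integral_first_part:
  "((\<lambda>l. ((a + b) / 2 - l + ((a + b) / 2 + c)) / sqrt ((l - a) * (b - l))) has_integral pi * ((a + b) / 2 + c)) {a..b}"
proof -
  let ?F = "\<lambda>l. sqrt ((l - a) * (b - l)) + ((a + b) / 2 + c) * arcsin ((l - (a + b) / 2) / ((b - a) / 2))"
  have "((\<lambda>l. ((a + b) / 2 - l + ((a + b) / 2 + c)) / sqrt ((l - a) * (b - l))) has_integral (?F b - ?F a)) {a..b}"
  proof (rule fundamental_theorem_of_calculus_interior)
    show "a \<le> b" using ab by simp
    show "continuous_on {a..b} ?F" by (intro continuous_intros arcsin_affine_cont)
    fix l assume "l \<in> {a<..<b}"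
    then have l: "a < l" "l < b" by auto
    have "(?F has_real_derivative ((a + b) / 2 - l) / sqrt ((l - a) * (b - l)) + ((a + b) / 2 + c) * (1 / sqrt ((l - a) * (b - l)))) (at l)"
      by (intro DERIV_add DERIV_cmult arcsin_affine_deriv[OF l] sqrt_quadratic_deriv[OF l])
    then show "(?F has_vector_derivative ((a + b) / 2 - l + ((a + b) / 2 + c)) / sqrt ((l - a) * (b - l))) (at l)"
      by (simp only: has_real_derivative_iff_has_vector_derivative[symmetric] add_divide_distrib[of "(a + b) / 2 - l"]
          times_divide_eq_right mult_1_right)
  qed
  moreover have e: "(b - (a + b) / 2) / ((b - a) / 2) = 1" "(a - (a + b) / 2) / ((b - a) / 2) = -1"
    using ab by (simp_all add: divide_eq_eq) (simp_all add: field_simps)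
  have "?F b - ?F a = pi * ((a + b) / 2 + c)"
    unfolding e by (simp add: algebra_simps)
  ultimately show ?thesis by (simp only:)
qed

lemma has_integral_second_part:
  assumes c: "a + c \<ge> 0"
  shows "((\<lambda>l. ((a + c) * (b + c) / (l + c)) / sqrt ((l - a) * (b - l))) has_integral pi * sqrt ((a + c) * (b + c))) {a..b}"
\<comment> \<open>In the degenerate case the numerator is identically 0. It arises for \<beta> = 1
  and \<open>c = 0\<close>, where the support reaches the origin.\<close>
proof (cases "a + c = 0")
  case True
  then show ?thesis by simp
next
  case False
  then have A: "a + c > 0" and B: "b + c > 0" using c ab by auto
  define K where "K = sqrt ((a + c) * (b + c))"
  have K: "K > 0" "K^2 = (a + c) * (b + c)" using A B by (auto simp: K_def)
  define m where "m = (a + b) / 2 + c"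
  define r where "r = (b - a) / 2"
  have r: "r > 0" using ab by (simp add: r_def)
  \<comment> \<open>Affine in \<open>1 / (l + c)\<close> and normalised to run from -1 at
    \<open>a\<close> to 1 at \<open>b\<close>: in the reciprocal variable the integrand is again
    that of an arcsine.\<close>
  define \<phi> where "\<phi> l = (m * (l + c) - K^2) / ((l + c) * r)" for l
  have one: "1 - \<phi> l ^ 2 = K^2 * ((l - a) * (b - l)) / ((l + c) * r)^2" if "l + c > 0" for l
  proof -
    have "((l + c) * r)^2 - (m * (l + c) - K^2)^2 = K^2 * ((l - a) * (b - l))"
      unfolding K m_def r_def by (simp add: power2_eq_square field_simps) algebra
    then show ?thesis using that r by (simp add: \<phi>_def power_divide diff_divide_eq_iff)
  qed
  have le1: "-1 \<le> \<phi> l \<and> \<phi> l \<le> 1" if "a \<le> l" "l \<le> b" for l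
  proof -
    have "0 \<le> 1 - \<phi> l ^ 2" using one[of l] that A by simp
    then have "(\<phi> l)^2 \<le> 1" by simp
    then have "\<bar>\<phi> l\<bar> \<le> 1" by (simp add: abs_square_le_1)
    then show ?thesis by auto
  qed
  let ?F = "\<lambda>l. K * arcsin (\<phi> l)"
  have "((\<lambda>l. ((a + c) * (b + c) / (l + c)) / sqrt ((l - a) * (b - l))) has_integral (?F b - ?F a)) {a..b}"
  proof (rule fundamental_theorem_of_calculus_interior)
    show "a \<le> b" using ab by simp
    have "continuous_on {a..b} \<phi>" unfolding \<phi>_def using A r by (intro continuous_intros) auto
    then show "continuous_on {a..b} ?F" using le1 by (intro continuous_intros) auto
    fix l assume "l \<in> {a<..<b}"
    then have l: "a < l" "l < b" by auto
    have u: "l + c > 0" using l A by simp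
    define S where "S = sqrt ((l - a) * (b - l))"
    have S: "S > 0" "S^2 = (l - a) * (b - l)" using quadratic_pos[OF l] by (auto simp: S_def simp del: mult_pos_pos)
    have o: "1 - \<phi> l ^ 2 = (K * S / ((l + c) * r))^2"
      using one[OF u] S by (simp add: power_divide power_mult_distrib)
    have sq: "sqrt (1 - \<phi> l ^ 2) = K * S / ((l + c) * r)" unfolding o using K S u r by simp
    have "0 < 1 - \<phi> l ^ 2" unfolding o using K S u r by simp
    then have "\<bar>\<phi> l\<bar> < 1" by (simp add: abs_square_less_1)
    then have t: "-1 < \<phi> l" "\<phi> l < 1" by auto
    have d: "(\<phi> has_real_derivative K^2 / ((l + c)^2 * r)) (at l)"
    proof -
      have "(\<phi> has_real_derivative (m * ((l + c) * r) - (m * (l + c) - K^2) * r) / ((l + c) * r)^2) (at l)"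
        unfolding \<phi>_def using u r
        by (auto intro!: derivative_eq_intros simp: power2_eq_square)
      moreover have "m * ((l + c) * r) - (m * (l + c) - K^2) * r = K^2 * r" by (simp add: algebra_simps)
      moreover have "K^2 * r / ((l + c) * r)^2 = K^2 / ((l + c)^2 * r)"
        using u r by (simp add: power_mult_distrib power2_eq_square[of r])
      ultimately show ?thesis by simp
    qed
    have "(?F has_real_derivative K * (inverse (sqrt (1 - \<phi> l ^ 2)) * (K^2 / ((l + c)^2 * r)))) (at l)"
      by (rule DERIV_cmult) (rule DERIV_chain2[OF DERIV_arcsin[OF t] d])
    also have "K * (inverse (sqrt (1 - \<phi> l ^ 2)) * (K^2 / ((l + c)^2 * r))) = K^2 / (l + c) / S"
    proof -
      have "K * (inverse (K * S / (u * r)) * (K^2 / (u^2 * r))) = K^2 / u / S" if "u > 0" for u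
        using that K(1) S(1) r by (simp add: field_simps power2_eq_square)
      from this[OF u] show ?thesis unfolding sq .
    qed
    finally show "(?F has_vector_derivative (a + c) * (b + c) / (l + c) / sqrt ((l - a) * (b - l))) (at l)"
      by (simp add: has_real_derivative_iff_has_vector_derivative S_def K(2))
  qed
  moreover have "m * (b + c) - K^2 = (b + c) * r" "m * (a + c) - K^2 = - ((a + c) * r)"
    unfolding K m_def r_def by (simp_all add: field_simps)
  then have "\<phi> b = 1" "\<phi> a = -1" using A B r by (simp_all add: \<phi>_def)
  ultimately show ?thesis by (simp add: K_def)
qed

lemma has_integral_sqrt_over:
  assumes c: "a + c \<ge> 0"
  shows "((\<lambda>l. sqrt ((l - a) * (b - l)) / (l + c)) has_integral
     pi * ((a + b) / 2 + c - sqrt ((a + c) * (b + c)))) {a..b}"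
proof -
  have "((\<lambda>l. ((a + b) / 2 - l + ((a + b) / 2 + c)) / sqrt ((l - a) * (b - l))
      - ((a + c) * (b + c) / (l + c)) / sqrt ((l - a) * (b - l))) has_integral
      (pi * ((a + b) / 2 + c) - pi * sqrt ((a + c) * (b + c)))) {a..b}"
    by (intro has_integral_diff has_integral_first_part has_integral_second_part c)
  then have "((\<lambda>l. sqrt ((l - a) * (b - l)) / (l + c)) has_integral
      (pi * ((a + b) / 2 + c) - pi * sqrt ((a + c) * (b + c)))) {a..b}"
  proof (rule has_integral_eq[rotated])
    fix l assume l: "l \<in> {a..b}"
    show "((a + b) / 2 - l + ((a + b) / 2 + c)) / sqrt ((l - a) * (b - l))
      - ((a + c) * (b + c) / (l + c)) / sqrt ((l - a) * (b - l)) = sqrt ((l - a) * (b - l)) / (l + c)"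
    \<comment> \<open>At the ends the root is 0, and division by zero makes all terms 0.\<close>
    proof (cases "l = a \<or> l = b")
      case False
      then have l': "a < l" "l < b" using l by auto
      define S where "S = sqrt ((l - a) * (b - l))"
      have S: "S > 0" "S^2 = (l - a) * (b - l)" using quadratic_pos[OF l'] by (auto simp: S_def simp del: mult_pos_pos)
      have u: "l + c > 0" using l' c by simp
      have "((a + b) / 2 - l + ((a + b) / 2 + c)) * (l + c) - (a + c) * (b + c) = S^2"
        unfolding S by (simp add: field_simps power2_eq_square)
      then have "((a + b) / 2 - l + ((a + b) / 2 + c)) - (a + c) * (b + c) / (l + c) = S^2 / (l + c)"
        using u by (simp add: field_simps)
      then have "(((a + b) / 2 - l + ((a + b) / 2 + c)) - (a + c) * (b + c) / (l + c)) / S = S / (l + c)"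
        using S(1) by (simp add: power2_eq_square)
      then show ?thesis unfolding S_def diff_divide_distrib .
    qed auto
  qed
  then show ?thesis by (simp only: right_diff_distrib[of pi "(a + b) / 2 + c"])
qed

end

section \<open>The Marchenko--Pastur law\<close>

lemma mp_edges:
  assumes "\<beta> > 0"
  shows "0 \<le> mp_minus \<beta>" "mp_minus \<beta> < mp_plus \<beta>" "0 < mp_plus \<beta>"
    "mp_minus \<beta> + mp_plus \<beta> = 2 * (1 + \<beta>)" "mp_minus \<beta> * mp_plus \<beta> = (1 - \<beta>)^2"
    "(mp_plus \<beta> - mp_minus \<beta>)^2 = 16 * \<beta>"
proof -
  define q where "q = sqrt \<beta>"
  have q: "q > 0" and \<beta>: "\<beta> = q^2" using assms by (auto simp: q_def)
  have e: "mp_minus \<beta> = (1 - q)^2" "mp_plus \<beta> = (1 + q)^2" by (auto simp: mp_minus_def mp_plus_def q_def)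
  show "0 \<le> mp_minus \<beta>" by (simp add: e)
  show "mp_minus \<beta> < mp_plus \<beta>" "0 < mp_plus \<beta>" unfolding e using q by (auto simp: power2_eq_square algebra_simps add_pos_pos)
  show "mp_minus \<beta> + mp_plus \<beta> = 2 * (1 + \<beta>)" unfolding e unfolding \<beta> by (simp add: power2_eq_square algebra_simps)
  show "mp_minus \<beta> * mp_plus \<beta> = (1 - \<beta>)^2" unfolding e unfolding \<beta> by (simp add: power2_eq_square algebra_simps)
  show "(mp_plus \<beta> - mp_minus \<beta>)^2 = 16 * \<beta>" unfolding e unfolding \<beta> by (simp add: power2_eq_square algebra_simps)
qed

lemma mp_density_measurable [measurable]: "mp_density \<beta> \<in> borel_measurable borel"
  unfolding mp_density_def[abs_def] by measurable

lemma mp_density_inside: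
  "mp_minus \<beta> \<le> l \<Longrightarrow> l \<le> mp_plus \<beta> \<Longrightarrow>
    mp_density \<beta> l = sqrt ((l - mp_minus \<beta>) * (mp_plus \<beta> - l)) / l / (2 * pi * \<beta>)"
  by (simp add: mp_density_def)

lemma mp_density_outside:
  "l \<notin> {mp_minus \<beta>..mp_plus \<beta>} \<Longrightarrow> mp_density \<beta> l = 0"
  by (auto simp: mp_density_def)

lemma mp_density_nonneg:
  assumes "\<beta> > 0" shows "0 \<le> mp_density \<beta> l"
proof (cases "l \<in> {mp_minus \<beta>..mp_plus \<beta>}")
  case True
  then have "0 \<le> l" using mp_edges(1)[OF assms] by auto
  then show ?thesis using assms by (simp add: mp_density_def)
qed (simp add: mp_density_outside)

text \<open>Nonnegativity is the bridge between the integral over the support, computed by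
  antiderivatives, and the Bochner integral over the line.\<close>

lemma has_bochner_integral_mp_density:
  assumes b: "\<beta> > 0" and g: "g \<in> borel_measurable borel"
    and nn: "\<And>l. l \<in> {mp_minus \<beta>..mp_plus \<beta>} \<Longrightarrow> g l \<ge> 0"
    and h: "((\<lambda>l. mp_density \<beta> l * g l) has_integral I) {mp_minus \<beta>..mp_plus \<beta>}"
  shows "has_bochner_integral lborel (\<lambda>l. mp_density \<beta> l * g l) I"
proof -
  let ?f = "\<lambda>l. mp_density \<beta> l * g l"
  note [measurable] = g
  have f0: "0 \<le> ?f l" for l
    using nn[of l] mp_density_nonneg[OF b, of l] by (cases "l \<in> {mp_minus \<beta>..mp_plus \<beta>}") (auto simp: mp_density_outside)
  have "(?f has_integral I) UNIV"
  proof -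
    have "(\<lambda>l. if l \<in> {mp_minus \<beta>..mp_plus \<beta>} then ?f l else 0) = ?f"
      using mp_density_outside by fastforce
    then show ?thesis using h has_integral_restrict_UNIV[of "{mp_minus \<beta>..mp_plus \<beta>}" ?f I] by simp
  qed
  then have "(\<integral>\<^sup>+l. ennreal (?f l) \<partial>lborel) = ennreal I"
    using f0 by (intro nn_integral_has_integral_lborel) auto
  then show ?thesis
    using has_integral_nonneg[OF h] f0 by (intro has_bochner_integral_nn_integral) auto
qed

text \<open>The first value is the smaller of 1 and \<open>1 / \<beta>\<close>; for \<beta> > 1 the
  rest of the mass is the atom. In the last integral \<open>1 / (l (l + s))\<close> is split by
  partial fractions into two cases of \<open>has_integral_sqrt_over\<close>.\<close>

lemma mp_density_integrals:
  assumes b: "\<beta> > 0"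
  shows "has_bochner_integral lborel (\<lambda>l. mp_density \<beta> l * 1) ((1 + \<beta> - \<bar>1 - \<beta>\<bar>) / (2 * \<beta>))"
    "has_bochner_integral lborel (\<lambda>l. mp_density \<beta> l * l) 1"
    "s > 0 \<Longrightarrow> has_bochner_integral lborel (\<lambda>l. mp_density \<beta> l * (1 / (l + s)))
      (((1 + \<beta> - \<bar>1 - \<beta>\<bar>) / (2 * \<beta>) - (1 + \<beta> + s - sqrt ((mp_minus \<beta> + s) * (mp_plus \<beta> + s))) / (2 * \<beta>)) / s)"
proof -
  let ?a = "mp_minus \<beta>" and ?b = "mp_plus \<beta>"
  note e = mp_edges[OF b]
  have J: "((\<lambda>l. sqrt ((l - ?a) * (?b - l)) / (l + c)) has_integral pi * (1 + \<beta> + c - sqrt ((?a + c) * (?b + c)))) {?a..?b}"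
    if "c \<ge> 0" for c
  proof -
    have m: "(?a + ?b) / 2 = 1 + \<beta>" using e(4) by simp
    show ?thesis using has_integral_sqrt_over[OF e(2), of c] that e(1) unfolding m by simp
  qed
  have J0: "((\<lambda>l. sqrt ((l - ?a) * (?b - l)) / l) has_integral pi * (1 + \<beta> - \<bar>1 - \<beta>\<bar>)) {?a..?b}"
    using J[of 0] by (simp add: e(5))
  have "((\<lambda>l. mp_density \<beta> l * 1) has_integral (pi * (1 + \<beta> - \<bar>1 - \<beta>\<bar>) / (2 * pi * \<beta>))) {?a..?b}"
    by (rule has_integral_eq[OF _ has_integral_divide[OF J0]]) (auto simp: mp_density_inside)
  from has_bochner_integral_mp_density[OF b _ _ this]
  show "has_bochner_integral lborel (\<lambda>l. mp_density \<beta> l * 1) ((1 + \<beta> - \<bar>1 - \<beta>\<bar>) / (2 * \<beta>))" by simp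
  have "((\<lambda>l. sqrt ((l - ?a) * (?b - l)) / (2 * pi * \<beta>)) has_integral (pi * (?b - ?a)^2 / 8 / (2 * pi * \<beta>))) {?a..?b}"
    by (intro has_integral_divide has_integral_sqrt_quadratic e)
  then have "((\<lambda>l. mp_density \<beta> l * l) has_integral (pi * (?b - ?a)^2 / 8 / (2 * pi * \<beta>))) {?a..?b}"
  proof (rule has_integral_eq[rotated])
    fix l assume l: "l \<in> {?a..?b}"
    show "sqrt ((l - ?a) * (?b - l)) / (2 * pi * \<beta>) = mp_density \<beta> l * l"
    \<comment> \<open>The origin lies in the closed support only if the left edge is 0, and then the
      square root vanishes there.\<close>
    proof (cases "l = 0")
      case True
      then have "?a = 0" using l e(1) by auto
      then show ?thesis using True by simp
    qed (use l in \<open>simp add: mp_density_inside\<close>)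
  qed
  from has_bochner_integral_mp_density[OF b _ _ this]
  show "has_bochner_integral lborel (\<lambda>l. mp_density \<beta> l * l) 1"
    using e(1) b by (simp add: e(6))
  assume s: "s > 0"
  have "((\<lambda>l. (sqrt ((l - ?a) * (?b - l)) / l - sqrt ((l - ?a) * (?b - l)) / (l + s)) / (2 * pi * \<beta>) / s) has_integral
     ((pi * (1 + \<beta> - \<bar>1 - \<beta>\<bar>) - pi * (1 + \<beta> + s - sqrt ((?a + s) * (?b + s)))) / (2 * pi * \<beta>) / s)) {?a..?b}"
    using s by (intro has_integral_divide has_integral_diff J J0) auto
  then have "((\<lambda>l. mp_density \<beta> l * (1 / (l + s))) has_integral
     ((pi * (1 + \<beta> - \<bar>1 - \<beta>\<bar>) - pi * (1 + \<beta> + s - sqrt ((?a + s) * (?b + s)))) / (2 * pi * \<beta>) / s)) {?a..?b}"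
  proof (rule has_integral_eq[rotated])
    fix l assume l: "l \<in> {?a..?b}"
    define S where "S = sqrt ((l - ?a) * (?b - l))"
    show "(sqrt ((l - ?a) * (?b - l)) / l - sqrt ((l - ?a) * (?b - l)) / (l + s)) / (2 * pi * \<beta>) / s = mp_density \<beta> l * (1 / (l + s))"
    proof (cases "l = 0")
      case True
      then have "?a = 0" using l e(1) by auto
      then show ?thesis using True by (simp add: mp_density_def)
    next
      case False
      then have l0: "l > 0" using l e(1) by auto
      have "S / l - S / (l + s) = S / l * s / (l + s)" using l0 s by (simp add: field_simps)
      then have "(S / l - S / (l + s)) / (2 * pi * \<beta>) / s = S / l / (2 * pi * \<beta>) * (1 / (l + s))"
        using s by simp
      then show ?thesis using l by (simp only: mp_density_inside atLeastAtMost_iff S_def)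
    qed
  qed
  from has_bochner_integral_mp_density[OF b _ _ this]
  have "has_bochner_integral lborel (\<lambda>l. mp_density \<beta> l * (1 / (l + s)))
     ((pi * (1 + \<beta> - \<bar>1 - \<beta>\<bar>) - pi * (1 + \<beta> + s - sqrt ((?a + s) * (?b + s)))) / (2 * pi * \<beta>) / s)"
    using s e(1) by simp
  also have "(pi * (1 + \<beta> - \<bar>1 - \<beta>\<bar>) - pi * (1 + \<beta> + s - sqrt ((?a + s) * (?b + s)))) / (2 * pi * \<beta>) / s
     = ((1 + \<beta> - \<bar>1 - \<beta>\<bar>) / (2 * \<beta>) - (1 + \<beta> + s - sqrt ((?a + s) * (?b + s))) / (2 * \<beta>)) / s"
    by (simp add: diff_divide_distrib)
  finally show "has_bochner_integral lborel (\<lambda>l. mp_density \<beta> l * (1 / (l + s)))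
     (((1 + \<beta> - \<bar>1 - \<beta>\<bar>) / (2 * \<beta>) - (1 + \<beta> + s - sqrt ((?a + s) * (?b + s))) / (2 * \<beta>)) / s)" .
qed

text \<open>The interval starts at 0 to include the atom. Boundedness on it is enough for
  integrability, since the density vanishes outside the two edges.\<close>

definition mp_ok :: "real \<Rightarrow> (real \<Rightarrow> real) \<Rightarrow> bool" where
  "mp_ok \<beta> g \<longleftrightarrow> g \<in> borel_measurable borel \<and> (\<exists>K. \<forall>l\<in>{0..mp_plus \<beta>}. \<bar>g l\<bar> \<le> K)"

lemma mp_ok_integrable:
  assumes b: "\<beta> > 0" and g: "mp_ok \<beta> g"
  shows "integrable lborel (\<lambda>l. mp_density \<beta> l * g l)"
proof -
  from g obtain K where [measurable]: "g \<in> borel_measurable borel" and K: "\<And>l. l \<in> {0..mp_plus \<beta>} \<Longrightarrow> \<bar>g l\<bar> \<le> K"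
    unfolding mp_ok_def by blast
  have "integrable lborel (\<lambda>l. K * (mp_density \<beta> l * 1))"
    using mp_density_integrals(1)[OF b] by (intro integrable_mult_right integrable.intros)
  then show ?thesis
  proof (rule Bochner_Integration.integrable_bound)
    show "AE l in lborel. norm (mp_density \<beta> l * g l) \<le> norm (K * (mp_density \<beta> l * 1))"
    proof (rule AE_I2)
      fix l
      show "norm (mp_density \<beta> l * g l) \<le> norm (K * (mp_density \<beta> l * 1))"
      proof (cases "l \<in> {mp_minus \<beta>..mp_plus \<beta>}")
        case True
        then have "\<bar>g l\<bar> \<le> \<bar>K\<bar>" using K[of l] mp_edges(1)[OF b] by auto
        then show ?thesis using mp_density_nonneg[OF b, of l]
            by (simp add: abs_mult) (metis mult.commute mult_left_mono)
      qed (simp add: mp_density_outside)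
    qed
  qed measurable
qed

lemma mp_ok_cont:
  assumes "continuous_on UNIV g"
  shows "mp_ok \<beta> g"
proof -
  have "compact (g ` {0..mp_plus \<beta>})"
    using continuous_on_subset[OF assms] by (intro compact_continuous_image) auto
  then obtain K where "\<forall>y\<in>g ` {0..mp_plus \<beta>}. norm y \<le> K"
    using compact_imp_bounded bounded_iff by metis
  then show ?thesis using borel_measurable_continuous_onI[OF assms] by (auto simp: mp_ok_def)
qed

lemma mp_integral_linear:
  assumes b: "\<beta> > 0" and f: "mp_ok \<beta> f" and g: "mp_ok \<beta> g"
  shows "mp_integral \<beta> (\<lambda>l. u * f l + v * g l) = u * mp_integral \<beta> f + v * mp_integral \<beta> g"
proof -
  have "(LINT l|lborel. mp_density \<beta> l * (u * f l + v * g l))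
     = (LINT l|lborel. u * (mp_density \<beta> l * f l) + v * (mp_density \<beta> l * g l))"
    by (simp add: algebra_simps)
  also have "\<dots> = u * (LINT l|lborel. mp_density \<beta> l * f l) + v * (LINT l|lborel. mp_density \<beta> l * g l)"
    using mp_ok_integrable[OF b f] mp_ok_integrable[OF b g] by simp
  finally show ?thesis by (simp add: mp_integral_def algebra_simps)
qed

lemma mp_integral_mono:
  assumes b: "\<beta> > 0" and f: "mp_ok \<beta> f" and g: "mp_ok \<beta> g"
    and le: "\<And>l. 0 \<le> l \<Longrightarrow> l \<le> mp_plus \<beta> \<Longrightarrow> f l \<le> g l"
  shows "mp_integral \<beta> f \<le> mp_integral \<beta> g"
proof -
  have "(LINT l|lborel. mp_density \<beta> l * f l) \<le> (LINT l|lborel. mp_density \<beta> l * g l)"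
  proof (rule integral_mono)
    fix l show "mp_density \<beta> l * f l \<le> mp_density \<beta> l * g l"
      using mp_density_nonneg[OF b, of l] le[of l] mp_edges(1)[OF b]
      by (cases "l \<in> {mp_minus \<beta>..mp_plus \<beta>}") (auto simp: mp_density_outside intro!: mult_left_mono)
  qed (use mp_ok_integrable[OF b f] mp_ok_integrable[OF b g] in auto)
  moreover have "max 0 (1 - 1 / \<beta>) * f 0 \<le> max 0 (1 - 1 / \<beta>) * g 0"
    using le[of 0] mp_edges(3)[OF b] by (intro mult_left_mono) auto
  ultimately show ?thesis by (simp add: mp_integral_def)
qed

lemma mp_mass:
  fixes \<beta> :: real
  shows "\<beta> > 0 \<Longrightarrow> max 0 (1 - 1 / \<beta>) + (1 + \<beta> - \<bar>1 - \<beta>\<bar>) / (2 * \<beta>) = 1"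
  by (auto simp: max_def abs_real_def field_simps)

lemma mp_integral_one:
  assumes b: "\<beta> > 0"
  shows "mp_integral \<beta> (\<lambda>_. 1) = 1"
  unfolding mp_integral_def has_bochner_integral_integral_eq[OF mp_density_integrals(1)[OF b]]
  using mp_mass[OF b] by simp

lemma mp_integral_const:
  assumes b: "\<beta> > 0"
  shows "mp_integral \<beta> (\<lambda>_. c) = c"
  using mp_integral_linear[OF b, of "\<lambda>_. 1" "\<lambda>_. 1" c 0] mp_integral_one[OF b] by (simp add: mp_ok_cont)

lemma mp_mean_one: "\<beta> > 0 \<Longrightarrow> mp_mean \<beta> = 1"
  using has_bochner_integral_integral_eq[OF mp_density_integrals(2)]
  by (simp add: mp_mean_def mp_integral_def)

text \<open>The explicit integrals give \<open>g = (S - (s + 1 - \<beta>)) / (2 \<beta> s)\<close>,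
  a root of the quadratic equivalent to the claimed equation; \<open>s + 1 - \<beta> \<le> S\<close>
  settles the sign.\<close>

lemma mp_stieltjes:
  assumes b: "\<beta> > 0" and s: "s > 0"
  defines "g \<equiv> mp_integral \<beta> (\<lambda>l. 1 / (l + s))"
  shows "g \<ge> 0" "s * g + g / (1 + \<beta> * g) = 1"
proof -
  note e = mp_edges[OF b]
  define S where "S = sqrt ((mp_minus \<beta> + s) * (mp_plus \<beta> + s))"
  have "(mp_minus \<beta> + s) * (mp_plus \<beta> + s) = (s + 1 - \<beta>)^2 + 4 * \<beta> * s"
  proof -
    have "(mp_minus \<beta> + s) * (mp_plus \<beta> + s) = mp_minus \<beta> * mp_plus \<beta> + s * (mp_minus \<beta> + mp_plus \<beta>) + s^2"
      by (simp add: algebra_simps power2_eq_square)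
    also have "\<dots> = (s + 1 - \<beta>)^2 + 4 * \<beta> * s"
      unfolding e(4,5) by (simp add: algebra_simps power2_eq_square)
    finally show ?thesis .
  qed
  moreover have "0 \<le> (mp_minus \<beta> + s) * (mp_plus \<beta> + s)" using e s by simp
  ultimately have S2: "S^2 = (s + 1 - \<beta>)^2 + 4 * \<beta> * s" by (simp add: S_def)
  have S0: "S \<ge> 0" using e s by (simp add: S_def)
  have int: "(LINT l|lborel. mp_density \<beta> l * (1 / (l + s)))
     = ((1 + \<beta> - \<bar>1 - \<beta>\<bar>) / (2 * \<beta>) - (1 + \<beta> + s - S) / (2 * \<beta>)) / s"
    using has_bochner_integral_integral_eq[OF mp_density_integrals(3)[OF b s]] by (simp add: S_def)
  have "g = (1 - (1 + \<beta> + s - S) / (2 * \<beta>)) / s"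
  proof -
    have "w * (1 / (0 + s)) + (k - t) / s = (1 - t) / s" if "w + k = 1" for w k t
      using that by (simp add: eq_diff_eq[symmetric] diff_divide_distrib flip: add_divide_distrib)
    from this[OF mp_mass[OF b]] show ?thesis unfolding g_def mp_integral_def int .
  qed
  also have "1 - (1 + \<beta> + s - S) / (2 * \<beta>) = (S - (s + 1 - \<beta>)) / (2 * \<beta>)"
    using b by (simp add: field_simps)
  finally have g: "g = (S - (s + 1 - \<beta>)) / (2 * \<beta> * s)" by simp
  have "(s + 1 - \<beta>)^2 \<le> S^2" unfolding S2 using b s by simp
  then have "s + 1 - \<beta> \<le> S" using S0 by (rule power2_le_imp_le)
  then show g0: "g \<ge> 0" unfolding g using b s by simp
  have "2 * \<beta> * s * g + (s + 1 - \<beta>) = S" unfolding g using b s by simp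
  then have "(2 * \<beta> * s * g + (s + 1 - \<beta>))^2 = (s + 1 - \<beta>)^2 + 4 * \<beta> * s" using S2 by simp
  then have "4 * \<beta> * s * (\<beta> * s * g^2 + (s + 1 - \<beta>) * g - 1) = 0"
    by (simp add: power2_eq_square algebra_simps)
  then have q: "\<beta> * s * g^2 + (s + 1 - \<beta>) * g - 1 = 0" using b s by simp
  have p: "1 + \<beta> * g > 0" using b g0 by (simp add: add_pos_nonneg)
  have "s * g * (1 + \<beta> * g) + g = 1 + \<beta> * g" using q by (simp add: power2_eq_square algebra_simps)
  then show "s * g + g / (1 + \<beta> * g) = 1" using p by (simp add: field_simps)
qed

lemma mp_integral_pos:
  assumes b: "\<beta> > 0" and f: "mp_ok \<beta> f" and nn: "\<And>l. 0 \<le> l \<Longrightarrow> f l \<ge> 0"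
    and uv: "u < v" "mp_minus \<beta> \<le> u" "v \<le> mp_plus \<beta>" and pos: "\<And>l. u < l \<Longrightarrow> l < v \<Longrightarrow> f l > 0"
  shows "mp_integral \<beta> f > 0"
proof -
  let ?g = "\<lambda>l. mp_density \<beta> l * f l"
  note e = mp_edges[OF b]
  note int = mp_ok_integrable[OF b f]
  have g0: "0 \<le> ?g l" for l
    using mp_density_nonneg[OF b, of l] nn[of l] e(1)
    by (cases "l \<in> {mp_minus \<beta>..mp_plus \<beta>}") (auto simp: mp_density_outside)
  have "(LINT l|lborel. ?g l) \<noteq> 0"
  proof
    assume "(LINT l|lborel. ?g l) = 0"
    then have "AE l in lborel. ?g l = 0"
      using integral_nonneg_eq_0_iff_AE[OF int] g0 by simp
    then have "AE l in lborel. l \<notin> {u<..<v}"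
    proof eventually_elim
      case (elim l)
      show ?case
      proof
        assume l: "l \<in> {u<..<v}"
        then have "l > 0" "mp_minus \<beta> < l" "l < mp_plus \<beta>" using uv e(1) by auto
        then have "mp_density \<beta> l > 0" using b by (simp add: mp_density_inside)
        then show False using elim pos[of l] l by auto
      qed
    qed
    then have "emeasure lborel {u<..<v} = 0"
      by (subst (asm) AE_iff_measurable[of "{u<..<v}"]) auto
    then show False using uv by simp
  qed
  moreover have "(LINT l|lborel. ?g l) \<ge> 0" using g0 by (simp add: integral_nonneg_AE)
  moreover have "max 0 (1 - 1 / \<beta>) * f 0 \<ge> 0" using nn[of 0] by simp
  ultimately show ?thesis by (simp add: mp_integral_def)
qed

text \<open>Mass below \<open>x\<close> has two sources. For \<beta> > 1 the point \<open>x\<close>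
  may lie in the gap between 0 and the left edge, so the atom is used; otherwise \<open>x\<close>
  exceeds the left edge and the density suffices. At \<beta> = 1 both meanings of the left edge
  agree.\<close>

lemma mp_both_sides:
  assumes b: "\<beta> > 0" and x: "mp_minus_t \<beta> < x" "x < mp_plus \<beta>"
  shows "mp_integral \<beta> (\<lambda>l. max 0 (l - x)) > 0" "mp_integral \<beta> (\<lambda>l. max 0 (x - l)) > 0"
proof -
  note e = mp_edges[OF b]
  have ok: "mp_ok \<beta> (\<lambda>l. max 0 (l - x))" "mp_ok \<beta> (\<lambda>l. max 0 (x - l))"
    by (auto intro!: mp_ok_cont continuous_intros)
  show "mp_integral \<beta> (\<lambda>l. max 0 (l - x)) > 0"
    by (rule mp_integral_pos[OF b ok(1), of "max x (mp_minus \<beta>)" "mp_plus \<beta>"]) (use x e in auto)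
  show "mp_integral \<beta> (\<lambda>l. max 0 (x - l)) > 0"
  proof (cases "\<beta> > 1")
    case True
    then have x0: "x > 0" using x by (simp add: mp_minus_t_def)
    have "0 < max 0 (1 - 1 / \<beta>) * x" using True x0 by simp
    moreover have "(LINT l|lborel. mp_density \<beta> l * max 0 (x - l)) \<ge> 0"
      using mp_density_nonneg[OF b] by (intro integral_nonneg_AE) simp
    ultimately show ?thesis using x0 by (simp add: mp_integral_def)
  next
    case False
    then have "mp_minus \<beta> < x" using x by (cases "\<beta> = 1") (auto simp: mp_minus_t_def mp_minus_def)
    then show ?thesis
      by (intro mp_integral_pos[OF b ok(2), of "mp_minus \<beta>" x]) (use x in auto)
  qed
qed

section \<open>From Stieltjes transforms to functions of linear growth\<close>

lemma inverse_power_mvt: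
  fixes u v :: real
  assumes "0 < u" "u < v"
  shows "\<exists>z. u < z \<and> z < v \<and> inverse v ^ m - inverse u ^ m = (v - u) * (- (real m * inverse z ^ Suc m))"
proof -
  have "\<exists>z>u. z < v \<and> (\<lambda>x. inverse x ^ m) v - (\<lambda>x. inverse x ^ m) u = (v - u) * (- (real m * inverse z ^ Suc m))"
  proof (rule MVT2[OF assms(2)])
    fix x assume "u \<le> x" "x \<le> v"
    then have x: "x > 0" using assms by simp
    have "((\<lambda>x. inverse x ^ m) has_real_derivative real m * inverse x ^ (m - 1) * (- (inverse x ^ 2))) (at x)"
      using x by (auto intro!: derivative_eq_intros simp: power2_eq_square)
    moreover have "real m * inverse x ^ (m - 1) * (- (inverse x ^ 2)) = - (real m * inverse x ^ Suc m)"
      by (cases m) (simp_all add: power2_eq_square)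
    ultimately show "((\<lambda>x. inverse x ^ m) has_real_derivative - (real m * inverse x ^ Suc m)) (at x)" by (simp only:)
  qed
  then show ?thesis by auto
qed

text \<open>Two applications of the mean value theorem. The bound is uniform in
  \<open>w \<ge> s\<close>, so difference quotients in the shift approximate the next inverse power
  uniformly over the spectrum.\<close>

lemma inverse_power_difference_quotient:
  fixes w s \<delta> :: real
  assumes s: "s > 0" and w: "s \<le> w" and d: "\<delta> > 0" and m: "m > 0"
  shows "\<bar>(inverse w ^ m - inverse (w + \<delta>) ^ m) / (m * \<delta>) - inverse w ^ Suc m\<bar> \<le> (real (Suc m) * inverse s ^ (m + 2)) * \<delta>"
proof -
  obtain z where z: "w < z" "z < w + \<delta>" "inverse (w + \<delta>) ^ m - inverse w ^ m = \<delta> * (- (real m * inverse z ^ Suc m))"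
    using inverse_power_mvt[of w "w + \<delta>" m] s w d by auto
  then have 1: "(inverse w ^ m - inverse (w + \<delta>) ^ m) / (m * \<delta>) = inverse z ^ Suc m"
    using m d by (simp add: field_simps)
  obtain y where y: "w < y" "y < z" "inverse z ^ Suc m - inverse w ^ Suc m = (z - w) * (- (real (Suc m) * inverse y ^ Suc (Suc m)))"
    using inverse_power_mvt[of w z "Suc m"] s w z by auto
  have "\<bar>inverse z ^ Suc m - inverse w ^ Suc m\<bar> = (z - w) * (real (Suc m) * inverse y ^ Suc (Suc m))"
    unfolding y(3) using y z s w by (simp add: abs_mult)
  also have "\<dots> \<le> \<delta> * (real (Suc m) * inverse s ^ Suc (Suc m))"
    using y z s w by (intro mult_mono power_mono le_imp_inverse_le) auto
  finally show ?thesis unfolding 1 by (simp add: mult_ac)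
qed

lemma mp_ok_linear:
  assumes "mp_ok \<beta> f" "mp_ok \<beta> g"
  shows "mp_ok \<beta> (\<lambda>l. u * f l + v * g l)"
proof -
  from assms obtain K L where "\<And>l. l \<in> {0..mp_plus \<beta>} \<Longrightarrow> \<bar>f l\<bar> \<le> K" "\<And>l. l \<in> {0..mp_plus \<beta>} \<Longrightarrow> \<bar>g l\<bar> \<le> L"
    unfolding mp_ok_def by blast
  then have "\<bar>u * f l + v * g l\<bar> \<le> \<bar>u\<bar> * K + \<bar>v\<bar> * L" if "l \<in> {0..mp_plus \<beta>}" for l
    using that by (intro order_trans[OF abs_triangle_ineq] add_mono) (auto simp: abs_mult intro!: mult_left_mono)
  then have "\<exists>K. \<forall>l\<in>{0..mp_plus \<beta>}. \<bar>u * f l + v * g l\<bar> \<le> K" by blast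
  then show ?thesis using assms unfolding mp_ok_def by (auto intro!: borel_measurable_add borel_measurable_times)
qed

context
  fixes \<beta> :: real and ls :: "nat \<Rightarrow> real list"
  assumes b: "\<beta> > 0" and len: "\<And>n. length (ls n) = n" and nn: "\<And>n l. l \<in> set (ls n) \<Longrightarrow> l \<ge> 0"
    and stieltjes: "\<And>s. s > 0 \<Longrightarrow> s \<in> \<rat> \<Longrightarrow>
      (\<lambda>n. (\<Sum>l\<leftarrow>ls n. 1 / (l + s)) / n) \<longlonglongrightarrow> mp_integral \<beta> (\<lambda>l. 1 / (l + s))"
    and mean: "(\<lambda>n. (\<Sum>l\<leftarrow>ls n. l) / n) \<longlonglongrightarrow> 1"
begin

definition emp_conv :: "(real \<Rightarrow> real) \<Rightarrow> bool" where
  "emp_conv f \<longleftrightarrow> mp_ok \<beta> f \<and> (\<lambda>n. (\<Sum>l\<leftarrow>ls n. f l) / n) \<longlonglongrightarrow> mp_integral \<beta> f"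

lemma emp_conv_linear:
  assumes f: "emp_conv f" and g: "emp_conv g"
  shows "emp_conv (\<lambda>l. u * f l + v * g l)"
proof -
  have "(\<Sum>l\<leftarrow>xs. u * f l + v * g l) = u * (\<Sum>l\<leftarrow>xs. f l) + v * (\<Sum>l\<leftarrow>xs. g l)" for xs
    by (induction xs) (auto simp: algebra_simps)
  then have "(\<lambda>n. (\<Sum>l\<leftarrow>ls n. u * f l + v * g l) / n) = (\<lambda>n. u * ((\<Sum>l\<leftarrow>ls n. f l) / n) + v * ((\<Sum>l\<leftarrow>ls n. g l) / n))"
    by (auto simp: add_divide_distrib)
  also have "\<dots> \<longlonglongrightarrow> u * mp_integral \<beta> f + v * mp_integral \<beta> g"
    using f g unfolding emp_conv_def by (intro tendsto_intros) auto
  finally show ?thesis using f g mp_ok_linear mp_integral_linear[OF b] unfolding emp_conv_def by simp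
qed

lemma emp_conv_sum:
  fixes c :: "nat \<Rightarrow> real"
  assumes "\<And>i. i \<in> A \<Longrightarrow> emp_conv (f i)" "finite A"
  shows "emp_conv (\<lambda>l. \<Sum>i\<in>A. c i * f i l)"
  using assms(2,1)
proof (induction A rule: finite_induct)
  case empty
  have "emp_conv (\<lambda>l. 0 * 0)"
    using mp_integral_const[OF b, of 0] by (auto simp: emp_conv_def mp_ok_cont)
  then show ?case by simp
next
  case (insert i A)
  then have "emp_conv (\<lambda>l. c i * f i l + 1 * (\<Sum>i\<in>A. c i * f i l))"
    by (intro emp_conv_linear) auto
  then show ?case using insert by simp
qed

lemma emp_conv_one: "emp_conv (\<lambda>_. 1)"
  unfolding emp_conv_def
proof
  have "eventually (\<lambda>n. (\<Sum>l\<leftarrow>ls n. 1) / real n = 1) sequentially"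
    using eventually_gt_at_top[of 0] by eventually_elim (simp add: sum_list_triv len)
  then show "(\<lambda>n. (\<Sum>l\<leftarrow>ls n. 1) / real n) \<longlonglongrightarrow> mp_integral \<beta> (\<lambda>_. 1)"
    unfolding mp_integral_one[OF b] by (rule tendsto_eventually)
qed (simp add: mp_ok_cont)

lemma emp_conv_id: "emp_conv (\<lambda>l. l)"
  using mean mp_mean_one[OF b] by (simp add: emp_conv_def mp_ok_cont mp_mean_def)

text \<open>An error growing like \<open>1 + l\<close> is tolerable because the averages of
  \<open>1 + l\<close> converge to its integral, which is 2. This is where convergence of the mean
  controls large eigenvalues.\<close>

lemma emp_conv_approx:
  assumes f: "mp_ok \<beta> f"
    and ap: "\<And>e. e > 0 \<Longrightarrow> \<exists>g. emp_conv g \<and> (\<forall>l\<ge>0. \<bar>f l - g l\<bar> \<le> e * (1 + l))"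
  shows "emp_conv f"
  unfolding emp_conv_def
proof (intro conjI f tendstoI)
  fix e :: real assume e: "e > 0"
  \<comment> \<open>The three errors are at most \<open>3 d\<close>, \<open>d\<close> and
    \<open>2 d\<close>, together less than \<open>8 d\<close>.\<close>
  define d where "d = e / 8"
  have d: "d > 0" using e by (simp add: d_def)
  obtain g where g: "emp_conv g" and fg: "\<And>l. l \<ge> 0 \<Longrightarrow> \<bar>f l - g l\<bar> \<le> d * (1 + l)"
    using ap[OF d] by blast
  have gok: "mp_ok \<beta> g" using g by (simp add: emp_conv_def)
  have wok: "mp_ok \<beta> (\<lambda>l. d * 1 + d * l)" by (intro mp_ok_cont continuous_intros)
  have wint: "mp_integral \<beta> (\<lambda>l. d * 1 + d * l) = 2 * d"
    using mp_integral_linear[OF b, of "\<lambda>_. 1" "\<lambda>l. l" d d] mp_integral_one[OF b] mp_mean_one[OF b]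
    by (simp add: mp_ok_cont mp_mean_def)
  have "mp_integral \<beta> f \<le> mp_integral \<beta> (\<lambda>l. 1 * g l + 1 * (d * 1 + d * l))"
    using fg by (intro mp_integral_mono[OF b f mp_ok_linear[OF gok wok]]) (auto simp: abs_le_iff algebra_simps)
  moreover have "mp_integral \<beta> (\<lambda>l. 1 * g l + (-1) * (d * 1 + d * l)) \<le> mp_integral \<beta> f"
    using fg by (intro mp_integral_mono[OF b mp_ok_linear[OF gok wok] f]) (auto simp: abs_le_iff algebra_simps)
  ultimately have I: "\<bar>mp_integral \<beta> f - mp_integral \<beta> g\<bar> \<le> 2 * d"
    unfolding mp_integral_linear[OF b gok wok] wint by simp
  have A: "\<bar>(\<Sum>l\<leftarrow>ls n. f l) / n - (\<Sum>l\<leftarrow>ls n. g l) / n\<bar> \<le> d * ((\<Sum>l\<leftarrow>ls n. 1) / n + (\<Sum>l\<leftarrow>ls n. l) / n)" for n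
  proof -
    have bound: "\<bar>(\<Sum>l\<leftarrow>xs. f l) - (\<Sum>l\<leftarrow>xs. g l)\<bar> \<le> d * ((\<Sum>l\<leftarrow>xs. 1) + (\<Sum>l\<leftarrow>xs. l))" if "\<And>l. l \<in> set xs \<Longrightarrow> l \<ge> 0" for xs
      using that
    proof (induction xs)
      case (Cons l xs)
      have "\<bar>f l - g l\<bar> \<le> d * (1 + l)" using Cons.prems by (intro fg) simp
      moreover have "\<bar>(\<Sum>l\<leftarrow>xs. f l) - (\<Sum>l\<leftarrow>xs. g l)\<bar> \<le> d * ((\<Sum>l\<leftarrow>xs. 1) + (\<Sum>l\<leftarrow>xs. l))"
        using Cons.prems by (intro Cons.IH) simp
      ultimately show ?case by (simp add: algebra_simps abs_le_iff)
    qed simp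
    have "\<bar>(\<Sum>l\<leftarrow>ls n. f l) - (\<Sum>l\<leftarrow>ls n. g l)\<bar> / n \<le> d * ((\<Sum>l\<leftarrow>ls n. 1) + (\<Sum>l\<leftarrow>ls n. l)) / n"
      by (rule divide_right_mono[OF bound]) (use nn in auto)
    then show ?thesis by (simp only: add_divide_distrib[symmetric] diff_divide_distrib[symmetric] abs_divide abs_of_nat times_divide_eq_right)
  qed
  have "(\<lambda>n. (\<Sum>l\<leftarrow>ls n. 1) / real n) \<longlonglongrightarrow> 1" using emp_conv_one mp_integral_one[OF b] by (simp add: emp_conv_def)
  then have "(\<lambda>n. (\<Sum>l\<leftarrow>ls n. 1) / real n + (\<Sum>l\<leftarrow>ls n. l) / real n) \<longlonglongrightarrow> 1 + 1" by (intro tendsto_add mean)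
  then have "eventually (\<lambda>n. (\<Sum>l\<leftarrow>ls n. 1) / real n + (\<Sum>l\<leftarrow>ls n. l) / real n < 3) sequentially"
    by (rule order_tendstoD(2)) simp
  moreover have "(\<lambda>n. (\<Sum>l\<leftarrow>ls n. g l) / real n) \<longlonglongrightarrow> mp_integral \<beta> g" using g by (simp add: emp_conv_def)
  then have "eventually (\<lambda>n. dist ((\<Sum>l\<leftarrow>ls n. g l) / n) (mp_integral \<beta> g) < d) sequentially"
    using d by (rule tendstoD)
  ultimately show "eventually (\<lambda>n. dist ((\<Sum>l\<leftarrow>ls n. f l) / n) (mp_integral \<beta> f) < e) sequentially"
  proof eventually_elim
    case (elim n)
    have "d * ((\<Sum>l\<leftarrow>ls n. 1) / real n + (\<Sum>l\<leftarrow>ls n. l) / real n) \<le> d * 3"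
      using elim(1) d by (intro mult_left_mono) auto
    then show ?case using elim(2) I A[of n] unfolding dist_real_def d_def by linarith
  qed
qed

lemma mp_ok_inverse_power:
  assumes "s > 0"
  shows "mp_ok \<beta> (\<lambda>l. inverse (l + s) ^ k)"
  unfolding mp_ok_def
proof (intro conjI exI ballI)
  fix l assume "l \<in> {0..mp_plus \<beta>}"
  then show "\<bar>inverse (l + s) ^ k\<bar> \<le> inverse s ^ k"
    using assms by (auto simp: power_abs intro!: power_mono le_imp_inverse_le)
qed measurable

text \<open>Higher powers arise by differentiating in \<open>s\<close>. Difference quotients stand
  in for the derivative, so that limits in \<open>n\<close> are taken at finitely many shifts at a
  time.\<close>

lemma emp_conv_inverse_power:
  "s > 0 \<Longrightarrow> s \<in> \<rat> \<Longrightarrow> emp_conv (\<lambda>l. inverse (l + s) ^ Suc k)"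
proof (induction k arbitrary: s)
  case 0
  then show ?case using stieltjes[OF 0] mp_ok_inverse_power[of s 1] by (simp add: emp_conv_def inverse_eq_divide)
next
  case (Suc k)
  note s = Suc.prems
  define m where "m = Suc k"
  have m: "m > 0" by (simp add: m_def)
  show ?case unfolding m_def[symmetric]
  proof (rule emp_conv_approx[OF mp_ok_inverse_power[OF s(1)]])
    fix e :: real assume e: "e > 0"
    define C where "C = real (Suc m) * inverse s ^ (m + 2)"
    have C: "C > 0" using s by (simp add: C_def)
    obtain N :: nat where N: "inverse (real (Suc N)) < e / C"
      using reals_Archimedean[of "e / C"] e C by auto
    \<comment> \<open>A reciprocal integer keeps the shifted parameter rational, where convergence
      is assumed.\<close>
    define \<delta> where "\<delta> = inverse (real (Suc N))"
    have \<delta>: "\<delta> > 0" "\<delta> \<in> \<rat>" "C * \<delta> \<le> e" using N C by (auto simp: \<delta>_def field_simps)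
    let ?g = "\<lambda>l. (1 / (m * \<delta>)) * inverse (l + s) ^ m + (- 1 / (m * \<delta>)) * inverse (l + (s + \<delta>)) ^ m"
    have "emp_conv ?g"
      unfolding m_def using s \<delta> by (intro emp_conv_linear Suc.IH) (auto intro: add_pos_pos)
    moreover have "\<bar>inverse (l + s) ^ Suc m - ?g l\<bar> \<le> e * (1 + l)" if "l \<ge> 0" for l
    proof -
      have "?g l = (inverse (l + s) ^ m - inverse (l + s + \<delta>) ^ m) / (m * \<delta>)"
        by (simp add: diff_divide_distrib add.assoc)
      then have "\<bar>inverse (l + s) ^ Suc m - ?g l\<bar> \<le> C * \<delta>"
        unfolding C_def using inverse_power_difference_quotient[OF s(1) _ \<delta>(1) m, of "l + s"] that
        by (simp only:) (simp add: abs_minus_commute)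
      also have "\<dots> \<le> e * (1 + l)" using \<delta>(3) that e by (simp add: algebra_simps add_increasing2)
      finally show ?thesis .
    qed
    ultimately show "\<exists>g. emp_conv g \<and> (\<forall>l\<ge>0. \<bar>inverse (l + s) ^ Suc m - g l\<bar> \<le> e * (1 + l))" by blast
  qed
qed

text \<open>In \<open>u = 1 / (1 + l)\<close> the half-line becomes an interval, closed at 0 by the
  limit \<open>L\<close>. A uniform polynomial approximation of \<open>f l / (1 + l)\<close> in
  \<open>u\<close> approximates \<open>f\<close> with an error weighted by \<open>1 + l\<close>, as
  \<open>emp_conv_approx\<close> allows.\<close>

proposition empirical_convergence:
  assumes f: "continuous_on UNIV f" and L: "((\<lambda>l. f l / (1 + l)) \<longlongrightarrow> L) at_top"
  shows "(\<lambda>n. (\<Sum>l\<leftarrow>ls n. f l) / n) \<longlonglongrightarrow> mp_integral \<beta> f"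
proof -
  define k where "k u = (if u = 0 then L else f (1 / u - 1) * u)" for u :: real
  have kc: "continuous_on {0..1} k"
    unfolding continuous_on_eq_continuous_within
  proof
    fix u :: real assume u: "u \<in> {0..1}"
    show "continuous (at u within {0..1}) k"
    proof (cases "u = 0")
      case True
      have "((\<lambda>l. f (l - 1) / (1 + (l - 1))) \<longlongrightarrow> L) at_top"
        by (rule filterlim_compose[OF L]) (simp add: filterlim_at_top_add_at_top filterlim_tendsto_add_at_top[OF tendsto_const[of "-1"], simplified] filterlim_ident)
      then have "((\<lambda>l. f (l - 1) / l) \<longlongrightarrow> L) at_top" by simp
      then have "((\<lambda>u. f (inverse u - 1) / inverse u) \<longlongrightarrow> L) (at_right 0)"
        by (rule filterlim_compose[OF _ filterlim_inverse_at_top_right])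
      moreover have "eventually (\<lambda>u. f (inverse u - 1) / inverse u = k u) (at_right 0)"
        using eventually_at_right_less[of 0] by eventually_elim (simp add: k_def inverse_eq_divide)
      ultimately have "(k \<longlongrightarrow> L) (at_right 0)" by (rule Lim_transform_eventually)
      moreover have "at (0::real) within {0..1} = at_right 0"
        by (rule at_within_Icc_at_right) simp
      ultimately show ?thesis using True by (simp add: continuous_within k_def)
    next
      case False
      then have u0: "u > 0" using u by simp
      have cf: "isCont f x" for x using f by (simp add: continuous_on_eq_continuous_at)
      have ci: "isCont (\<lambda>u. 1 / u - 1) u" using u0 by (intro continuous_intros) auto
      have "isCont (\<lambda>u. f (1 / u - 1) * u) u"
        by (rule continuous_mult[OF isCont_o2[OF ci cf] continuous_ident])
      moreover have "eventually (\<lambda>u. u \<in> {0<..}) (nhds u)"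
        using u0 by (intro eventually_nhds_in_open) auto
      then have "eventually (\<lambda>u. f (1 / u - 1) * u = k u) (nhds u)"
        by eventually_elim (auto simp: k_def)
      ultimately have "isCont k u" by (simp add: isCont_cong)
      then show ?thesis by (rule continuous_at_imp_continuous_at_within)
    qed
  qed
  have "emp_conv f"
  proof (rule emp_conv_approx[OF mp_ok_cont[OF f]])
    fix e :: real assume e: "e > 0"
    obtain p where p: "real_polynomial_function p" "\<And>u. u \<in> {0..1} \<Longrightarrow> \<bar>k u - p u\<bar> < e"
      using Stone_Weierstrass_real_polynomial_function[OF compact_Icc kc e] by blast
    obtain c N where c: "p = (\<lambda>u. \<Sum>i\<le>N. c i * u ^ i)"
      using p(1) real_polynomial_function_iff_sum by blast
    \<comment> \<open>This is \<open>1 + l\<close> times \<open>u ^ i\<close>: exponent 0 needs the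
      mean, exponent 1 the total mass, and higher exponents the inverse powers.\<close>
    define h where "h i = (\<lambda>l::real. if i = 0 then 1 + l else if i = 1 then 1 else inverse (l + 1) ^ (i - 1))" for i :: nat
    have h: "emp_conv (h i)" for i
    proof -
      consider "i = 0" | "i = 1" | j where "i = Suc (Suc j)" by (metis One_nat_def not0_implies_Suc)
      then show ?thesis
      proof cases
        case 1
        then show ?thesis using emp_conv_linear[OF emp_conv_one emp_conv_id, of 1 1] by (simp add: h_def)
      next
        case 2
        then show ?thesis using emp_conv_one by (simp add: h_def)
      next
        case 3
        then show ?thesis using emp_conv_inverse_power[of 1 j] by (simp add: h_def)
      qed
    qed
    have hp: "h i l = (1 + l) * inverse (1 + l) ^ i" if "l \<ge> 0" for i l
      using that by (cases i) (auto simp: h_def add.commute)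
    have "emp_conv (\<lambda>l. \<Sum>i\<le>N. c i * h i l)" by (intro emp_conv_sum h) auto
    moreover have "\<bar>f l - (\<Sum>i\<le>N. c i * h i l)\<bar> \<le> e * (1 + l)" if l: "l \<ge> 0" for l
    proof -
      define u where "u = inverse (1 + l)"
      have u: "u \<in> {0..1}" "u \<noteq> 0" "1 / u - 1 = l" "(1 + l) * u = 1" using l by (auto simp: u_def field_simps)
      have "f l = (1 + l) * k u" using u l by (simp add: k_def mult.assoc[symmetric] mult.commute)
      moreover have "(\<Sum>i\<le>N. c i * h i l) = (1 + l) * p u"
        unfolding c sum_distrib_left hp[OF l] u_def by (simp add: mult_ac)
      ultimately have "\<bar>f l - (\<Sum>i\<le>N. c i * h i l)\<bar> = (1 + l) * \<bar>k u - p u\<bar>"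
        using l by (simp add: abs_mult flip: right_diff_distrib)
      also have "\<dots> \<le> (1 + l) * e" using p(2)[OF u(1)] l by (intro mult_left_mono) auto
      finally show ?thesis by (simp add: mult.commute)
    qed
    ultimately show "\<exists>g. emp_conv g \<and> (\<forall>l\<ge>0. \<bar>f l - g l\<bar> \<le> e * (1 + l))" by blast
  qed
  then show ?thesis by (simp add: emp_conv_def)
qed

end

section \<open>Legendre duality and exponential tails\<close>

text \<open>\<open>D\<close> plays the role of \<open>\<Psi>'\<close>; the quadratic upper bound replaces differentiability.\<close>

locale smooth_convex =
  fixes \<Psi> D :: "real \<Rightarrow> real" and C :: real
  assumes C: "C \<ge> 0"
    and lower: "\<And>\<alpha> \<eta>. \<Psi> \<alpha> + \<eta> * D \<alpha> \<le> \<Psi> (\<alpha> + \<eta>)"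
    and upper: "\<And>\<alpha> \<eta>. \<Psi> (\<alpha> + \<eta>) \<le> \<Psi> \<alpha> + \<eta> * D \<alpha> + C * \<eta>^2"
    and zero: "\<Psi> 0 = 0"
begin

lemma isCont_Psi: "isCont \<Psi> \<alpha>"
  unfolding isCont_iff
proof (rule real_tendsto_sandwich)
  show "\<forall>\<^sub>F h in at 0. \<Psi> \<alpha> + h * D \<alpha> \<le> \<Psi> (\<alpha> + h)" by (simp add: lower)
  show "\<forall>\<^sub>F h in at 0. \<Psi> (\<alpha> + h) \<le> \<Psi> \<alpha> + h * D \<alpha> + C * h^2" by (simp add: upper)
  show "((\<lambda>h. \<Psi> \<alpha> + h * D \<alpha>) \<longlongrightarrow> \<Psi> \<alpha>) (at 0)" by (auto intro!: tendsto_eq_intros)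
  show "((\<lambda>h. \<Psi> \<alpha> + h * D \<alpha> + C * h^2) \<longlongrightarrow> \<Psi> \<alpha>) (at 0)" by (auto intro!: tendsto_eq_intros)
qed

lemma small_step:
  assumes "d > 0" "r > 0"
  shows "\<exists>\<eta>>0. \<eta> < r \<and> C * \<eta>^2 < \<eta> * d"
proof -
  define \<eta> where "\<eta> = min (r / 2) (d / (C + 1))"
  have e: "\<eta> > 0" "\<eta> < r" using assms C by (auto simp: \<eta>_def)
  have "C * \<eta> < (C + 1) * \<eta>" using e by simp
  also have "\<dots> \<le> (C + 1) * (d / (C + 1))" using C by (intro mult_left_mono) (auto simp: \<eta>_def)
  also have "\<dots> = d" using C by simp
  finally have "\<eta> * (C * \<eta>) < \<eta> * d" using e by simp
  then show ?thesis using e by (auto simp: power2_eq_square mult_ac)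
qed

text \<open>Minimise \<open>\<Psi> \<alpha> - \<alpha> t\<close> on the interval from
  \<open>- K\<close> to 0. Coercivity excludes the left end and \<open>t < D 0\<close> the right
  end; at an interior minimum a slope other than \<open>t\<close> would permit a descending step by
  the quadratic upper bound.\<close>

lemma exposed_point:
  assumes t: "t < D 0" and K: "K > 0" and coercive: "\<Psi> (- K) + K * t > 0"
  shows "\<exists>\<alpha>. - K < \<alpha> \<and> \<alpha> < 0 \<and> D \<alpha> = t"
proof -
  define F where "F \<alpha> = \<Psi> \<alpha> - \<alpha> * t" for \<alpha>
  have cont: "continuous_on {-K..0} F"
    unfolding F_def using isCont_Psi by (intro continuous_intros continuous_at_imp_continuous_on) auto
  obtain a where a: "a \<in> {-K..0}" and min: "\<And>\<alpha>. \<alpha> \<in> {-K..0} \<Longrightarrow> F a \<le> F \<alpha>"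
    using continuous_attains_inf[OF compact_Icc _ cont] K by auto
  have step: "F (\<alpha> + \<eta>) \<le> F \<alpha> + \<eta> * (D \<alpha> - t) + C * \<eta>^2" for \<alpha> \<eta>
    using upper[of \<alpha> \<eta>] by (simp add: F_def algebra_simps)
  have aK: "a \<noteq> - K" using min[of 0] coercive K by (auto simp: F_def zero)
  have a0: "a \<noteq> 0"
  proof
    assume "a = 0"
    obtain \<eta> where \<eta>: "\<eta> > 0" "\<eta> < K" "C * \<eta>^2 < \<eta> * (D 0 - t)" using small_step[of "D 0 - t" K] t K by auto
    have "F (0 + (- \<eta>)) < F 0" using step[of 0 "- \<eta>"] \<eta> by simp
    then show False using min[of "- \<eta>"] \<eta> \<open>a = 0\<close> by simp
  qed
  have a': "- K < a" "a < 0" using a aK a0 by auto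
  have "D a = t"
  proof (rule ccontr)
    assume "D a \<noteq> t"
    then consider "D a > t" | "D a < t" by linarith
    then show False
    proof cases
      case 1
      obtain \<eta> where \<eta>: "\<eta> > 0" "\<eta> < a + K" "C * \<eta>^2 < \<eta> * (D a - t)" using small_step[of "D a - t" "a + K"] 1 a' by auto
      have "F (a + (- \<eta>)) < F a" using step[of a "- \<eta>"] \<eta> by simp
      then show False using min[of "a - \<eta>"] \<eta> a' by simp
    next
      case 2
      obtain \<eta> where \<eta>: "\<eta> > 0" "\<eta> < - a" "C * \<eta>^2 < \<eta> * (t - D a)" using small_step[of "t - D a" "- a"] 2 a' by auto
      have "F (a + \<eta>) < F a" using step[of a "\<eta>"] \<eta> by (simp add: algebra_simps)
      then show False using min[of "a + \<eta>"] \<eta> a' by simp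
    qed
  qed
  then show ?thesis using a' by blast
qed

lemma legendre_at:
  assumes "D a = t"
  shows "\<alpha> * t - \<Psi> \<alpha> \<le> a * t - \<Psi> a"
  using lower[of a "\<alpha> - a"] assms by (simp add: algebra_simps)

text \<open>The supremum is attained where the slope equals \<open>t\<close>. That point is
  negative, so the line and the negative half-line share it.\<close>

lemma legendre_sup:
  assumes t: "t < D 0" and K: "K > 0" and coercive: "\<Psi> (- K) + K * t > 0"
  shows "\<exists>v. (SUP \<alpha>. ereal (\<alpha> * t - \<Psi> \<alpha>)) = ereal v \<and> (SUP \<alpha>\<in>{..<0}. ereal (\<alpha> * t - \<Psi> \<alpha>)) = ereal v
     \<and> (\<exists>a<0. v = a * t - \<Psi> a) \<and> (\<forall>\<alpha>. \<alpha> * t - \<Psi> \<alpha> \<le> v)"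
proof -
  obtain a where a: "a < 0" "D a = t" using exposed_point[OF assms] by blast
  note le = legendre_at[OF a(2)]
  have "(SUP \<alpha>\<in>A. ereal (\<alpha> * t - \<Psi> \<alpha>)) = ereal (a * t - \<Psi> a)" if "a \<in> A" for A
    using le that by (intro SUP_eqI) auto
  then show ?thesis using a le by (intro exI[of _ "a * t - \<Psi> a"]) auto
qed

text \<open>Probability enters only through \<open>chernoff\<close> and \<open>tilt\<close>. At a
  parameter whose slope is slightly below \<open>t\<close>, the window just below \<open>t\<close>
  is typical for the tilted law, and both shifted terms are exponentially smaller than the left side
  of \<open>tilt\<close>.\<close>

lemma lower_tail_limit:
  fixes P :: "nat \<Rightarrow> real" and \<Psi>n :: "nat \<Rightarrow> real \<Rightarrow> real"
  assumes t: "t < D 0" and K: "K > 0" and coercive: "\<Psi> (- K) + K * (t - 1) > 0"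
    and conv: "\<And>\<alpha>. (\<lambda>n. \<Psi>n n \<alpha>) \<longlonglongrightarrow> \<Psi> \<alpha>"
    and chernoff: "\<And>n \<alpha>. n > 0 \<Longrightarrow> \<alpha> \<le> 0 \<Longrightarrow> P n \<le> exp (n * (\<Psi>n n \<alpha> - \<alpha> * t))"
    and tilt: "\<And>n \<alpha> \<eta> u. n > 0 \<Longrightarrow> \<alpha> \<le> 0 \<Longrightarrow> \<eta> \<ge> 0 \<Longrightarrow> u < t \<Longrightarrow>
      exp (n * \<Psi>n n \<alpha>) \<le> exp (n * (\<alpha> * u)) * P n + exp (n * (\<Psi>n n (\<alpha> + \<eta>) - \<eta> * t)) + exp (n * (\<Psi>n n (\<alpha> - \<eta>) + \<eta> * u))"
    and v: "\<And>\<alpha>. \<alpha> * t - \<Psi> \<alpha> \<le> v" "\<exists>a<0. v = a * t - \<Psi> a"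
  shows "(\<lambda>n. ln (P n) / n) \<longlonglongrightarrow> - v"
proof -
  \<comment> \<open>Positivity of \<open>P n\<close> is part of the claim: it gives the logarithm
    its meaning, and the upper bound uses it for monotonicity of \<open>ln\<close>.\<close>
  have low: "eventually (\<lambda>n. P n > 0 \<and> ln (P n) / n > - v - e) sequentially" if e: "e > 0" for e
  proof -
    \<comment> \<open>The window has width \<open>2 \<delta>\<close>; moving from \<open>t\<close>
      to its lower end costs at most \<open>2 K \<delta> \<le> e / 4\<close>, because the tilt lies
      above \<open>- K\<close>.\<close>
    define \<delta> where "\<delta> = min (1/2) (e / (8 * K))"
    have d: "\<delta> > 0" "\<delta> \<le> 1/2" "2 * K * \<delta> \<le> e / 4" using e K by (auto simp: \<delta>_def min_def field_simps)
    define t' where "t' = t - \<delta>"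
    define u where "u = t - 2 * \<delta>"
    \<comment> \<open>Coercivity at \<open>t - 1\<close> is inherited by all levels from there up to
      \<open>t\<close>, so one \<open>K\<close> serves every \<delta>.\<close>
    have "K * (t - 1) \<le> K * t'" using K d by (simp add: t'_def)
    then have "\<Psi> (- K) + K * t' > 0" "t' < D 0" using coercive t d by (auto simp: t'_def)
    then obtain a where a: "- K < a" "a < 0" "D a = t'"
      using exposed_point[of t' K] K by blast
    obtain \<eta> where \<eta>: "\<eta> > 0" "C * \<eta>^2 < \<eta> * \<delta>" using small_step[of \<delta> 1] d by auto
    \<comment> \<open>The slope \<open>t - \<delta>\<close> is the centre of the window, so a shift
      by \<eta> in either direction gains \<open>\<eta> \<delta>\<close> against the error
      \<open>C \<eta>^2\<close>. Half of the balance absorbs the passage from \<open>\<Psi>n\<close>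
      to \<open>\<Psi>\<close>.\<close>
    define c where "c = (\<eta> * \<delta> - C * \<eta>^2) / 2"
    have c: "c > 0" using \<eta> by (simp add: c_def)
    have c2: "2 * c = \<eta> * \<delta> - C * \<eta>^2" by (simp add: c_def)
    have Da: "\<eta> * D a = \<eta> * t - \<eta> * \<delta>" "\<eta> * u = \<eta> * t - 2 * (\<eta> * \<delta>)"
      using a by (auto simp: t'_def u_def algebra_simps)
    have "\<Psi> (a + \<eta>) - \<Psi> a - \<eta> * t < - c"
      using upper[of a \<eta>] c c2 Da by linarith
    moreover have "(\<lambda>n. \<Psi>n n (a + \<eta>) - \<Psi>n n a - \<eta> * t) \<longlonglongrightarrow> \<Psi> (a + \<eta>) - \<Psi> a - \<eta> * t"
      by (intro tendsto_intros conv)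
    ultimately have e1: "eventually (\<lambda>n. \<Psi>n n (a + \<eta>) - \<Psi>n n a - \<eta> * t < - c) sequentially"
      by (metis order_tendstoD(2))
    have "\<Psi> (a - \<eta>) - \<Psi> a + \<eta> * u < - c"
      using upper[of a "- \<eta>"] c c2 Da by simp
    moreover have "(\<lambda>n. \<Psi>n n (a - \<eta>) - \<Psi>n n a + \<eta> * u) \<longlonglongrightarrow> \<Psi> (a - \<eta>) - \<Psi> a + \<eta> * u"
      by (intro tendsto_intros conv)
    ultimately have e2: "eventually (\<lambda>n. \<Psi>n n (a - \<eta>) - \<Psi>n n a + \<eta> * u < - c) sequentially"
      by (metis order_tendstoD(2))
    have "(\<lambda>n. exp (- c) ^ n) \<longlonglongrightarrow> 0" using c by (intro LIMSEQ_realpow_zero) auto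
    then have e3: "eventually (\<lambda>n. exp (- c) ^ n < 1/4) sequentially" by (rule order_tendstoD) simp
    have "(\<lambda>n. \<Psi>n n a - a * u + ln (1/2) / real n) \<longlonglongrightarrow> \<Psi> a - a * u + 0"
      by (intro tendsto_intros conv lim_const_over_n)
    moreover have "\<Psi> a - a * u + 0 > - v - e"
    proof -
      have "\<Psi> a - a * t \<ge> - v" using v(1)[of a] by simp
      moreover have "a * (2 * \<delta>) \<ge> - K * (2 * \<delta>)" using a d by (intro mult_right_mono) auto
      ultimately show ?thesis using d e by (simp add: u_def algebra_simps)
    qed
    ultimately have e4: "eventually (\<lambda>n. \<Psi>n n a - a * u + ln (1/2) / real n > - v - e) sequentially"
      by (metis order_tendstoD(1))
    show ?thesis using e1 e2 e3 e4 eventually_gt_at_top[of 0]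
    proof eventually_elim
      case (elim n)
      have ec: "exp (- (real n * c)) < 1/4" using elim(3) by (simp add: exp_of_nat_mult[symmetric])
      have small: "exp (real n * y) \<le> exp (real n * \<Psi>n n a) * (1/4)" if "y - \<Psi>n n a < - c" for y :: real
      proof -
        have "real n * y \<le> real n * \<Psi>n n a + - (real n * c)"
          using mult_left_mono[OF less_imp_le[OF that], of "real n"] by (simp add: algebra_simps)
        then have "exp (n * y) \<le> exp (n * \<Psi>n n a) * exp (- (real n * c))" by (simp flip: exp_add)
        also have "\<dots> \<le> exp (n * \<Psi>n n a) * (1/4)" using ec by (intro mult_left_mono) auto
        finally show ?thesis .
      qed
      have "exp (n * \<Psi>n n a) \<le> exp (n * (a * u)) * P n + exp (n * (\<Psi>n n (a + \<eta>) - \<eta> * t)) + exp (n * (\<Psi>n n (a - \<eta>) + \<eta> * u))"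
        using a \<eta> d elim by (intro tilt) (auto simp: u_def)
      also have "\<dots> \<le> exp (n * (a * u)) * P n + exp (n * \<Psi>n n a) * (1/4) + exp (n * \<Psi>n n a) * (1/4)"
        using small[of "\<Psi>n n (a + \<eta>) - \<eta> * t"] small[of "\<Psi>n n (a - \<eta>) + \<eta> * u"] elim(1,2) by linarith
      finally have "exp (n * \<Psi>n n a) / 2 \<le> exp (n * (a * u)) * P n" by simp
      then have "P n \<ge> exp (n * \<Psi>n n a) / 2 / exp (n * (a * u))"
        by (simp add: field_simps)
      also have "exp (n * \<Psi>n n a) / 2 / exp (n * (a * u)) = exp (n * (\<Psi>n n a - a * u) + ln (1/2))"
        by (simp add: exp_add exp_diff right_diff_distrib)
      finally have P: "P n \<ge> exp (n * (\<Psi>n n a - a * u) + ln (1/2))" .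
      then have P0: "P n > 0" using exp_gt_zero less_le_trans by blast
      then have "ln (P n) \<ge> n * (\<Psi>n n a - a * u) + ln (1/2)" using P by (simp add: ln_ge_iff)
      then have "ln (P n) / n \<ge> (n * (\<Psi>n n a - a * u) + ln (1/2)) / n"
        by (rule divide_right_mono) simp
      also have "(n * (\<Psi>n n a - a * u) + ln (1/2)) / n = \<Psi>n n a - a * u + ln (1/2) / n"
        using elim by (simp add: add_divide_distrib)
      finally show ?case using elim(4) P0 by linarith
    qed
  qed
  obtain a where a: "a < 0" "v = a * t - \<Psi> a" using v by blast
  have up: "eventually (\<lambda>n. ln (P n) / n < - v + e) sequentially" if e: "e > 0" for e
  proof -
    have "(\<lambda>n. \<Psi>n n a - a * t) \<longlonglongrightarrow> \<Psi> a - a * t" by (intro tendsto_intros conv)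
    then have "eventually (\<lambda>n. \<Psi>n n a - a * t < - v + e) sequentially"
      by (rule order_tendstoD(2)) (use a e in simp)
    then show ?thesis using low[OF e] eventually_gt_at_top[of 0]
    proof eventually_elim
      case (elim n)
      have "P n \<le> exp (n * (\<Psi>n n a - a * t))" using a elim by (intro chernoff) auto
      then have "ln (P n) \<le> ln (exp (n * (\<Psi>n n a - a * t)))" using elim by (intro ln_mono) auto
      then have "ln (P n) / n \<le> n * (\<Psi>n n a - a * t) / n" by (intro divide_right_mono) auto
      also have "\<dots> = \<Psi>n n a - a * t" using elim by simp
      finally show ?case using elim(1) by linarith
    qed
  qed
  show ?thesis
  proof (rule order_tendstoI)
    fix y assume "y < - v"
    then show "eventually (\<lambda>n. y < ln (P n) / n) sequentially"
      using low[of "- v - y"] by (auto elim!: eventually_mono)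
  next
    fix y assume "- v < y"
    then show "eventually (\<lambda>n. ln (P n) / n < y) sequentially"
      using up[of "y + v"] by (auto elim!: eventually_mono)
  qed
qed

end

section \<open>Cumulant generating functions of bounded laws\<close>

locale bounded_law = prob_space N for N :: "real measure" +
  fixes M :: real
  assumes sets_N [measurable_cong]: "sets N = sets borel"
    and bounds: "AE y in N. 0 \<le> y \<and> y \<le> M" and M: "M > 0"
begin

definition mgf :: "real \<Rightarrow> real" where "mgf s = (\<integral>y. exp (s * y) \<partial>N)"
definition cgf :: "real \<Rightarrow> real" where "cgf s = ln (mgf s)"
definition tilted :: "real \<Rightarrow> real measure" where
  "tilted s = density N (\<lambda>y. ennreal (exp (s * y) / mgf s))"
definition tmean :: "real \<Rightarrow> real" where "tmean s = (\<integral>y. y \<partial>tilted s)"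

lemma exp_bounds: "AE y in N. exp (- (\<bar>s\<bar> * M)) \<le> exp (s * y) \<and> exp (s * y) \<le> exp (\<bar>s\<bar> * M)"
  using bounds
proof eventually_elim
  case (elim y)
  have "\<bar>s * y\<bar> \<le> \<bar>s\<bar> * M" using elim by (simp add: abs_mult mult_left_mono)
  then show ?case by (auto simp: abs_le_iff)
qed

lemma integrable_exp: "integrable N (\<lambda>y. exp (s * y))"
  by (rule integrable_const_bound[of "\<lambda>y. exp (s * y)" "exp (\<bar>s\<bar> * M)"])
    (use exp_bounds[of s] in \<open>auto elim!: eventually_mono\<close>)

lemma mgf_pos: "mgf s > 0"
proof -
  have "exp (- (\<bar>s\<bar> * M)) \<le> mgf s" unfolding mgf_def
    by (rule integral_ge_const[OF integrable_exp]) (use exp_bounds[of s] in \<open>auto elim!: eventually_mono\<close>)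
  then show ?thesis by (meson exp_gt_zero less_le_trans)
qed

lemma mgf_0: "mgf 0 = 1" by (simp add: mgf_def prob_space)
lemma cgf_0: "cgf 0 = 0" by (simp add: cgf_def mgf_0)
lemma exp_cgf: "exp (cgf s) = mgf s" by (simp add: cgf_def mgf_pos)

lemma integral_tilted:
  assumes [measurable]: "f \<in> borel_measurable borel"
  shows "(\<integral>y. f y \<partial>tilted s) = (\<integral>y. exp (s * y) * f y \<partial>N) / mgf s"
  unfolding tilted_def using mgf_pos[of s]
  by (subst integral_density) (auto simp: less_imp_le simp flip: integral_divide_zero)

lemma bounded_law_tilted: "bounded_law (tilted s) M"
proof (intro bounded_law.intro bounded_law_axioms.intro)
  show "prob_space (tilted s)"
  proof
    have "emeasure (tilted s) (space (tilted s)) = (\<integral>\<^sup>+y. ennreal (exp (s * y) / mgf s) \<partial>N)"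
      unfolding tilted_def by (subst emeasure_density) (auto intro!: nn_integral_cong)
    also have "\<dots> = ennreal ((\<integral>y. exp (s * y) / mgf s \<partial>N))"
      using integrable_exp mgf_pos[of s] by (intro nn_integral_eq_integral) auto
    also have "\<dots> = 1" using mgf_pos[of s] by (simp add: mgf_def)
    finally show "emeasure (tilted s) (space (tilted s)) = 1" .
  qed
  show "sets (tilted s) = sets borel" by (simp add: tilted_def sets_N)
  show "AE y in tilted s. 0 \<le> y \<and> y \<le> M"
    unfolding tilted_def using bounds by (subst AE_density) auto
qed (rule M)

lemma interval_bounded: "interval_bounded_random_variable N (\<lambda>y. y) 0 M"
  by unfold_locales (use bounds in auto)

lemma interval_bounded_neg: "interval_bounded_random_variable N (\<lambda>y. - y) (- M) 0"
  by unfold_locales (use bounds in \<open>auto elim!: eventually_mono\<close>)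

lemma integrable_id: "integrable N (\<lambda>y. y)"
  by (rule interval_bounded_random_variable.integrable[OF interval_bounded])

lemma mean_bounds: "0 \<le> (\<integral>y. y \<partial>N)" "(\<integral>y. y \<partial>N) \<le> M"
proof -
  show "0 \<le> (\<integral>y. y \<partial>N)" by (rule integral_ge_const[OF integrable_id]) (use bounds in auto)
  show "(\<integral>y. y \<partial>N) \<le> M" by (rule integral_le_const[OF integrable_id]) (use bounds in auto)
qed

text \<open>Jensen's inequality, by integrating the tangent of the exponential at the mean.\<close>

lemma mgf_ge: "exp (\<eta> * (\<integral>y. y \<partial>N)) \<le> mgf \<eta>"
proof -
  define k where "k = (\<integral>y. y \<partial>N)"
  have "(\<integral>y. exp (\<eta> * k) * (1 + \<eta> * y - \<eta> * k) \<partial>N) \<le> mgf \<eta>"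
    unfolding mgf_def
  proof (rule integral_mono)
    show "integrable N (\<lambda>y. exp (\<eta> * k) * (1 + \<eta> * y - \<eta> * k))"
      using integrable_id by auto
    fix y
    have "exp (\<eta> * k) * (1 + (\<eta> * y - \<eta> * k)) \<le> exp (\<eta> * k) * exp (\<eta> * y - \<eta> * k)"
      by (intro mult_left_mono exp_ge_add_one_self) auto
    then show "exp (\<eta> * k) * (1 + \<eta> * y - \<eta> * k) \<le> exp (\<eta> * y)"
      by (simp add: add_diff_eq flip: exp_add)
  qed (rule integrable_exp)
  also have "(\<integral>y. exp (\<eta> * k) * (1 + \<eta> * y - \<eta> * k) \<partial>N) = exp (\<eta> * k)"
    using integrable_id by (simp add: prob_space k_def[symmetric])
  finally show ?thesis by (simp add: k_def)
qed

text \<open>Hoeffding's lemma, applied to \<open>- y\<close> when \<eta> is negative.\<close>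

lemma mgf_le: "mgf \<eta> \<le> exp (\<eta> * (\<integral>y. y \<partial>N) + \<eta>^2 * M^2 / 8)"
proof -
  define k where "k = (\<integral>y. y \<partial>N)"
  have nn: "(\<integral>\<^sup>+y. ennreal (exp (\<eta> * (y - k))) \<partial>N) \<le> ennreal (exp (\<eta>^2 * M^2 / 8))"
  proof -
    consider "\<eta> > 0" | "\<eta> = 0" | "\<eta> < 0" by linarith
    then show ?thesis
    proof cases
      case 1
      from interval_bounded_random_variable.Hoeffdings_lemma_nn_integral[OF interval_bounded this]
      show ?thesis by (simp add: k_def)
    next
      case 2
      then show ?thesis by (simp add: emeasure_space_1)
    next
      case 3
      then have "- \<eta> > 0" by simp
      from interval_bounded_random_variable.Hoeffdings_lemma_nn_integral[OF interval_bounded_neg this]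
      show ?thesis by (simp add: k_def algebra_simps)
    qed
  qed
  have "(\<integral>y. exp (\<eta> * (y - k)) \<partial>N) \<le> exp (\<eta>^2 * M^2 / 8)"
    by (rule integral_real_bounded[OF _ nn]) simp
  moreover have "(\<integral>y. exp (\<eta> * (y - k)) \<partial>N) = mgf \<eta> * exp (- \<eta> * k)"
    unfolding mgf_def by (simp add: right_diff_distrib exp_diff exp_minus divide_inverse)
  ultimately have "exp (\<eta> * k) * (mgf \<eta> * exp (- \<eta> * k)) \<le> exp (\<eta> * k) * exp (\<eta>^2 * M^2 / 8)"
    by (intro mult_left_mono) auto
  moreover have "exp (\<eta> * k) * (mgf \<eta> * exp (- \<eta> * k)) = mgf \<eta>"
    by (simp add: exp_minus)
  ultimately have "mgf \<eta> \<le> exp (\<eta> * k) * exp (\<eta>^2 * M^2 / 8)" by (simp only:)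
  then show ?thesis by (simp add: k_def[symmetric] exp_add)
qed

end

section \<open>Cumulants through exponential tilting\<close>

context bounded_law
begin

text \<open>Tilted laws satisfy the same locale, so this identity moves bounds around parameter 0 to
  bounds around every \<open>s\<close>.\<close>

lemma mgf_tilted: "bounded_law.mgf (tilted s) \<eta> = mgf (s + \<eta>) / mgf s"
  unfolding bounded_law.mgf_def[OF bounded_law_tilted]
  by (subst integral_tilted) (simp_all add: mgf_def distrib_right exp_add)

lemma cgf_lower: "cgf s + \<eta> * tmean s \<le> cgf (s + \<eta>)"
proof -
  have "exp (\<eta> * tmean s) \<le> mgf (s + \<eta>) / mgf s"
    unfolding mgf_tilted[symmetric] tmean_def by (rule bounded_law.mgf_ge[OF bounded_law_tilted])
  then have "exp (cgf s + \<eta> * tmean s) \<le> exp (cgf (s + \<eta>))"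
    unfolding exp_add exp_cgf using mgf_pos[of s] by (simp add: field_simps)
  then show ?thesis by simp
qed

lemma cgf_upper: "cgf (s + \<eta>) \<le> cgf s + \<eta> * tmean s + \<eta>^2 * M^2 / 8"
proof -
  have "mgf (s + \<eta>) / mgf s \<le> exp (\<eta> * tmean s + \<eta>^2 * M^2 / 8)"
    unfolding mgf_tilted[symmetric] tmean_def by (rule bounded_law.mgf_le[OF bounded_law_tilted])
  then have "exp (cgf (s + \<eta>)) \<le> exp (cgf s + (\<eta> * tmean s + \<eta>^2 * M^2 / 8))"
    unfolding exp_add[of "cgf s"] exp_cgf using mgf_pos[of s] by (simp add: field_simps)
  then show ?thesis unfolding exp_le_cancel_iff by linarith
qed

lemma tmean_bounds: "0 \<le> tmean s" "tmean s \<le> M"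
  unfolding tmean_def by (rule bounded_law.mean_bounds[OF bounded_law_tilted])+

lemma tmean_0: "tmean 0 = (\<integral>y. y \<partial>N)"
  unfolding tmean_def by (subst integral_tilted) (auto simp: mgf_0)

text \<open>In the sum of the quadratic bounds around \<open>s\<close> and around \<open>u\<close>
  the values of \<open>cgf\<close> cancel and only the slopes remain; each bound contributes
  \<open>M^2 / 8\<close>.\<close>

lemma tmean_lipschitz: "\<bar>tmean u - tmean s\<bar> \<le> M^2 / 4 * \<bar>u - s\<bar>"
proof -
  define \<eta> where "\<eta> = u - s"
  have u: "u = s + \<eta>" by (simp add: \<eta>_def)
  have "cgf (u + - \<eta>) \<le> cgf u + (- \<eta>) * tmean u + \<eta>^2 * M^2 / 8" using cgf_upper[of u "- \<eta>"] by simp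
  then have 1: "\<eta> * tmean u \<le> \<eta> * tmean s + \<eta>^2 * M^2 / 4"
    using cgf_upper[of s \<eta>] unfolding u by simp
  have "cgf u + (- \<eta>) * tmean u \<le> cgf (u + - \<eta>)" using cgf_lower[of u "- \<eta>"] by simp
  then have 2: "\<eta> * tmean s \<le> \<eta> * tmean u" using cgf_lower[of s \<eta>] unfolding u by simp
  have "\<bar>\<eta>\<bar> * \<bar>tmean u - tmean s\<bar> = \<bar>\<eta> * tmean u - \<eta> * tmean s\<bar>"
    by (simp add: abs_mult right_diff_distrib[symmetric])
  also have "\<dots> \<le> \<eta>^2 * M^2 / 4" using 1 2 by linarith
  also have "\<dots> = \<bar>\<eta>\<bar> * (M^2 / 4 * \<bar>\<eta>\<bar>)" by (simp add: power2_eq_square)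
  finally show ?thesis by (cases "\<eta> = 0") (auto simp: \<eta>_def)
qed

lemma continuous_tmean: "continuous_on UNIV tmean"
proof (rule lipschitz_on_continuous_on)
  show "(M^2 / 4)-lipschitz_on UNIV tmean"
    using tmean_lipschitz by (intro lipschitz_onI) (auto simp: dist_real_def)
qed

lemma continuous_cgf: "continuous_on UNIV cgf"
proof (rule lipschitz_on_continuous_on)
  have "\<bar>cgf u - cgf s\<bar> \<le> M * \<bar>u - s\<bar>" for u s
  proof -
    have a: "\<bar>(u - s) * tmean r\<bar> \<le> M * \<bar>u - s\<bar>" for r
      using tmean_bounds[of r] by (simp add: abs_mult mult.commute mult_right_mono)
    have "cgf s + (u - s) * tmean s \<le> cgf u" using cgf_lower[of s "u - s"] by simp
    moreover have "cgf u - (u - s) * tmean u \<le> cgf s" using cgf_lower[of u "s - u"] by (simp add: algebra_simps)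
    ultimately show ?thesis using a[of s] a[of u] by linarith
  qed
  then show "M-lipschitz_on UNIV cgf"
    using M by (intro lipschitz_onI) (auto simp: dist_real_def)
qed

text \<open>Discarding the mass below \<open>c\<close> gives an affine minorant of slope
  \<open>c\<close>; it yields both the asymptotic slope and the coercivity.\<close>

lemma cgf_ge_right:
  assumes s: "s \<ge> 0" and p: "prob {c..} > 0"
  shows "s * c + ln (prob {c..}) \<le> cgf s"
proof -
  have m: "{c..} \<in> sets N" by (simp add: sets_N)
  have "exp (s * c) * prob {c..} = (\<integral>y. exp (s * c) * indicator {c..} y \<partial>N)" using m by simp
  also have "\<dots> \<le> mgf s" unfolding mgf_def
  proof (rule integral_mono)
    show "integrable N (\<lambda>y. exp (s * c) * indicator {c..} y)" using m by (intro integrable_mult_right) (simp add: less_top[symmetric])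
    show "exp (s * c) * indicator {c..} y \<le> exp (s * y)" for y using s by (auto simp: indicator_def mult_left_mono)
  qed (rule integrable_exp)
  finally have "exp (s * c + ln (prob {c..})) \<le> exp (cgf s)" using p by (simp add: exp_add exp_cgf)
  then show ?thesis by simp
qed

lemma cgf_ge_left:
  assumes s: "s \<le> 0" and p: "prob {..c} > 0"
  shows "s * c + ln (prob {..c}) \<le> cgf s"
proof -
  have m: "{..c} \<in> sets N" by (simp add: sets_N)
  have "exp (s * c) * prob {..c} = (\<integral>y. exp (s * c) * indicator {..c} y \<partial>N)" using m by simp
  also have "\<dots> \<le> mgf s" unfolding mgf_def
  proof (rule integral_mono)
    show "integrable N (\<lambda>y. exp (s * c) * indicator {..c} y)" using m by (intro integrable_mult_right) (simp add: less_top[symmetric])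
    show "exp (s * c) * indicator {..c} y \<le> exp (s * y)" for y using s by (auto simp: indicator_def mult_left_mono_neg)
  qed (rule integrable_exp)
  finally have "exp (s * c + ln (prob {..c})) \<le> exp (cgf s)" using p by (simp add: exp_add exp_cgf)
  then show ?thesis by simp
qed

text \<open>Mass near \<open>M\<close> pushes the slope up to \<open>M\<close>; the supporting line
  at \<open>s\<close>, read at 0, together with \<open>tmean s \<le> M\<close> keeps it from going
  higher.\<close>

lemma cgf_slope_at_top:
  assumes p: "\<And>c. c < M \<Longrightarrow> prob {c..} > 0"
  shows "((\<lambda>s. cgf s / s) \<longlongrightarrow> M) at_top"
proof (rule order_tendstoI)
  fix y assume y: "y < M"
  define c where "c = (y + M) / 2"
  have c: "y < c" "c < M" using y by (auto simp: c_def)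
  have "((\<lambda>s. c + ln (prob {c..}) / s) \<longlongrightarrow> c + 0) at_top"
    by (intro tendsto_add tendsto_const tendsto_divide_0[OF tendsto_const] filterlim_at_top_imp_at_infinity filterlim_ident)
  then have "eventually (\<lambda>s. c + ln (prob {c..}) / s > y) at_top" by (rule order_tendstoD) (use c in simp)
  then show "eventually (\<lambda>s. y < cgf s / s) at_top" using eventually_gt_at_top[of 0]
  proof eventually_elim
    case (elim s)
    have "(s * c + ln (prob {c..})) / s \<le> cgf s / s"
      using elim by (intro divide_right_mono cgf_ge_right p c) auto
    then show ?case using elim by (simp add: add_divide_distrib)
  qed
next
  fix y assume y: "M < y"
  show "eventually (\<lambda>s. cgf s / s < y) at_top" using eventually_gt_at_top[of 0]
  proof eventually_elim
    case (elim s)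
    have "cgf s \<le> s * tmean s" using cgf_lower[of s "- s"] by (simp add: cgf_0)
    also have "\<dots> \<le> s * M" using tmean_bounds elim by (intro mult_left_mono) auto
    finally have "cgf s / s \<le> M" using elim by (simp add: field_simps)
    then show ?case using y by simp
  qed
qed

lemma cgf_slope_at_bot:
  assumes p: "\<And>c. 0 < c \<Longrightarrow> prob {..c} > 0"
  shows "((\<lambda>s. cgf s / s) \<longlongrightarrow> 0) at_bot"
proof (rule order_tendstoI)
  fix y :: real assume y: "0 < y"
  define c where "c = y / 2"
  have c: "0 < c" "c < y" using y by (auto simp: c_def)
  have "((\<lambda>s. c + ln (prob {..c}) / s) \<longlongrightarrow> c + 0) at_bot"
    by (intro tendsto_add tendsto_const tendsto_divide_0[OF tendsto_const] filterlim_at_bot_imp_at_infinity filterlim_ident)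
  then have "eventually (\<lambda>s. c + ln (prob {..c}) / s < y) at_bot" by (rule order_tendstoD) (use c in simp)
  then show "eventually (\<lambda>s. cgf s / s < y) at_bot" using eventually_gt_at_bot[of 0]
  proof eventually_elim
    case (elim s)
    have "cgf s / s \<le> (s * c + ln (prob {..c})) / s"
      using elim by (intro divide_right_mono_neg cgf_ge_left p c) auto
    then show ?case using elim by (simp add: add_divide_distrib)
  qed
next
  fix y :: real assume y: "y < 0"
  show "eventually (\<lambda>s. y < cgf s / s) at_bot" using eventually_gt_at_bot[of 0]
  proof eventually_elim
    case (elim s)
    have "cgf s \<le> s * tmean s" using cgf_lower[of s "- s"] by (simp add: cgf_0)
    also have "\<dots> \<le> 0" using tmean_bounds elim by (intro mult_nonpos_nonneg) auto
    finally have "0 \<le> cgf s / s" using elim by (simp add: divide_nonpos_neg)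
    then show ?case using y by simp
  qed
qed

end

section \<open>Weighted sums of independent copies\<close>

context bounded_law
begin

definition lower_prob :: "nat \<Rightarrow> (nat \<Rightarrow> real) \<Rightarrow> real \<Rightarrow> real" where
  "lower_prob n a t = measure (PiM {..<n} (\<lambda>_. N)) {y \<in> space (PiM {..<n} (\<lambda>_. N)). (\<Sum>i<n. a i * y i) \<le> n * t}"

definition mean_cgf :: "nat \<Rightarrow> (nat \<Rightarrow> real) \<Rightarrow> real \<Rightarrow> real" where
  "mean_cgf n a \<alpha> = (\<Sum>i<n. cgf (\<alpha> * a i)) / n"

lemma weighted_sum_measurable [measurable]:
  "(\<lambda>y. \<Sum>i<n. a i * y i) \<in> borel_measurable (PiM {..<n} (\<lambda>_. N))"
proof -
  have [measurable]: "(\<lambda>y. y i) \<in> borel_measurable (PiM {..<n} (\<lambda>_. N))" if "i < n" for i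
    using measurable_component_singleton[of i "{..<n}" "\<lambda>_. N"] that
      measurable_cong_sets[OF refl sets_N] by blast
  show ?thesis by measurable
qed

lemma exp_weighted_sum:
  assumes n: "n > 0"
  shows "integrable (PiM {..<n} (\<lambda>_. N)) (\<lambda>y. exp (\<alpha> * (\<Sum>i<n. a i * y i)))"
    "(\<integral>y. exp (\<alpha> * (\<Sum>i<n. a i * y i)) \<partial>PiM {..<n} (\<lambda>_. N)) = exp (n * mean_cgf n a \<alpha>)"
proof -
  interpret product_sigma_finite "\<lambda>_::nat. N" by standard
  have e: "exp (\<alpha> * (\<Sum>i<n. a i * y i)) = (\<Prod>i<n. exp ((\<alpha> * a i) * y i))" for y :: "nat \<Rightarrow> real"
    by (simp add: sum_distrib_left exp_sum mult.assoc)
  show "integrable (PiM {..<n} (\<lambda>_. N)) (\<lambda>y. exp (\<alpha> * (\<Sum>i<n. a i * y i)))"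
    unfolding e by (intro product_integrable_prod integrable_exp) auto
  have "(\<integral>y. exp (\<alpha> * (\<Sum>i<n. a i * y i)) \<partial>PiM {..<n} (\<lambda>_. N)) = (\<Prod>i<n. mgf (\<alpha> * a i))"
    unfolding e mgf_def by (intro product_integral_prod integrable_exp) auto
  also have "\<dots> = exp (n * mean_cgf n a \<alpha>)"
    using n by (simp add: mean_cgf_def exp_sum exp_cgf)
  finally show "(\<integral>y. exp (\<alpha> * (\<Sum>i<n. a i * y i)) \<partial>PiM {..<n} (\<lambda>_. N)) = exp (n * mean_cgf n a \<alpha>)" .
qed

lemma lower_prob_chernoff:
  assumes n: "n > 0" and \<alpha>: "\<alpha> \<le> 0"
  shows "lower_prob n a t \<le> exp (n * (mean_cgf n a \<alpha> - \<alpha> * t))"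
proof -
  interpret P: prob_space "PiM {..<n} (\<lambda>_. N)" by (intro prob_space_PiM prob_space_axioms)
  let ?P = "PiM {..<n} (\<lambda>_. N)"
  let ?S = "\<lambda>y. \<Sum>i<n. a i * y i"
  let ?A = "{y \<in> space ?P. ?S y \<le> n * t}"
  have A: "?A \<in> sets ?P" by measurable
  have "lower_prob n a t = (\<integral>y. indicator ?A y \<partial>?P)" using A by (simp add: lower_prob_def)
  also have "\<dots> \<le> (\<integral>y. exp (- \<alpha> * (n * t)) * exp (\<alpha> * ?S y) \<partial>?P)"
  proof (rule integral_mono)
    show "integrable ?P (indicator ?A :: _ \<Rightarrow> real)" using A by (simp add: less_top[symmetric])
    show "integrable ?P (\<lambda>y. exp (- \<alpha> * (n * t)) * exp (\<alpha> * ?S y))"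
      by (intro integrable_mult_right exp_weighted_sum n)
    show "indicator ?A y \<le> exp (- \<alpha> * (n * t)) * exp (\<alpha> * ?S y)" for y
      using \<alpha> by (auto simp: indicator_def mult_left_mono_neg simp flip: exp_add)
  qed
  also have "\<dots> = exp (n * (mean_cgf n a \<alpha> - \<alpha> * t))"
    unfolding integral_mult_right_zero exp_weighted_sum(2)[OF n]
    by (simp add: algebra_simps flip: exp_add)
  finally show ?thesis .
qed

text \<open>The change of measure without the changed measure: off the window \<open>n u < S \<le> n t\<close> the
  exponential is dominated by one with a shifted parameter.\<close>

lemma lower_prob_tilt:
  assumes n: "n > 0" and \<alpha>: "\<alpha> \<le> 0" and \<eta>: "\<eta> \<ge> 0"
  shows "exp (n * mean_cgf n a \<alpha>) \<le> exp (n * (\<alpha> * u)) * lower_prob n a t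
    + exp (n * (mean_cgf n a (\<alpha> + \<eta>) - \<eta> * t)) + exp (n * (mean_cgf n a (\<alpha> - \<eta>) + \<eta> * u))"
proof -
  interpret P: prob_space "PiM {..<n} (\<lambda>_. N)" by (intro prob_space_PiM prob_space_axioms)
  let ?P = "PiM {..<n} (\<lambda>_. N)"
  let ?S = "\<lambda>y. \<Sum>i<n. a i * y i"
  let ?A = "{y \<in> space ?P. ?S y \<le> n * t}"
  have A: "?A \<in> sets ?P" by measurable
  have iA: "integrable ?P (indicator ?A :: _ \<Rightarrow> real)" using A by (simp add: less_top[symmetric])
  note ie = exp_weighted_sum(1)[OF n]
  have "exp (n * mean_cgf n a \<alpha>) = (\<integral>y. exp (\<alpha> * ?S y) \<partial>?P)" by (rule exp_weighted_sum(2)[OF n, symmetric])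
  also have "\<dots> \<le> (\<integral>y. exp (\<alpha> * (n * u)) * indicator ?A y + exp (- \<eta> * (n * t)) * exp ((\<alpha> + \<eta>) * ?S y)
      + exp (\<eta> * (n * u)) * exp ((\<alpha> - \<eta>) * ?S y) \<partial>?P)"
  proof (rule integral_mono)
    show "integrable ?P (\<lambda>y. exp (\<alpha> * (n * u)) * indicator ?A y + exp (- \<eta> * (n * t)) * exp ((\<alpha> + \<eta>) * ?S y)
      + exp (\<eta> * (n * u)) * exp ((\<alpha> - \<eta>) * ?S y))"
      by (intro Bochner_Integration.integrable_add Bochner_Integration.integrable_mult_right iA ie)
    fix y assume y: "y \<in> space ?P"
    \<comment> \<open>Below the window the shift to \<open>\<alpha> - \<eta>\<close> dominates,
      above it the shift to \<open>\<alpha> + \<eta>\<close>; inside,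
      \<open>\<alpha> \<le> 0\<close> bounds the exponential by its value at the lower end.\<close>
    consider "?S y \<le> n * u" | "?S y > n * u" "?S y \<le> n * t" | "?S y > n * t" by linarith
    then show "exp (\<alpha> * ?S y) \<le> exp (\<alpha> * (n * u)) * indicator ?A y + exp (- \<eta> * (n * t)) * exp ((\<alpha> + \<eta>) * ?S y)
      + exp (\<eta> * (n * u)) * exp ((\<alpha> - \<eta>) * ?S y)"
    proof cases
      case 1
      have "\<eta> * ?S y \<le> \<eta> * (n * u)" using 1 \<eta> by (intro mult_left_mono)
      then have "exp (\<alpha> * ?S y) \<le> exp (\<eta> * (n * u) + (\<alpha> - \<eta>) * ?S y)" by (simp add: left_diff_distrib)
      then show ?thesis by (simp add: exp_add add_increasing)
    next
      case 2
      have "\<alpha> * ?S y \<le> \<alpha> * (n * u)" using 2 \<alpha> by (intro mult_left_mono_neg) auto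
      then have "exp (\<alpha> * ?S y) \<le> exp (\<alpha> * (n * u)) * indicator ?A y" using 2 y by simp
      then show ?thesis by (intro order_trans[OF _ add_increasing2[OF _ add_increasing2[OF _ order_refl]]]) auto
    next
      case 3
      have "\<eta> * (n * t) \<le> \<eta> * ?S y" using 3 \<eta> by (intro mult_left_mono) auto
      then have "exp (\<alpha> * ?S y) \<le> exp (- \<eta> * (n * t) + (\<alpha> + \<eta>) * ?S y)" by (simp add: distrib_right)
      then have "exp (\<alpha> * ?S y) \<le> exp (- \<eta> * (n * t)) * exp ((\<alpha> + \<eta>) * ?S y)" by (simp only: exp_add)
      then show ?thesis by (intro order_trans[OF _ add_increasing2[OF _ add_increasing[OF _ order_refl]]]) auto
    qed
  qed (rule ie)
  also have "\<dots> = exp (\<alpha> * (n * u)) * (\<integral>y. indicator ?A y \<partial>?P) + exp (- \<eta> * (n * t)) * (\<integral>y. exp ((\<alpha> + \<eta>) * ?S y) \<partial>?P)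
      + exp (\<eta> * (n * u)) * (\<integral>y. exp ((\<alpha> - \<eta>) * ?S y) \<partial>?P)"
    by (subst Bochner_Integration.integral_add, (intro Bochner_Integration.integrable_add Bochner_Integration.integrable_mult_right iA ie)+)+
      (simp only: integral_mult_right_zero)
  also have "(\<integral>y. indicator ?A y \<partial>?P) = lower_prob n a t" using A by (simp add: lower_prob_def)
  finally show ?thesis unfolding exp_weighted_sum(2)[OF n]
    by (simp add: algebra_simps flip: exp_add)
qed

end

section \<open>The exponential law conditioned to a bounded interval\<close>

lemma Y_dist_interval:
  assumes M: "M > 0" and uv: "0 \<le> u" "u < v" "v \<le> M"
  shows "emeasure (Y_dist M) {u..v} > 0"
proof -
  have M1: "1 - exp (- M) > 0" using M by simp
  have "ennreal (exp (- M) * (v - u)) = (\<integral>\<^sup>+y. ennreal (exp (- M)) * indicator {u..v} y \<partial>lborel)"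
    using uv by (subst nn_integral_cmult_indicator) (auto simp: ennreal_mult)
  also have "\<dots> \<le> (\<integral>\<^sup>+y. ennreal (indicator {0..M} y * exp (- y) / (1 - exp (- M))) * indicator {u..v} y \<partial>lborel)"
  proof (rule nn_integral_mono)
    fix y
    have "exp (- M) \<le> indicator {0..M} y * exp (- y) / (1 - exp (- M))" if "y \<in> {u..v}"
    proof -
      have "exp (- M) * (1 - exp (- M)) \<le> exp (- M) * 1" by (intro mult_left_mono) auto
      also have "\<dots> \<le> exp (- y)" using that uv by simp
      finally show ?thesis using that uv M1 by (simp add: field_simps)
    qed
    then show "ennreal (exp (- M)) * indicator {u..v} y \<le> ennreal (indicator {0..M} y * exp (- y) / (1 - exp (- M))) * indicator {u..v} y"
      by (auto simp: indicator_def intro!: ennreal_leI)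
  qed
  also have "\<dots> = emeasure (Y_dist M) {u..v}"
    unfolding Y_dist_def by (subst emeasure_density) auto
  finally show ?thesis using uv by (simp add: ennreal_zero_less_mult_iff less_le_trans[rotated])
qed

text \<open>Evaluation by an antiderivative against the weight \<open>exp (- y)\<close>, meant for
  the total mass and the mean.\<close>

lemma Y_dist_integral:
  assumes M: "M > 0" and F: "\<And>y. (F has_real_derivative f y * exp (- y)) (at y)"
    and f: "continuous_on UNIV f" "\<And>y. y \<ge> 0 \<Longrightarrow> f y \<ge> 0"
  shows "(\<integral>\<^sup>+y. ennreal (f y) \<partial>Y_dist M) = ennreal ((F M - F 0) / (1 - exp (- M)))"
proof -
  have M1: "1 - exp (- M) > 0" using M by simp
  have [measurable]: "f \<in> borel_measurable borel" by (rule borel_measurable_continuous_onI[OF f(1)])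
  have "(\<integral>\<^sup>+y. ennreal (f y) \<partial>Y_dist M)
     = (\<integral>\<^sup>+y. ennreal (indicator {0..M} y * exp (- y) / (1 - exp (- M))) * ennreal (f y) \<partial>lborel)"
    unfolding Y_dist_def by (subst nn_integral_density) auto
  also have "\<dots> = (\<integral>\<^sup>+y. ennreal (f y * exp (- y) / (1 - exp (- M))) * indicator {0..M} y \<partial>lborel)"
    using M1 f(2) by (intro nn_integral_cong) (auto simp: indicator_def mult.commute simp flip: ennreal_mult')
  also have "\<dots> = ennreal (F M / (1 - exp (- M)) - F 0 / (1 - exp (- M)))"
    using M M1 f(2) by (intro nn_integral_FTC_Icc) (auto intro!: DERIV_cdivide F)
  finally show ?thesis by (simp add: diff_divide_distrib)
qed

lemma bounded_law_Y_dist: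
  assumes M: "M > 0"
  shows "bounded_law (Y_dist M) M"
proof (intro bounded_law.intro bounded_law_axioms.intro)
  show "prob_space (Y_dist M)"
  proof
    have "emeasure (Y_dist M) (space (Y_dist M)) = (\<integral>\<^sup>+y. ennreal 1 \<partial>Y_dist M)" by simp
    also have "\<dots> = ennreal ((- exp (- M) - - exp (- 0)) / (1 - exp (- M)))"
      by (rule Y_dist_integral[OF M]) (auto intro!: derivative_eq_intros)
    also have "\<dots> = 1" using M by simp
    finally show "emeasure (Y_dist M) (space (Y_dist M)) = 1" .
  qed
  show "AE y in Y_dist M. 0 \<le> y \<and> y \<le> M"
    unfolding Y_dist_def by (subst AE_density) (auto simp: indicator_def)
qed (use M in \<open>auto simp: Y_dist_def\<close>)

lemma Y_dist_mean:
  assumes M: "M > 0"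
  shows "(\<integral>y. y \<partial>Y_dist M) = (1 - (M + 1) * exp (- M)) / (1 - exp (- M))"
proof -
  interpret bounded_law "Y_dist M" M by (rule bounded_law_Y_dist[OF M])
  have "(\<integral>\<^sup>+y. ennreal y \<partial>Y_dist M) = ennreal ((- (M + 1) * exp (- M) - - (0 + 1) * exp (- 0)) / (1 - exp (- M)))"
    by (rule Y_dist_integral[OF M]) (auto intro!: derivative_eq_intros simp: algebra_simps)
  moreover have "(\<integral>\<^sup>+y. ennreal y \<partial>Y_dist M) = ennreal (\<integral>y. y \<partial>Y_dist M)"
    by (rule nn_integral_eq_integral[OF integrable_id]) (use bounds in auto)
  moreover have "0 \<le> 1 - (M + 1) * exp (- M)"
  proof -
    have "(M + 1) * exp (- M) \<le> exp M * exp (- M)" using exp_ge_add_one_self[of M] by (intro mult_right_mono) (auto simp: add.commute)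
    then show ?thesis by (simp flip: exp_add)
  qed
  ultimately show ?thesis using mean_bounds(1) M
    by (simp add: algebra_simps)
qed

text \<open>The truncated mean is a factor of the slope at 0, so this limit decides on which side of
  that slope the level \<open>t\<close> lies once \<open>M\<close> is large.\<close>

lemma Y_dist_mean_limit: "((\<lambda>M. \<integral>y. y \<partial>Y_dist M) \<longlongrightarrow> 1) at_top"
proof -
  have "((\<lambda>M::real. (1 - (M + 1) * exp (- M)) / (1 - exp (- M))) \<longlongrightarrow> 1) at_top" by real_asymp
  moreover have "eventually (\<lambda>M. (1 - (M + 1) * exp (- M)) / (1 - exp (- M)) = (\<integral>y. y \<partial>Y_dist M)) at_top"
    using eventually_gt_at_top[of 0] by eventually_elim (simp add: Y_dist_mean)
  ultimately show ?thesis by (rule Lim_transform_eventually)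
qed

lemma Y_dist_prob_right:
  assumes "M > 0" "c < M"
  shows "measure (Y_dist M) {c..} > 0"
proof -
  interpret bounded_law "Y_dist M" M by (rule bounded_law_Y_dist[OF assms(1)])
  have "0 < prob {max 0 c..M}" using Y_dist_interval[of M "max 0 c" M] assms by (simp add: emeasure_eq_measure)
  also have "\<dots> \<le> prob {c..}" by (intro finite_measure_mono) (auto simp: sets_N)
  finally show ?thesis .
qed

lemma Y_dist_prob_left:
  assumes "M > 0" "0 < c"
  shows "measure (Y_dist M) {..c} > 0"
proof -
  interpret bounded_law "Y_dist M" M by (rule bounded_law_Y_dist[OF assms(1)])
  have "0 < prob {0..min c M}" using Y_dist_interval[of M 0 "min c M"] assms by (simp add: emeasure_eq_measure)
  also have "\<dots> \<le> prob {..c}" by (intro finite_measure_mono) (auto simp: sets_N)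
  finally show ?thesis .
qed

section \<open>Tail asymptotics conditional on the spectrum\<close>

context bounded_law
begin

text \<open>Provides the growth hypothesis of \<open>empirical_convergence\<close>. The limit is
  \<open>\<gamma> M\<close> for positive \<gamma> and 0 otherwise, as the law reaches down to 0 and
  up to \<open>M\<close>.\<close>

lemma cgf_slope_limit:
  assumes p: "\<And>c. c < M \<Longrightarrow> prob {c..} > 0" and q: "\<And>c. 0 < c \<Longrightarrow> prob {..c} > 0"
  shows "\<exists>L. ((\<lambda>l. cgf (\<gamma> * (l - x)) / (1 + l)) \<longlongrightarrow> L) at_top"
proof -
  have r: "((\<lambda>l::real. (l - x) / (1 + l)) \<longlongrightarrow> 1) at_top" by real_asymp
  consider "\<gamma> = 0" | "\<gamma> > 0" | "\<gamma> < 0" by linarith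
  then show ?thesis
  proof cases
    case 1
    then show ?thesis by (auto simp: cgf_0)
  next
    case 2
    have "filterlim (\<lambda>l. \<gamma> * (l - x)) at_top at_top" using 2 by real_asymp
    from tendsto_mult[OF filterlim_compose[OF cgf_slope_at_top[OF p] this] tendsto_mult_left[OF r, of \<gamma>]]
    have "((\<lambda>l. cgf (\<gamma> * (l - x)) / (\<gamma> * (l - x)) * (\<gamma> * ((l - x) / (1 + l)))) \<longlongrightarrow> M * (\<gamma> * 1)) at_top" .
    moreover have "eventually (\<lambda>l. cgf (\<gamma> * (l - x)) / (\<gamma> * (l - x)) * (\<gamma> * ((l - x) / (1 + l))) = cgf (\<gamma> * (l - x)) / (1 + l)) at_top"
      using eventually_gt_at_top[of x] by eventually_elim (use 2 in auto)
    ultimately show ?thesis by (blast intro: Lim_transform_eventually)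
  next
    case 3
    have "filterlim (\<lambda>l. \<gamma> * (l - x)) at_bot at_top" using 3 by real_asymp
    from tendsto_mult[OF filterlim_compose[OF cgf_slope_at_bot[OF q] this] tendsto_mult_left[OF r, of \<gamma>]]
    have "((\<lambda>l. cgf (\<gamma> * (l - x)) / (\<gamma> * (l - x)) * (\<gamma> * ((l - x) / (1 + l)))) \<longlongrightarrow> 0 * (\<gamma> * 1)) at_top" .
    moreover have "eventually (\<lambda>l. cgf (\<gamma> * (l - x)) / (\<gamma> * (l - x)) * (\<gamma> * ((l - x) / (1 + l))) = cgf (\<gamma> * (l - x)) / (1 + l)) at_top"
      using eventually_gt_at_top[of x] by eventually_elim (use 3 in auto)
    ultimately show ?thesis by (blast intro: Lim_transform_eventually)
  qed
qed

section \<open>The limiting cumulant generating function\<close>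

context
  fixes \<beta> :: real and a :: "real \<Rightarrow> real"
  assumes b: "\<beta> > 0" and a: "continuous_on UNIV a"
begin

definition limit_cgf :: "real \<Rightarrow> real" where
  "limit_cgf \<alpha> = mp_integral \<beta> (\<lambda>l. cgf (\<alpha> * a l))"

definition limit_slope :: "real \<Rightarrow> real" where
  "limit_slope \<alpha> = mp_integral \<beta> (\<lambda>l. a l * tmean (\<alpha> * a l))"

lemma cont_cgf: "continuous_on UNIV (\<lambda>l. cgf (\<alpha> * a l))"
  by (rule continuous_on_compose2[OF continuous_cgf]) (auto intro!: continuous_intros a)

lemma cont_slope: "continuous_on UNIV (\<lambda>l. a l * tmean (\<alpha> * a l))"
  by (intro continuous_on_mult a continuous_on_compose2[OF continuous_tmean]) (auto intro!: continuous_intros a)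

text \<open>The bounds \<open>cgf_lower\<close> and \<open>cgf_upper\<close> hold at each eigenvalue
  with step \<open>\<eta> a l\<close>; integrating them over the limit law gives both inequalities
  and the constant.\<close>

lemma smooth_convex_limit_cgf:
  "smooth_convex limit_cgf limit_slope (M^2 / 8 * mp_integral \<beta> (\<lambda>l. a l ^ 2))"
proof
  have ok: "mp_ok \<beta> (\<lambda>l. cgf (\<alpha> * a l))" "mp_ok \<beta> (\<lambda>l. a l * tmean (\<alpha> * a l))"
    "mp_ok \<beta> (\<lambda>l. a l ^ 2)" for \<alpha>
    using cont_cgf[of \<alpha>] cont_slope[of \<alpha>] continuous_on_power[OF a] by (simp_all add: mp_ok_cont)
  note lin = mp_integral_linear[OF b] and oklin = mp_ok_linear
  have "0 \<le> mp_integral \<beta> (\<lambda>l. a l ^ 2)"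
    using mp_integral_mono[OF b, of "\<lambda>_. 0" "\<lambda>l. a l ^ 2"] ok(3) mp_integral_const[OF b, of 0]
    by (simp add: mp_ok_cont)
  then show "0 \<le> M^2 / 8 * mp_integral \<beta> (\<lambda>l. a l ^ 2)" by simp
  show "limit_cgf 0 = 0" using mp_integral_const[OF b, of 0] by (simp add: limit_cgf_def cgf_0)
  fix \<alpha> \<eta>
  have e: "(\<alpha> + \<eta>) * a l = \<alpha> * a l + \<eta> * a l" for l by (simp add: distrib_right)
  have 1: "mp_integral \<beta> (\<lambda>l. 1 * cgf (\<alpha> * a l) + \<eta> * (a l * tmean (\<alpha> * a l))) = limit_cgf \<alpha> + \<eta> * limit_slope \<alpha>"
    by (subst lin[OF ok(1,2)]) (simp add: limit_cgf_def limit_slope_def)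
  have 2: "mp_integral \<beta> (\<lambda>l. 1 * (1 * cgf (\<alpha> * a l) + \<eta> * (a l * tmean (\<alpha> * a l))) + (M^2 / 8 * \<eta>^2) * a l ^ 2)
     = limit_cgf \<alpha> + \<eta> * limit_slope \<alpha> + M^2 / 8 * mp_integral \<beta> (\<lambda>l. a l ^ 2) * \<eta>^2"
    by (subst lin[OF oklin[OF ok(1,2)] ok(3)]) (simp add: 1[simplified])
  show "limit_cgf \<alpha> + \<eta> * limit_slope \<alpha> \<le> limit_cgf (\<alpha> + \<eta>)"
    unfolding 1[symmetric] unfolding limit_cgf_def[of "\<alpha> + \<eta>"] e
  proof (rule mp_integral_mono[OF b oklin[OF ok(1,2)]])
    show "mp_ok \<beta> (\<lambda>l. cgf (\<alpha> * a l + \<eta> * a l))" using ok(1)[of "\<alpha> + \<eta>"] by (simp add: e)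
    show "1 * cgf (\<alpha> * a l) + \<eta> * (a l * tmean (\<alpha> * a l)) \<le> cgf (\<alpha> * a l + \<eta> * a l)" for l
      using cgf_lower[of "\<alpha> * a l" "\<eta> * a l"] by (simp add: mult.assoc)
  qed
  show "limit_cgf (\<alpha> + \<eta>) \<le> limit_cgf \<alpha> + \<eta> * limit_slope \<alpha> + M^2 / 8 * mp_integral \<beta> (\<lambda>l. a l ^ 2) * \<eta>^2"
    unfolding 2[symmetric] unfolding limit_cgf_def[of "\<alpha> + \<eta>"] e
  proof (rule mp_integral_mono[OF b _ oklin[OF oklin[OF ok(1,2)] ok(3)]])
    show "mp_ok \<beta> (\<lambda>l. cgf (\<alpha> * a l + \<eta> * a l))" using ok(1)[of "\<alpha> + \<eta>"] by (simp add: e)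
    show "cgf (\<alpha> * a l + \<eta> * a l) \<le> 1 * (1 * cgf (\<alpha> * a l) + \<eta> * (a l * tmean (\<alpha> * a l))) + (M^2 / 8 * \<eta>^2) * a l ^ 2" for l
      using cgf_upper[of "\<alpha> * a l" "\<eta> * a l"] by (simp add: mult.assoc power_mult_distrib mult_ac)
  qed
qed

lemma limit_slope_0: "limit_slope 0 = (\<integral>y. y \<partial>N) * mp_integral \<beta> a"
proof -
  have "mp_integral \<beta> (\<lambda>l. (\<integral>y. y \<partial>N) * a l + 0 * 1) = (\<integral>y. y \<partial>N) * mp_integral \<beta> a + 0 * mp_integral \<beta> (\<lambda>_. 1)"
    by (rule mp_integral_linear[OF b]) (auto intro!: mp_ok_cont a)
  then show ?thesis by (simp add: limit_slope_def tmean_0 mult.commute)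
qed

text \<open>At parameter \<open>- K\<close> the places with \<open>a l < 0\<close> contribute growth
  at rate \<open>M / 2\<close>, the others a loss at rate at most 1. As the limit law charges the
  places where \<open>a\<close> is negative, a large \<open>M\<close> lets the gain win.\<close>

lemma limit_cgf_coercive:
  assumes M2: "M \<ge> 2" and neg: "mp_integral \<beta> (\<lambda>l. max 0 (- a l)) > 0"
    and big: "M * mp_integral \<beta> (\<lambda>l. max 0 (- a l)) \<ge> 2 * (mp_integral \<beta> (\<lambda>l. max 0 (a l)) + 1 - t)"
    and p: "prob {M / 2..} > 0" and q: "prob {..1} > 0"
  shows "\<exists>K>0. limit_cgf (- K) + K * t > 0"
proof -
  define A where "A = mp_integral \<beta> (\<lambda>l. max 0 (- a l))"
  define B where "B = mp_integral \<beta> (\<lambda>l. max 0 (a l))"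
  define c where "c = ln (prob {M / 2..}) + ln (prob {..1})"
  have logs: "ln (prob {M / 2..}) \<le> 0" "ln (prob {..1}) \<le> 0" using p q by auto
  \<comment> \<open>The logarithms of the two probabilities cost \<open>c\<close>, independent of
    \<open>K\<close>; with \<open>K = 1 - c\<close> the linear gain, at least \<open>K\<close>,
    exceeds this cost by 1.\<close>
  define K where "K = 1 - c"
  have K: "K > 0" "K \<ge> 1" using logs by (auto simp: K_def c_def)
  have ok: "mp_ok \<beta> (\<lambda>l. max 0 (- a l))" "mp_ok \<beta> (\<lambda>l. max 0 (a l))" "mp_ok \<beta> (\<lambda>_. 1)"
    using a by (auto intro!: mp_ok_cont continuous_intros)
  let ?g = "\<lambda>l. 1 * ((K * (M / 2)) * max 0 (- a l) + (- K) * max 0 (a l)) + c * 1"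
  have "mp_integral \<beta> ?g \<le> limit_cgf (- K)"
    unfolding limit_cgf_def
  proof (rule mp_integral_mono[OF b])
    show "mp_ok \<beta> ?g" by (intro mp_ok_linear ok)
    show "mp_ok \<beta> (\<lambda>l. cgf (- K * a l))" by (intro mp_ok_cont cont_cgf)
    fix l
    show "?g l \<le> cgf (- K * a l)"
    proof (cases "a l < 0")
      case True
      then have "(- K * a l) * (M / 2) + ln (prob {M / 2..}) \<le> cgf (- K * a l)"
        using K p by (intro cgf_ge_right) (auto simp: mult_nonneg_nonpos)
      then show ?thesis using True logs by (simp add: c_def mult_ac)
    next
      case False
      then have "(- K * a l) * 1 + ln (prob {..1}) \<le> cgf (- K * a l)"
        using K q by (intro cgf_ge_left) auto
      then show ?thesis using False logs by (simp add: c_def mult_ac)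
    qed
  qed
  also have "mp_integral \<beta> ?g = K * (M / 2) * A - K * B + c"
    using mp_integral_linear[OF b mp_ok_linear[OF ok(1,2)] ok(3), of 1 "K * (M / 2)" "- K" c]
      mp_integral_linear[OF b ok(1,2), of "K * (M / 2)" "- K"] mp_integral_one[OF b]
    by (simp add: A_def B_def)
  finally have "K * (M / 2 * A - B + t) + c \<le> limit_cgf (- K) + K * t" by (simp add: algebra_simps)
  moreover have "K * 1 \<le> K * (M / 2 * A - B + t)"
    using big K by (intro mult_left_mono) (auto simp: A_def B_def)
  ultimately have "1 \<le> limit_cgf (- K) + K * t" by (simp add: K_def)
  then show ?thesis using K by (intro exI[of _ K]) auto
qed

end

end

text \<open>All that is used about the random spectrum is condensed here. Neither \<open>M\<close>
  nor \<open>t\<close> occurs, so one null set serves all of them.\<close>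

definition mp_sequence :: "real \<Rightarrow> (nat \<Rightarrow> real list) \<Rightarrow> bool" where
  "mp_sequence \<beta> ls \<longleftrightarrow> (\<forall>n. length (ls n) = n) \<and> (\<forall>n. \<forall>l\<in>set (ls n). l \<ge> 0) \<and>
     (\<forall>s\<in>{0<..} \<inter> \<rat>. (\<lambda>n. (\<Sum>l\<leftarrow>ls n. 1 / (l + s)) / n) \<longlonglongrightarrow> mp_integral \<beta> (\<lambda>l. 1 / (l + s))) \<and>
     (\<lambda>n. (\<Sum>l\<leftarrow>ls n. l) / n) \<longlonglongrightarrow> 1"

text \<open>The sign \<open>\<sigma>\<close> lets one statement cover both tails: \<open>\<sigma> = -1\<close> and \<open>-t\<close> give the upper one.\<close>

definition tail_rate :: "real \<Rightarrow> real \<Rightarrow> real \<Rightarrow> real \<Rightarrow> real \<Rightarrow> real \<Rightarrow> bool" where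
  "tail_rate \<beta> x M \<sigma> t v \<longleftrightarrow>
     (SUP \<alpha>. ereal (\<alpha> * t - psi \<beta> x M (\<alpha> * \<sigma>))) = ereal v \<and>
     (SUP \<alpha>\<in>{..<0}. ereal (\<alpha> * t - psi \<beta> x M (\<alpha> * \<sigma>))) = ereal v \<and>
     (\<forall>ls. mp_sequence \<beta> ls \<longrightarrow>
       (\<lambda>n. ln (bounded_law.lower_prob (Y_dist M) n (\<lambda>i. \<sigma> * (ls n ! i - x)) t) / n) \<longlonglongrightarrow> - v)"

lemma lower_tail_theorem:
  fixes \<sigma> x t \<beta> :: real
  assumes b: "\<beta> > 0" and s: "\<sigma> \<noteq> 0"
    and neg: "mp_integral \<beta> (\<lambda>l. max 0 (- (\<sigma> * (l - x)))) > 0" and t: "t < \<sigma> * (1 - x)"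
  shows "\<exists>M0>0. \<forall>M\<ge>M0. \<exists>v.
     tail_rate \<beta> x M \<sigma> t v"
proof -
  let ?a = "\<lambda>l. \<sigma> * (l - x)"
  define A where "A = mp_integral \<beta> (\<lambda>l. max 0 (- ?a l))"
  define B where "B = mp_integral \<beta> (\<lambda>l. max 0 (?a l))"
  have a: "continuous_on UNIV ?a" by (intro continuous_intros)
  have int_a: "mp_integral \<beta> ?a = \<sigma> * (1 - x)"
    using mp_integral_linear[OF b, of "\<lambda>l. l" "\<lambda>_. 1" \<sigma> "- (\<sigma> * x)"] mp_mean_one[OF b] mp_integral_one[OF b]
    by (simp add: mp_ok_cont mp_mean_def algebra_simps)
  have "((\<lambda>M. (\<integral>y. y \<partial>Y_dist M) * (\<sigma> * (1 - x))) \<longlongrightarrow> 1 * (\<sigma> * (1 - x))) at_top"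
    by (intro tendsto_mult tendsto_const Y_dist_mean_limit)
  then have "eventually (\<lambda>M. t < (\<integral>y. y \<partial>Y_dist M) * (\<sigma> * (1 - x))) at_top"
    by (rule order_tendstoD) (use t in simp)
  then obtain M1 where M1: "\<And>M. M \<ge> M1 \<Longrightarrow> t < (\<integral>y. y \<partial>Y_dist M) * (\<sigma> * (1 - x))"
    unfolding eventually_at_top_linorder by blast
  \<comment> \<open>\<open>M1\<close> puts the slope at 0 beyond \<open>t\<close>; the last entry is
    the coercivity condition at level \<open>t - 1\<close>, the one that
    \<open>lower_tail_limit\<close> asks for.\<close>
  define M0 where "M0 = max (max 2 M1) (2 * (B + 2 - t) / A)"
  show ?thesis
  proof (rule exI[of _ M0], intro conjI allI impI)
    show "M0 > 0" by (simp add: M0_def)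
    fix M assume "M0 \<le> M"
    then have Mge: "M \<ge> 2" "M \<ge> M1" "2 * (B + 2 - t) / A \<le> M" by (auto simp: M0_def)
    then have Mpos: "M > 0" by simp
    interpret bounded_law "Y_dist M" M by (rule bounded_law_Y_dist[OF Mpos])
    note pr = Y_dist_prob_right[OF Mpos] and pl = Y_dist_prob_left[OF Mpos]
    let ?Psi = "limit_cgf \<beta> ?a" and ?D = "limit_slope \<beta> ?a"
    interpret sc: smooth_convex ?Psi ?D "M^2 / 8 * mp_integral \<beta> (\<lambda>l. ?a l ^ 2)"
      by (rule smooth_convex_limit_cgf[OF b a])
    have D0: "t < ?D 0" using M1[OF Mge(2)] by (simp add: limit_slope_0[OF b a] int_a)
    have "A > 0" using neg by (simp only: A_def)
    then have "2 * (B + 1 - (t - 1)) \<le> M * A" using Mge(3) by (simp add: pos_divide_le_eq)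
    then obtain K where K: "K > 0" "?Psi (- K) + K * (t - 1) > 0"
      using limit_cgf_coercive[OF b a Mge(1), of "t - 1"] neg pr[of "M / 2"] pl[of 1] Mpos
      unfolding A_def B_def by auto
    have K': "?Psi (- K) + K * t > 0" using K by (simp add: algebra_simps)
    have psi: "psi \<beta> x M (\<alpha> * \<sigma>) = ?Psi \<alpha>" for \<alpha>
      by (simp add: psi_def limit_cgf_def[OF b a] cgf_def mgf_def mgf_Y_def mult.assoc)
    obtain v where v: "(SUP \<alpha>. ereal (\<alpha> * t - ?Psi \<alpha>)) = ereal v" "(SUP \<alpha>\<in>{..<0}. ereal (\<alpha> * t - ?Psi \<alpha>)) = ereal v"
      "\<exists>a<0. v = a * t - ?Psi a" "\<And>\<alpha>. \<alpha> * t - ?Psi \<alpha> \<le> v"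
      using sc.legendre_sup[OF D0 K(1) K'] by blast
    have main: "(\<lambda>n. ln (lower_prob n (\<lambda>i. \<sigma> * (ls n ! i - x)) t) / n) \<longlonglongrightarrow> - v"
      if "mp_sequence \<beta> ls" for ls
    proof -
      from that have ls: "\<And>n. length (ls n) = n" "\<And>n l. l \<in> set (ls n) \<Longrightarrow> l \<ge> 0"
        "\<And>s. s > 0 \<Longrightarrow> s \<in> \<rat> \<Longrightarrow> (\<lambda>n. (\<Sum>l\<leftarrow>ls n. 1 / (l + s)) / n) \<longlonglongrightarrow> mp_integral \<beta> (\<lambda>l. 1 / (l + s))"
        "(\<lambda>n. (\<Sum>l\<leftarrow>ls n. l) / n) \<longlonglongrightarrow> 1"
        unfolding mp_sequence_def by auto
      let ?c = "\<lambda>n i. \<sigma> * (ls n ! i - x)"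
      have conv: "(\<lambda>n. mean_cgf n (?c n) \<alpha>) \<longlonglongrightarrow> ?Psi \<alpha>" for \<alpha>
      proof -
        obtain L where L: "((\<lambda>l. cgf ((\<alpha> * \<sigma>) * (l - x)) / (1 + l)) \<longlongrightarrow> L) at_top"
          using cgf_slope_limit[OF pr pl] by blast
        have "(\<lambda>n. (\<Sum>l\<leftarrow>ls n. cgf (\<alpha> * ?a l)) / n) \<longlonglongrightarrow> mp_integral \<beta> (\<lambda>l. cgf (\<alpha> * ?a l))"
          using L by (intro empirical_convergence[OF b ls cont_cgf[OF b a]]) (simp_all only: mult.assoc)
        moreover have "(\<Sum>l\<leftarrow>ls n. cgf (\<alpha> * ?a l)) = (\<Sum>i<n. cgf (\<alpha> * ?c n i))" for n
          using ls(1) by (simp add: sum_list_sum_nth atLeast0LessThan)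
        ultimately show ?thesis by (simp add: mean_cgf_def limit_cgf_def[OF b a])
      qed
      show ?thesis
      proof (rule sc.lower_tail_limit[OF D0 K conv])
        show "\<alpha> * t - ?Psi \<alpha> \<le> v" for \<alpha> by (rule v(4))
        show "\<exists>a<0. v = a * t - ?Psi a" by (rule v(3))
      qed (rule lower_prob_chernoff lower_prob_tilt; assumption)+
    qed
    have "tail_rate \<beta> x M \<sigma> t v"
      unfolding tail_rate_def psi using v(1,2) main by blast
    then show "\<exists>v. tail_rate \<beta> x M \<sigma> t v" ..
  qed
qed

lemma cond_prob_le_eq:
  assumes M: "M > 0" and n: "n > 0" and ls: "length ls = n"
  shows "cond_prob_le M x t ls = bounded_law.lower_prob (Y_dist M) n (\<lambda>i. 1 * (ls ! i - x)) t"
proof -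
  have e: "(1 / real n * S \<le> t) = (S \<le> n * t)" for S using n by (simp add: field_simps)
  show ?thesis unfolding cond_prob_le_def bounded_law.lower_prob_def[OF bounded_law_Y_dist[OF M]] ls e by simp
qed

lemma cond_prob_ge_eq:
  assumes M: "M > 0" and n: "n > 0" and ls: "length ls = n"
  shows "cond_prob_ge M x t ls = bounded_law.lower_prob (Y_dist M) n (\<lambda>i. (- 1) * (ls ! i - x)) (- t)"
proof -
  have e: "(1 / real n * S \<ge> t) = (- S \<le> n * (- t))" for S using n by (simp add: field_simps)
  have s: "(\<Sum>i<n. (- 1) * (ls ! i - x) * y i) = - (\<Sum>i<n. (ls ! i - x) * y i)" for y :: "nat \<Rightarrow> real"
    by (simp add: sum_negf left_diff_distrib sum_subtractf)
  show ?thesis unfolding cond_prob_ge_def bounded_law.lower_prob_def[OF bounded_law_Y_dist[OF M]] ls e s ..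
qed

lemma AE_mp_sequence:
  assumes G: "gaussian_model \<Omega> m H" and lim: "(\<lambda>n. real (m n) / real n) \<longlonglongrightarrow> 1 / \<beta>" and b: "\<beta> > 0"
  shows "AE \<omega> in \<Omega>. mp_sequence \<beta> (\<lambda>n. sample_cov_eigvals n (m n) (H n \<omega>))"
proof -
  have "AE \<omega> in \<Omega>.
     (\<forall>s\<in>{0<..} \<inter> \<rat>. (\<lambda>n. (\<Sum>l\<leftarrow>sample_cov_eigvals n (m n) (H n \<omega>). 1 / (l + s)) / n)
         \<longlonglongrightarrow> mp_integral \<beta> (\<lambda>l. 1 / (l + s))) \<and>
     (\<lambda>n. (\<Sum>l\<leftarrow>sample_cov_eigvals n (m n) (H n \<omega>). l) / n) \<longlonglongrightarrow> 1"
    by (rule AE_empirical_stieltjes[OF G lim b]) (use mp_stieltjes[OF b] in auto)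
  then show ?thesis
    by eventually_elim (simp add: mp_sequence_def sample_cov_eigvals_basic)
qed

text \<open>\<open>P\<close> stands for either conditional probability. The identification with
  \<open>lower_prob\<close> is asked for positive \<open>n\<close>, which is enough for a
  limit.\<close>

lemma AE_tail_limit:
  fixes P :: "real list \<Rightarrow> real"
  assumes G: "gaussian_model \<Omega> m H" and lim: "(\<lambda>n. real (m n) / real n) \<longlonglongrightarrow> 1 / \<beta>" and b: "\<beta> > 0"
    and rate: "tail_rate \<beta> x M \<sigma> t v"
    and P: "\<And>n ls. n > 0 \<Longrightarrow> length ls = n \<Longrightarrow> P ls = bounded_law.lower_prob (Y_dist M) n (\<lambda>i. \<sigma> * (ls ! i - x)) t"
  shows "AE \<omega> in \<Omega>. (\<lambda>n. ereal (ln (P (sample_cov_eigvals n (m n) (H n \<omega>))) / real n)) \<longlonglongrightarrow> - ereal v"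
  using AE_mp_sequence[OF G lim b]
proof eventually_elim
  case (elim \<omega>)
  let ?ls = "\<lambda>n. sample_cov_eigvals n (m n) (H n \<omega>)"
  have "(\<lambda>n. ln (bounded_law.lower_prob (Y_dist M) n (\<lambda>i. \<sigma> * (?ls n ! i - x)) t) / n) \<longlonglongrightarrow> - v"
    using rate elim unfolding tail_rate_def by blast
  moreover have "eventually (\<lambda>n. ln (bounded_law.lower_prob (Y_dist M) n (\<lambda>i. \<sigma> * (?ls n ! i - x)) t) / n
      = ln (P (?ls n)) / n) sequentially"
    using eventually_gt_at_top[of 0]
    by eventually_elim (simp only: P[OF _ sample_cov_eigvals_basic(1)])
  ultimately have "(\<lambda>n. ln (P (?ls n)) / n) \<longlonglongrightarrow> - v" by (rule Lim_transform_eventually)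
  then show ?case by simp
qed

theorem theorem6:
  fixes \<beta> x :: real
  assumes "\<beta> > 0"
    and "mp_minus_t \<beta> < x" and "x < mp_plus \<beta>"
  shows
   "(\<forall>t < mp_mean \<beta> - x. \<exists>M0>0. \<forall>M \<ge> M0.
       psi_star \<beta> x M t = psi_sup \<beta> x M {..<0} t \<and>
       (\<forall>(\<Omega> :: 'w measure) m H.
          gaussian_model \<Omega> m H \<and> (\<lambda>n. real (m n) / real n) \<longlonglongrightarrow> 1 / \<beta> \<longrightarrow>
          (AE \<omega> in \<Omega>. (\<lambda>n. ereal (ln (cond_prob_le M x t
                 (sample_cov_eigvals n (m n) (H n \<omega>))) / real n))
               \<longlonglongrightarrow> - psi_star \<beta> x M t)))
  \<and> (\<forall>t > mp_mean \<beta> - x. \<exists>M0>0. \<forall>M \<ge> M0.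
       psi_star \<beta> x M t = psi_sup \<beta> x M {0<..} t \<and>
       (\<forall>(\<Omega> :: 'w measure) m H.
          gaussian_model \<Omega> m H \<and> (\<lambda>n. real (m n) / real n) \<longlonglongrightarrow> 1 / \<beta> \<longrightarrow>
          (AE \<omega> in \<Omega>. (\<lambda>n. ereal (ln (cond_prob_ge M x t
                 (sample_cov_eigvals n (m n) (H n \<omega>))) / real n))
               \<longlonglongrightarrow> - psi_star \<beta> x M t)))"
proof (intro conjI allI impI)
  note b = assms(1)
  note sides = mp_both_sides[OF assms]
  fix t assume "t < mp_mean \<beta> - x"
  then have t: "t < 1 * (1 - x)" by (simp add: mp_mean_one[OF b])
  \<comment> \<open>The lower tail draws its coercivity from eigenvalues to the left of
    \<open>x\<close>, whose weights are negative.\<close>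
  have neg: "mp_integral \<beta> (\<lambda>l. max 0 (- (1 * (l - x)))) > 0" using sides(2) by simp
  have "1 \<noteq> (0::real)" by simp
  from lower_tail_theorem[OF b this neg t]
  obtain M0 where M0: "M0 > 0" and rate: "\<And>M. M \<ge> M0 \<Longrightarrow> \<exists>v. tail_rate \<beta> x M 1 t v" by blast
  show "\<exists>M0>0. \<forall>M \<ge> M0.
       psi_star \<beta> x M t = psi_sup \<beta> x M {..<0} t \<and>
       (\<forall>(\<Omega> :: 'w measure) m H.
          gaussian_model \<Omega> m H \<and> (\<lambda>n. real (m n) / real n) \<longlonglongrightarrow> 1 / \<beta> \<longrightarrow>
          (AE \<omega> in \<Omega>. (\<lambda>n. ereal (ln (cond_prob_le M x t
                 (sample_cov_eigvals n (m n) (H n \<omega>))) / real n))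
               \<longlonglongrightarrow> - psi_star \<beta> x M t))"
  proof (intro exI[of _ M0] conjI allI impI M0)
    fix M assume M: "M \<ge> M0"
    then have Mpos: "M > 0" using M0 by simp
    from rate[OF M] obtain v where v: "tail_rate \<beta> x M 1 t v" by blast
    then have star: "psi_star \<beta> x M t = ereal v" and half: "psi_sup \<beta> x M {..<0} t = ereal v"
      by (simp_all add: tail_rate_def psi_star_def psi_sup_def)
    show "psi_star \<beta> x M t = psi_sup \<beta> x M {..<0} t" unfolding star half ..
    fix \<Omega> :: "'w measure" and m H
    assume G: "gaussian_model \<Omega> m H \<and> (\<lambda>n. real (m n) / real n) \<longlonglongrightarrow> 1 / \<beta>"
    show "AE \<omega> in \<Omega>. (\<lambda>n. ereal (ln (cond_prob_le M x t (sample_cov_eigvals n (m n) (H n \<omega>))) / real n)) \<longlonglongrightarrow> - psi_star \<beta> x M t"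
      unfolding star
      by (rule AE_tail_limit[OF conjunct1[OF G] conjunct2[OF G] b v]) (rule cond_prob_le_eq[OF Mpos])
  qed
next
  note b = assms(1)
  note sides = mp_both_sides[OF assms]
  fix t assume "t > mp_mean \<beta> - x"
  \<comment> \<open>Reversing the sign of the weights and of the level turns the upper tail into a
    lower tail; now the mass to the right of \<open>x\<close> provides coercivity.\<close>
  then have t: "- t < (- 1) * (1 - x)" by (simp add: mp_mean_one[OF b])
  have neg: "mp_integral \<beta> (\<lambda>l. max 0 (- ((- 1) * (l - x)))) > 0" using sides(1) by simp
  have "(- 1) \<noteq> (0::real)" by simp
  from lower_tail_theorem[OF b this neg t]
  obtain M0 where M0: "M0 > 0" and rate: "\<And>M. M \<ge> M0 \<Longrightarrow> \<exists>v. tail_rate \<beta> x M (- 1) (- t) v" by blast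
  show "\<exists>M0>0. \<forall>M \<ge> M0.
       psi_star \<beta> x M t = psi_sup \<beta> x M {0<..} t \<and>
       (\<forall>(\<Omega> :: 'w measure) m H.
          gaussian_model \<Omega> m H \<and> (\<lambda>n. real (m n) / real n) \<longlonglongrightarrow> 1 / \<beta> \<longrightarrow>
          (AE \<omega> in \<Omega>. (\<lambda>n. ereal (ln (cond_prob_ge M x t
                 (sample_cov_eigvals n (m n) (H n \<omega>))) / real n))
               \<longlonglongrightarrow> - psi_star \<beta> x M t))"
  proof (intro exI[of _ M0] conjI allI impI M0)
    fix M assume M: "M \<ge> M0"
    then have Mpos: "M > 0" using M0 by simp
    from rate[OF M] obtain v where v: "tail_rate \<beta> x M (- 1) (- t) v" by blast
    \<comment> \<open>Replacing \<alpha> by its negative leaves the objective intact and exchanges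
      the half-lines.\<close>
    have flip: "(SUP \<alpha>\<in>A. ereal (\<alpha> * (- t) - psi \<beta> x M (\<alpha> * (- 1)))) = psi_sup \<beta> x M (uminus ` A) t" for A
      by (simp add: psi_sup_def image_image)
    have "uminus ` {..<0::real} = {0<..}" by (simp add: image_uminus_lessThan)
    then have star: "psi_star \<beta> x M t = ereal v" and half: "psi_sup \<beta> x M {0<..} t = ereal v"
      using v unfolding tail_rate_def flip by (simp_all add: psi_star_def)
    show "psi_star \<beta> x M t = psi_sup \<beta> x M {0<..} t" unfolding star half ..
    fix \<Omega> :: "'w measure" and m H
    assume G: "gaussian_model \<Omega> m H \<and> (\<lambda>n. real (m n) / real n) \<longlonglongrightarrow> 1 / \<beta>"
    show "AE \<omega> in \<Omega>. (\<lambda>n. ereal (ln (cond_prob_ge M x t (sample_cov_eigvals n (m n) (H n \<omega>))) / real n)) \<longlonglongrightarrow> - psi_star \<beta> x M t"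
      unfolding star
      by (rule AE_tail_limit[OF conjunct1[OF G] conjunct2[OF G] b v]) (rule cond_prob_ge_eq[OF Mpos])
  qed
qed

end
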